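(* Assuming the Elliott--Halberstam Conjecture, there exist infinitely many pairs of primes $(p,q)$ such that $p-q\in\mathcal{S}(5)$.
   Context: An integer is $y$-smooth if its largest prime factor is less than or equal to $y$; equivalently, every prime dividing it is at most $y$ (so $\pm1$ are $y$-smooth, the sign is irrelevant, and $0$, being divisible by every prime, is not $y$-smooth). $\mathcal{S}(y)$ denotes the set of all $y$-smooth integers. Elliott--Halberstam Conjecture: for every $0<\theta<1$ and every $A>0$, $$\sum_{q\le x^{\theta}}\ \max_{\gcd(a,q)=1}\left|\pi(x;q,a)-\frac{\pi(x)}{\varphi(q)}\right|\ll_{\theta,A}\frac{x}{(\log x)^{A}},$$ where $\pi(x)$ is the number of primes up to $x$, $\pi(x;q,a)$ is the number of those congruent to $a$ modulo $q$, and $\varphi$ is Euler's function. *)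

theory Defs
  imports
    "HOL-Number_Theory.Totient"
    "HOL-Number_Theory.Cong"
    "HOL-Library.Landau_Symbols"
begin

text \<open>Zero, being divisible by every prime, is not smooth; plus and minus one are smooth.\<close>

definition smooth_ints :: "real \<Rightarrow> int set" where
  "smooth_ints y = {n. \<forall>p::nat. prime p \<longrightarrow> int p dvd n \<longrightarrow> real p \<le> y}"

definition primes_pi :: "real \<Rightarrow> nat" where
  "primes_pi x = card {p::nat. prime p \<and> real p \<le> x}"

definition primes_pi_mod :: "real \<Rightarrow> nat \<Rightarrow> nat \<Rightarrow> nat" where
  "primes_pi_mod x q a = card {p::nat. prime p \<and> real p \<le> x \<and> [p = a] (mod q)}"

text \<open>
  The count \<open>primes_pi_mod x q a\<close> depends only on the residue class of \<open>a\<close> modulo \<open>q\<close>, so the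
  maximum over all \<open>a\<close> coprime to \<open>q\<close> is taken over the representatives \<open>totatives q\<close>, which is
  finite and nonempty for \<open>q \<ge> 1\<close> (for \<open>q = 1\<close> it is \<open>{1}\<close>).
\<close>

definition EH_error :: "real \<Rightarrow> nat \<Rightarrow> real" where
  "EH_error x q =
     (MAX a\<in>totatives q.
        \<bar>real (primes_pi_mod x q a) - real (primes_pi x) / real (totient q)\<bar>)"

text \<open>The bound is for \<open>x\<close> tending to infinity, with constants depending on \<open>\<theta>\<close> and \<open>A\<close>.\<close>

definition Elliott_Halberstam :: bool where
  "Elliott_Halberstam \<longleftrightarrow>
     (\<forall>\<theta> A :: real. 0 < \<theta> \<longrightarrow> \<theta> < 1 \<longrightarrow> 0 < A \<longrightarrow>
        (\<lambda>x. \<Sum>q | 1 \<le> q \<and> real q \<le> x powr \<theta>. EH_error x q)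
          \<in> O[at_top](\<lambda>x. x / ln x powr A))"

end

theory Submission
  imports Defs "HOL-Analysis.Analysis" "HOL-Real_Asymp.Real_Asymp"
begin

text \<open>
  The proof follows Goldston, Pintz and Yildirim. All differences of the six shifts
  \<open>0, 4, 6, 10, 12, 16\<close> are composed of the primes 2, 3 and 5. Hence it suffices that for arbitrarily
  large \<open>n\<close> two of the numbers \<open>n + h\<close> are prime. If at most one of them were prime for all large
  \<open>n\<close>, then for every nonnegative weight the six sums of the weight over those \<open>N < n \<le> 2 * N\<close> for
  which a given \<open>n + h\<close> is prime would together not exceed the sum of the weight over all these \<open>n\<close>.

  A weight that violates this is supported on a residue class modulo \<open>W\<close>, the product of the primes up
  to a constant \<open>w\<close>, in which all \<open>n + h\<close> are coprime to \<open>W\<close>; there it is the square of a sum of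
  coefficients \<open>\<lambda>(d)\<close> over the divisors \<open>d \<le> R\<close> of the product of the \<open>n + h\<close>, with
  \<open>R = N powr 0.495\<close>. Expanding the square and counting in residue classes leads to quadratic forms in
  \<open>\<lambda>\<close>, with \<open>6 / p\<close> as density at \<open>p\<close> for all integers (\<open>sieve_sum_upper\<close>) and \<open>5 / (p - 1)\<close> for the
  primes (\<open>sieve_sum_primes_lower\<close>). The moduli of the second count reach almost up to \<open>N\<close>; its errors
  are negligible by the Elliott--Halberstam conjecture (\<open>EH_weighted_sum\<close>).

  Selberg's change of variables from \<open>\<lambda>\<close> to \<open>y\<close> diagonalizes the first form, and expresses the second
  one through sums of \<open>y\<close> over multiples (\<open>form_all_eq\<close>, \<open>form_primes_lower\<close>). For
  \<open>y(r) = ln R + 12 * ln (R / r)\<close> both reduce to moments of \<open>ln (R / r)\<close> against multiplicative weights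
  of dimension six and five. An induction on the dimension evaluates them (\<open>log_moment_dim_upper\<close>,
  \<open>log_moment_dim_lower\<close>). With \<open>\<alpha>\<close> the density of the integers coprime to \<open>W\<close> and \<open>l = ln R\<close>, the first
  form is at most \<open>(67 / 5040) * \<alpha>^6 * l^8\<close>, up to a factor close to 1 for large \<open>w\<close> and lower powers of \<open>l\<close>,
  and the second is at least \<open>(23 / 5040) * \<alpha>^7 * l^9\<close>. As there are about \<open>N / ln N = 0.495 * N / l\<close>
  primes in the interval, the six sums over primes win by the factor \<open>6 * 0.495 * 23 / 67 > 1\<close>. That
  many primes are needed only for arbitrarily large \<open>N\<close>, not for all, which is elementary
  (\<open>dyadic_primes_lower\<close>).
\<close>

section \<open>Squarefree numbers as finite sets of primes\<close>

text \<open>A squarefree number is represented by the set of its prime factors, and its value is the product.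
  Divisibility, greatest common divisor, least common multiple and coprimality become inclusion,
  intersection, union and disjointness, and a multiplicative function becomes a product over a set.\<close>

abbreviation val :: "nat set \<Rightarrow> real" where
  "val S \<equiv> real (\<Prod>S)"

text \<open>The set \<open>E\<close> of excluded numbers has a fixed part, the numbers up to the sieving limit, and a
  varying part, the primes of another squarefree number to which these must be coprime.\<close>

definition sqfree :: "nat set \<Rightarrow> real \<Rightarrow> nat set set" where
  "sqfree E z = {S. finite S \<and> (\<forall>p\<in>S. prime p) \<and> S \<inter> E = {} \<and> val S \<le> z}"

abbreviation rough :: "nat \<Rightarrow> real \<Rightarrow> nat set set" where
  "rough w \<equiv> sqfree {..w}"

lemma prod_primes_pos:
  fixes S :: "nat set"
  assumes "\<forall>p\<in>S. prime p"
  shows "\<Prod>S > 0"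
  using assms by (intro prod_pos) (auto dest: prime_gt_0_nat)

lemma prime_factors_prod_primes:
  fixes S :: "nat set"
  assumes "finite S" "\<forall>p\<in>S. prime p"
  shows "prime_factors (\<Prod>S) = S"
proof -
  have "0 \<notin> (\<lambda>p. p) ` S" using assms by auto
  then have "prime_factors (\<Prod>S) = \<Union>((prime_factors \<circ> (\<lambda>p. p)) ` S)"
    using prime_factors_prod[of S "\<lambda>p. p"] assms by simp
  also have "\<dots> = S" using assms by (auto simp: prime_prime_factors)
  finally show ?thesis .
qed

lemma inj_on_prod_primes: "inj_on (\<lambda>S. \<Prod>S :: nat) {S. finite S \<and> (\<forall>p\<in>S. prime p)}"
  by (rule inj_on_inverseI[where g = prime_factors]) (simp add: prime_factors_prod_primes)

lemma prod_primes_dvd_iff: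
  fixes S :: "nat set"
  assumes "finite S" "\<forall>p\<in>S. prime p"
  shows "\<Prod>S dvd n \<longleftrightarrow> (\<forall>p\<in>S. p dvd n)"
proof
  assume "\<Prod>S dvd n"
  then show "\<forall>p\<in>S. p dvd n" using assms(1) by (meson dvd_prodI dvd_trans)
next
  assume *: "\<forall>p\<in>S. p dvd n"
  show "\<Prod>S dvd n" using assms *
  proof (induction S rule: finite_induct)
    case (insert p S)
    have "coprime p (\<Prod>S)"
      using insert by (intro prod_coprime_right) (metis insertCI primes_coprime)
    then show ?case using insert by (simp add: divides_mult)
  qed auto
qed

lemma sqfreeD:
  assumes "S \<in> sqfree E z"
  shows "finite S" "\<And>p. p \<in> S \<Longrightarrow> prime p" "S \<inter> E = {}" "val S \<le> z" "val S \<ge> 1"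
proof -
  show "finite S" "\<And>p. p \<in> S \<Longrightarrow> prime p" "S \<inter> E = {}" "val S \<le> z"
    using assms by (auto simp: sqfree_def)
  then have "\<Prod>S > 0" by (intro prod_primes_pos) auto
  then show "val S \<ge> 1" by linarith
qed

lemma sqfree_le:
  assumes "S \<in> sqfree E z" "p \<in> S"
  shows "real p \<le> z"
proof -
  have "p dvd \<Prod>S" using assms sqfreeD(1) by (meson dvd_prodI)
  then have "p \<le> \<Prod>S" using sqfreeD[OF assms(1)] prod_primes_pos by (metis dvd_imp_le)
  then show ?thesis using sqfreeD(4)[OF assms(1)] by linarith
qed

lemma finite_sqfree [simp]: "finite (sqfree E z)"
proof -
  have "sqfree E z \<subseteq> Pow {..nat \<lfloor>z\<rfloor>}"
    using sqfree_le by (auto simp: le_nat_floor)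
  then show ?thesis by (rule finite_subset) auto
qed

lemma sqfree_subset:
  assumes "S \<in> sqfree E z" "T \<subseteq> S"
  shows "T \<in> sqfree E z"
proof -
  note S = sqfreeD[OF assms(1)]
  have "\<Prod>T dvd \<Prod>S" using S assms by (intro prod_dvd_prod_subset)
  then have "\<Prod>T \<le> \<Prod>S" using S prod_primes_pos by (metis dvd_imp_le)
  then have "val T \<le> val S" by linarith
  then have "val T \<le> z" using S(4) by linarith
  then show ?thesis using S assms finite_subset by (auto simp: sqfree_def)
qed

lemma sqfree_mono: "E' \<subseteq> E \<Longrightarrow> z \<le> z' \<Longrightarrow> sqfree E z \<subseteq> sqfree E' z'"
  by (auto simp: sqfree_def)

lemma empty_in_sqfree [simp]: "1 \<le> z \<Longrightarrow> {} \<in> sqfree E z"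
  by (auto simp: sqfree_def)

lemma sqfree_Un:
  assumes T: "T \<in> sqfree E z" and C: "C \<in> sqfree (E \<union> T) (z / val T)"
  shows "T \<union> C \<in> sqfree E z" "T \<inter> C = {}" "z / val (T \<union> C) = z / val T / val C"
proof -
  note TD = sqfreeD[OF T] and CD = sqfreeD[OF C]
  show disj: "T \<inter> C = {}" using CD(3) by blast
  have "\<Prod>(T \<union> C) = \<Prod>T * \<Prod>C" using TD CD disj by (intro prod.union_disjoint) auto
  then have "val (T \<union> C) \<le> z" "z / val (T \<union> C) = z / val T / val C"
    using TD CD by (simp_all add: field_simps)
  then show "T \<union> C \<in> sqfree E z" "z / val (T \<union> C) = z / val T / val C"
    using TD CD by (auto simp: sqfree_def)
qed

lemma sqfree_Diff:
  assumes S: "S \<in> sqfree E z" and "T \<subseteq> S"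
  shows "S - T \<in> sqfree (E \<union> T) (z / val T)"
proof -
  note SD = sqfreeD[OF S] and TD = sqfreeD[OF sqfree_subset[OF assms]]
  have "\<Prod>S = \<Prod>(S - T) * \<Prod>T" using assms(2) SD by (intro prod.subset_diff) auto
  then have "val (S - T) \<le> z / val T" using SD TD by (simp add: field_simps)
  then show ?thesis using SD by (auto simp: sqfree_def)
qed

text \<open>The squarefree multiples of \<open>U\<close> are the products of \<open>U\<close> with a cofactor coprime to it.\<close>

lemma sum_upsets:
  fixes f :: "nat set \<Rightarrow> 'a::comm_monoid_add"
  assumes U: "U \<in> sqfree E z"
  shows "(\<Sum>V | V \<in> sqfree E z \<and> U \<subseteq> V. f V) =
    (\<Sum>C\<in>sqfree (E \<union> U) (z / val U). f (U \<union> C))"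
  by (rule sum.reindex_bij_witness[where i = "\<lambda>C. U \<union> C" and j = "\<lambda>V. V - U"])
    (use sqfree_Un[OF U] sqfree_Diff in \<open>auto simp: Un_absorb1\<close>)

text \<open>Coprime factorizations of a squarefree number, summed by the first factor. This is the Dirichlet
  convolution on squarefree numbers and drives every induction on the dimension of a sum below.\<close>

lemma sum_factor_pairs:
  fixes f :: "nat set \<Rightarrow> nat set \<Rightarrow> 'a::comm_monoid_add"
  shows "(\<Sum>S\<in>sqfree E z. \<Sum>T\<in>Pow S. f T (S - T)) =
    (\<Sum>T\<in>sqfree E z. \<Sum>C\<in>sqfree (E \<union> T) (z / val T). f T C)"
proof -
  let ?F = "sqfree E z" and ?G = "\<lambda>T. sqfree (E \<union> T) (z / val T)"
  have "(\<Sum>S\<in>?F. \<Sum>T\<in>Pow S. f T (S - T)) =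
      (\<Sum>S\<in>?F. \<Sum>T | T \<in> ?F \<and> T \<subseteq> S. f T (S - T))"
    by (intro sum.cong) (auto dest: sqfree_subset)
  also have "\<dots> = (\<Sum>T\<in>?F. \<Sum>S | S \<in> ?F \<and> T \<subseteq> S. f T (S - T))"
    by (rule sum.swap_restrict) auto
  also have "\<dots> = (\<Sum>T\<in>?F. \<Sum>C\<in>?G T. f T (T \<union> C - T))"
    by (intro sum.cong refl sum_upsets)
  also have "\<dots> = (\<Sum>T\<in>?F. \<Sum>C\<in>?G T. f T C)"
  proof (intro sum.cong refl)
    fix T C assume "T \<in> ?F" "C \<in> ?G T"
    then have "T \<union> C - T = C" using sqfree_Un(2) by blast
    then show "f T (T \<union> C - T) = f T C" by simp
  qed
  finally show ?thesis .
qed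

section \<open>Logarithmic moments\<close>

text \<open>The powers of \<open>ln (z / S)\<close> are the smooth weights of the sieve. The passage from one exponent
  to the next is an integration over \<open>ln z\<close>, so bounds for the plain sums, \<open>m = 0\<close>, give bounds
  for all moments without any partial summation.\<close>

definition log_moment :: "nat set \<Rightarrow> (nat \<Rightarrow> real) \<Rightarrow> nat \<Rightarrow> real \<Rightarrow> real" where
  "log_moment E g m z = (\<Sum>S\<in>sqfree E z. (\<Prod>p\<in>S. g p) * ln (z / val S) ^ m)"

lemma has_integral_shifted_power:
  fixes a X :: real
  assumes "0 \<le> a" "a \<le> X"
  shows "((\<lambda>v. if a \<le> v then (v - a) ^ m else 0) has_integral (X - a) ^ Suc m / Suc m) {0..X}"
proof -
  have "((\<lambda>v. (v - a) ^ m) has_integral (X - a) ^ Suc m / Suc m - (a - a) ^ Suc m / Suc m) {a..X}"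
    using assms
    by (intro fundamental_theorem_of_calculus)
      (auto intro!: derivative_eq_intros simp: has_real_derivative_iff_has_vector_derivative[symmetric] simp del: power_Suc)
  then have "((\<lambda>v. (v - a) ^ m) has_integral (X - a) ^ Suc m / Suc m) {a..X}" by simp
  then have "((\<lambda>v. if v \<in> {a..X} then (v - a) ^ m else 0) has_integral (X - a) ^ Suc m / Suc m) {0..X}"
    by (subst has_integral_restrict) (use assms in auto)
  then show ?thesis
    by (rule has_integral_eq[rotated]) auto
qed

lemma log_moment_eq:
  assumes "v \<le> X"
  shows "log_moment E g m (exp v) = (\<Sum>S\<in>sqfree E (exp X). (\<Prod>p\<in>S. g p) *
    (if ln (val S) \<le> v then (v - ln (val S)) ^ m else 0))"
proof -
  let ?t = "\<lambda>S. if ln (val S) \<le> v then (v - ln (val S)) ^ m else 0"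
  have *: "ln (val S) \<le> v \<longleftrightarrow> val S \<le> exp v"
    if "S \<in> sqfree E (exp X)" for S
    using sqfreeD(5)[OF that] by (smt (verit) exp_ln ln_exp ln_le_cancel_iff exp_le_cancel_iff)
  have "log_moment E g m (exp v) = (\<Sum>S\<in>sqfree E (exp v). (\<Prod>p\<in>S. g p) *
    ?t S)"
    unfolding log_moment_def
  proof (rule sum.cong)
    fix S assume S: "S \<in> sqfree E (exp v)"
    then have "S \<in> sqfree E (exp X)" using assms sqfree_mono[of E E "exp v" "exp X"] by auto
    then have "ln (val S) \<le> v" using * sqfreeD(4)[OF S] by blast
    moreover have "ln (exp v / val S) = v - ln (val S)"
      using sqfreeD(5)[OF S] by (subst ln_div) (simp_all del: of_nat_prod)
    ultimately show "(\<Prod>p\<in>S. g p) * ln (exp v / val S) ^ m = (\<Prod>p\<in>S. g p) *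
    ?t S"
      by (simp del: of_nat_prod)
  qed simp
  also have "\<dots> = (\<Sum>S\<in>sqfree E (exp X). (\<Prod>p\<in>S. g p) *
    ?t S)"
  proof (rule sum.mono_neutral_left)
    show "sqfree E (exp v) \<subseteq> sqfree E (exp X)" using assms sqfree_mono[of E E] by auto
    show "\<forall>i\<in>sqfree E (exp X) - sqfree E (exp v). (\<Prod>p\<in>i. g p) *
        (if ln (real (\<Prod>i)) \<le> v then (v - ln (real (\<Prod>i))) ^ m else 0) = 0"
    proof
      fix S assume "S \<in> sqfree E (exp X) - sqfree E (exp v)"
      then have "\<not> ln (val S) \<le> v" using *[of S] by (auto simp: sqfree_def)
      then show "(\<Prod>p\<in>S. g p) * ?t S = 0"
        by simp
    qed
  qed simp
  finally show ?thesis .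
qed

text \<open>Each term integrates separately, since \<open>S\<close> enters the sum at \<open>ln z = ln S\<close> with weight \<open>0\<close>
  or, if \<open>m = 0\<close>, with a jump that the integral does not see.\<close>

lemma log_moment_has_integral:
  assumes "0 \<le> X"
  shows "((\<lambda>v. log_moment E g m (exp v)) has_integral log_moment E g (Suc m) (exp X) / Suc m) {0..X}"
proof -
  have "((\<lambda>v. \<Sum>S\<in>sqfree E (exp X). (\<Prod>p\<in>S. g p) *
      (if ln (val S) \<le> v then (v - ln (val S)) ^ m else 0)) has_integral
      (\<Sum>S\<in>sqfree E (exp X). (\<Prod>p\<in>S. g p) * ((X - ln (val S)) ^ Suc m / Suc m))) {0..X}"
  proof (intro has_integral_sum has_integral_mult_right has_integral_shifted_power finite_sqfree)
    fix S assume S: "S \<in> sqfree E (exp X)"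
    show "0 \<le> ln (val S)" using sqfreeD[OF S] by simp
    show "ln (val S) \<le> X"
      using sqfreeD(4,5)[OF S] by (smt (verit) exp_ln exp_le_cancel_iff)
  qed
  also have "(\<Sum>S\<in>sqfree E (exp X). (\<Prod>p\<in>S. g p) * ((X - ln (val S)) ^ Suc m / Suc m)) =
     log_moment E g (Suc m) (exp X) / Suc m"
    unfolding log_moment_def sum_divide_distrib
  proof (intro sum.cong refl)
    fix S assume S: "S \<in> sqfree E (exp X)"
    have "ln (exp X / val S) = X - ln (val S)"
      using sqfreeD(5)[OF S] by (subst ln_div) (simp_all del: of_nat_prod)
    then show "(\<Prod>p\<in>S. g p) * ((X - ln (val S)) ^ Suc m / Suc m) =
        (\<Prod>p\<in>S. g p) * ln (exp X / val S) ^ Suc m / Suc m"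
      by (simp del: of_nat_prod)
  qed
  finally show ?thesis
    by (rule has_integral_eq[rotated]) (use log_moment_eq in auto)
qed

lemma log_moment_lower:
  assumes "\<And>z. 1 \<le> z \<Longrightarrow> c * ln z \<le> log_moment E g 0 z" and "1 \<le> z"
  shows "c * ln z ^ Suc m / Suc m \<le> log_moment E g m z"
  using assms(2)
proof (induction m arbitrary: z)
  case 0
  then show ?case using assms(1) by simp
next
  case (Suc m)
  define X where "X = ln z"
  have X: "0 \<le> X" "z = exp X" using Suc.prems by (auto simp: X_def)
  have i1: "((\<lambda>v. c / Suc m * v ^ Suc m) has_integral c / Suc m * (X ^ Suc (Suc m) / Suc (Suc m))) {0..X}"
    using has_integral_mult_right[OF has_integral_shifted_power[of 0 X "Suc m"], of "c / Suc m"] X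
    by (auto elim!: has_integral_eq[rotated])
  have "c / Suc m * (X ^ Suc (Suc m) / Suc (Suc m)) \<le> log_moment E g (Suc m) (exp X) / Suc m"
    by (rule has_integral_le[OF i1 log_moment_has_integral[OF X(1)]])
      (use Suc.IH[of "exp _"] in auto)
  then have "(c * X ^ Suc (Suc m) / Suc (Suc m)) / Suc m \<le> log_moment E g (Suc m) (exp X) / Suc m"
    by (simp add: mult_ac del: power_Suc)
  then have "c * X ^ Suc (Suc m) / Suc (Suc m) \<le> log_moment E g (Suc m) (exp X)"
    by (subst (asm) divide_le_cancel) (simp del: power_Suc)
  then show ?case unfolding X(2) by (simp del: power_Suc)
qed

lemma log_moment_upper:
  assumes "\<And>z. 1 \<le> z \<Longrightarrow> log_moment E g 0 z \<le> c * ln z + C" and "1 \<le> z"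
  shows "log_moment E g m z \<le> c * ln z ^ Suc m / Suc m + C * ln z ^ m"
  using assms(2)
proof (induction m arbitrary: z)
  case 0
  then show ?case using assms(1) by simp
next
  case (Suc m)
  define X where "X = ln z"
  have X: "0 \<le> X" "z = exp X" using Suc.prems by (auto simp: X_def)
  have i1: "((\<lambda>v. c / Suc m * v ^ Suc m) has_integral c / Suc m * (X ^ Suc (Suc m) / Suc (Suc m))) {0..X}"
    using has_integral_mult_right[OF has_integral_shifted_power[of 0 X "Suc m"], of "c / Suc m"] X
    by (auto elim!: has_integral_eq[rotated])
  have i2: "((\<lambda>v. C * v ^ m) has_integral C * (X ^ Suc m / Suc m)) {0..X}"
    using has_integral_mult_right[OF has_integral_shifted_power[of 0 X m], of C] X
    by (auto elim!: has_integral_eq[rotated])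
  have "log_moment E g (Suc m) (exp X) / Suc m \<le>
      c / Suc m * (X ^ Suc (Suc m) / Suc (Suc m)) + C * (X ^ Suc m / Suc m)"
    by (rule has_integral_le[OF log_moment_has_integral[OF X(1)] has_integral_add[OF i1 i2]])
      (use Suc.IH[of "exp _"] in auto)
  then have "log_moment E g (Suc m) (exp X) / Suc m \<le>
      (c * X ^ Suc (Suc m) / Suc (Suc m) + C * X ^ Suc m) / Suc m"
    by (simp add: mult_ac add_divide_distrib del: power_Suc)
  then have "log_moment E g (Suc m) (exp X) \<le> c * X ^ Suc (Suc m) / Suc (Suc m) + C * X ^ Suc m"
    by (subst (asm) divide_le_cancel) (simp del: power_Suc)
  then show ?case unfolding X(2) by (simp del: power_Suc)
qed

section \<open>Sums of dimension one\<close>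

definition sieve_density :: "nat set \<Rightarrow> real" where
  "sieve_density E = (\<Prod>p | p \<in> E \<and> prime p. 1 - 1 / real p)"

lemma sieve_density_pos: "sieve_density E > 0"
  unfolding sieve_density_def by (intro prod_pos) (auto dest: prime_gt_1_nat)

lemma sieve_density_Un:
  assumes "finite E" "finite S" "\<And>p. p \<in> S \<Longrightarrow> prime p" "S \<inter> E = {}"
  shows "sieve_density (E \<union> S) = sieve_density E * (\<Prod>p\<in>S. 1 - 1 / real p)"
proof -
  have "{p. p \<in> E \<union> S \<and> prime p} = {p. p \<in> E \<and> prime p} \<union> S" using assms by auto
  moreover have "(\<Prod>p\<in>{p. p \<in> E \<and> prime p} \<union> S. 1 - 1 / real p) =
      (\<Prod>p | p \<in> E \<and> prime p. 1 - 1 / real p) * (\<Prod>p\<in>S. 1 - 1 / real p)"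
    using assms by (intro prod.union_disjoint) auto
  ultimately show ?thesis unfolding sieve_density_def by simp
qed

text \<open>Part of the expansion of the Euler product over \<open>T\<close> into geometric series.\<close>

lemma sum_recip_smooth_le:
  assumes "finite T" "\<And>p. p \<in> T \<Longrightarrow> prime p" "finite X"
    and "\<And>n. n \<in> X \<Longrightarrow> n > 0 \<and> prime_factors n \<subseteq> T"
  shows "(\<Sum>n\<in>X. 1 / real n) \<le> (\<Prod>p\<in>T. 1 / (1 - 1 / real p))"
  using assms
proof (induction T arbitrary: X rule: finite_induct)
  case empty
  then have "X \<subseteq> {1}" by (auto simp: prime_factorization_empty_iff)
  then have "(\<Sum>n\<in>X. 1 / real n) \<le> (\<Sum>n\<in>{1}. 1 / real n)"
    by (intro sum_mono2) auto
  then show ?case by simp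
next
  case (insert p T)
  have p: "prime p" "p > 1" using insert.prems(1)[of p] prime_gt_1_nat by auto
  define B where "B = Max (insert 0 ((\<lambda>n. multiplicity p n) ` X))"
  define X' where "X' = (\<lambda>n. n div p ^ multiplicity p n) ` X"
  define \<phi> where "\<phi> = (\<lambda>n. (multiplicity p n, n div p ^ multiplicity p n))"
  define h where "h = (\<lambda>(i, m). 1 / (real p ^ i * real m))"
  \<comment> \<open>Splitting off the full power of \<open>p\<close> is injective.\<close>
  have eq: "n = p ^ multiplicity p n * (n div p ^ multiplicity p n)" for n
    by (simp add: multiplicity_dvd)
  have inj: "inj_on \<phi> X"
    by (rule inj_onI) (metis \<phi>_def eq prod.inject)
  have X': "m > 0 \<and> prime_factors m \<subseteq> T" if m: "m \<in> X'" for m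
  proof -
    obtain n where n: "n \<in> X" "m = n div p ^ multiplicity p n" using m by (auto simp: X'_def)
    have n0: "n > 0" "prime_factors n \<subseteq> insert p T" using insert.prems n by auto
    have "\<not> p dvd m" using n n0 p multiplicity_decompose[of n p] by auto
    moreover have "m dvd n" using n eq[of n] by (metis dvd_triv_right)
    moreover from this have "prime_factors m \<subseteq> insert p T"
      using n0 dvd_prime_factors[of n m] by auto
    ultimately show ?thesis using n0 dvd_pos_nat[of n m] by (auto dest: in_prime_factors_imp_dvd)
  qed
  have "(\<Sum>n\<in>X. 1 / real n) = (\<Sum>n\<in>X. h (\<phi> n))"
  proof (rule sum.cong)
    fix n assume "n \<in> X"
    have "real n = real p ^ multiplicity p n * real (n div p ^ multiplicity p n)"
      using eq[of n] by (metis of_nat_mult of_nat_power)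
    then show "1 / real n = h (\<phi> n)" by (simp add: h_def \<phi>_def)
  qed simp
  also have "\<dots> = sum h (\<phi> ` X)" using inj by (simp add: sum.reindex)
  also have "\<dots> \<le> sum h ({..B} \<times> X')"
  proof (rule sum_mono2)
    show "finite ({..B} \<times> X')" using insert.prems by (auto simp: X'_def)
    show "\<phi> ` X \<subseteq> {..B} \<times> X'"
      using insert.prems by (auto simp: \<phi>_def B_def X'_def intro!: Max_ge)
  qed (auto simp: h_def)
  also have "\<dots> = (\<Sum>i\<le>B. (1 / real p) ^ i) * (\<Sum>m\<in>X'. 1 / real m)"
    unfolding sum_product sum.cartesian_product h_def by (intro sum.cong) (auto simp: power_one_over)
  also have "\<dots> \<le> (1 / (1 - 1 / real p)) * (\<Prod>p\<in>T. 1 / (1 - 1 / real p))"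
  proof (rule mult_mono)
    have "(\<Sum>i\<le>B. (1 / real p) ^ i) = (1 - (1 / real p) ^ Suc B) / (1 - 1 / real p)"
      using p by (subst sum_gp0) auto
    also have "\<dots> \<le> 1 / (1 - 1 / real p)"
      using p by (intro divide_right_mono) auto
    finally show "(\<Sum>i\<le>B. (1 / real p) ^ i) \<le> 1 / (1 - 1 / real p)" .
    show "(\<Sum>m\<in>X'. 1 / real m) \<le> (\<Prod>p\<in>T. 1 / (1 - 1 / real p))"
      using insert X' by (intro insert.IH) (auto simp: X'_def)
  qed (use p in \<open>auto intro!: sum_nonneg\<close>)
  finally show ?case using insert by simp
qed

text \<open>Every \<open>n \<le> z\<close> is counted by the product \<open>C\<close> of its primes outside \<open>E\<close>. The numbers belonging to
  a given \<open>C\<close> are \<open>C\<close> times a number composed of primes of \<open>C\<close> and \<open>E\<close>, so their reciprocals sum to at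
  most \<open>1 / \<phi>(C)\<close> divided by the density of \<open>E\<close>, whereas all reciprocals up to \<open>z\<close> sum to at least
  \<open>ln z\<close>. That this holds for every \<open>z \<ge> 1\<close> and \<open>E\<close> without an error term keeps the lower bounds exact.\<close>

lemma one_dim_lower:
  assumes E: "finite E" and z: "1 \<le> z"
  shows "sieve_density E * ln z \<le> (\<Sum>C\<in>sqfree E z. \<Prod>p\<in>C. 1 / (real p - 1))"
proof -
  define N where "N = nat \<lfloor>z\<rfloor>"
  define E' where "E' = {p. p \<in> E \<and> prime p}"
  define rad where "rad = (\<lambda>n::nat. prime_factors n - E)"
  have zN: "z \<le> real N + 1" "real N \<le> z" using z by (auto simp: N_def)
  have group_le: "(\<Sum>n\<in>{n. n \<in> {1..N} \<and> rad n = C}. 1 / real n) \<le>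
      (\<Prod>p\<in>C. 1 / (real p - 1)) / sieve_density E" if C: "C \<in> sqfree E z" for C
  proof -
    note CD = sqfreeD[OF C]
    define X where "X = {n. n \<in> {1..N} \<and> rad n = C}"
    have dvd: "\<Prod>C dvd n" if "n \<in> X" for n
      using that CD by (subst prod_primes_dvd_iff) (auto simp: X_def rad_def)
    define X' where "X' = (\<lambda>n. n div \<Prod>C) ` X"
    have inj: "inj_on (\<lambda>n. n div \<Prod>C) X"
      by (rule inj_onI) (metis dvd dvd_mult_div_cancel)
    have "(\<Sum>n\<in>X. 1 / real n) = (\<Sum>n\<in>X. 1 / val C * (1 / real (n div \<Prod>C)))"
    proof (rule sum.cong)
      fix n assume "n \<in> X"
      then have "real n = val C * real (n div \<Prod>C)"
        using dvd[of n] by (metis dvd_mult_div_cancel of_nat_mult)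
      then show "1 / real n = 1 / val C * (1 / real (n div \<Prod>C))" by simp
    qed simp
    also have "\<dots> = 1 / val C * (\<Sum>n\<in>X'. 1 / real n)"
      unfolding X'_def sum.reindex[OF inj] by (simp add: sum_distrib_left)
    also have "\<dots> \<le> 1 / val C * (\<Prod>p\<in>C \<union> E'. 1 / (1 - 1 / real p))"
    proof (intro mult_left_mono sum_recip_smooth_le)
      show "finite (C \<union> E')" "finite X'" using CD E by (auto simp: E'_def X'_def X_def)
      fix m assume "m \<in> X'"
      then obtain n where n: "n \<in> X" "m = n div \<Prod>C" by (auto simp: X'_def)
      then have *: "m dvd n" "n > 0" using dvd[of n] by (auto simp: X_def intro: dvdI[of _ _ "\<Prod>C"])
      then have "prime_factors m \<subseteq> prime_factors n" by (intro dvd_prime_factors) auto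
      then show "m > 0 \<and> prime_factors m \<subseteq> C \<union> E'"
        using n * by (auto simp: X_def rad_def E'_def dvd_pos_nat)
    qed (use CD in \<open>auto simp: E'_def\<close>)
    also have "(\<Prod>p\<in>C \<union> E'. 1 / (1 - 1 / real p)) = (\<Prod>p\<in>C. 1 / (1 - 1 / real p)) * (\<Prod>p\<in>E'. 1 / (1 - 1 / real p))"
      using CD E by (intro prod.union_disjoint) (auto simp: E'_def)
    also have "(\<Prod>p\<in>E'. 1 / (1 - 1 / real p)) = 1 / sieve_density E"
      unfolding sieve_density_def E'_def by (simp add: prod_dividef)
    also have "1 / val C * ((\<Prod>p\<in>C. 1 / (1 - 1 / real p)) * (1 / sieve_density E)) =
        ((\<Prod>p\<in>C. 1 / real p) * (\<Prod>p\<in>C. 1 / (1 - 1 / real p))) / sieve_density E"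
      by (simp add: prod_dividef)
    also have "(\<Prod>p\<in>C. 1 / real p) * (\<Prod>p\<in>C. 1 / (1 - 1 / real p)) = (\<Prod>p\<in>C. 1 / (real p - 1))"
      unfolding prod.distrib[symmetric]
    proof (rule prod.cong)
      fix p assume "p \<in> C"
      then have "p > 1" using CD prime_gt_1_nat by auto
      then show "1 / real p * (1 / (1 - 1 / real p)) = 1 / (real p - 1)" by (simp add: field_simps)
    qed simp
    finally show ?thesis unfolding X_def .
  qed
  have "ln z \<le> ln (real N + 1)" using z zN by simp
  also have "\<dots> \<le> harm N" by (rule ln_le_harm)
  also have "\<dots> = (\<Sum>n\<in>{1..N}. 1 / real n)" by (simp add: harm_def inverse_eq_divide)
  also have "\<dots> = (\<Sum>C\<in>sqfree E z. \<Sum>n\<in>{n. n \<in> {1..N} \<and> rad n = C}. 1 / real n)"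
  proof (rule sum.group[symmetric])
    show "rad ` {1..N} \<subseteq> sqfree E z"
    proof (rule image_subsetI)
      fix n assume n: "n \<in> {1..N}"
      have "\<Prod>(rad n) dvd n" by (subst prod_primes_dvd_iff) (auto simp: rad_def)
      then have "\<Prod>(rad n) \<le> n" using n by (intro dvd_imp_le) auto
      then have "val (rad n) \<le> real N" using n by (simp del: of_nat_prod)
      then show "rad n \<in> sqfree E z" using zN by (auto simp: sqfree_def rad_def)
    qed
  qed auto
  also have "\<dots> \<le> (\<Sum>C\<in>sqfree E z. (\<Prod>p\<in>C. 1 / (real p - 1)) / sieve_density E)"
    by (intro sum_mono group_le)
  also have "\<dots> = (\<Sum>C\<in>sqfree E z. \<Prod>p\<in>C. 1 / (real p - 1)) / sieve_density E"
    by (simp add: sum_divide_distrib)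
  finally show ?thesis using sieve_density_pos[of E] by (simp add: field_simps)
qed

text \<open>Dropping the coprimality of the two factors only adds nonnegative terms.\<close>

lemma sum_prod_add_le:
  assumes "\<And>p. prime p \<Longrightarrow> p \<notin> E \<Longrightarrow> 0 \<le> a p" "\<And>p. prime p \<Longrightarrow> p \<notin> E \<Longrightarrow> 0 \<le> (b p :: real)"
  shows "(\<Sum>S\<in>sqfree E z. \<Prod>p\<in>S. a p + b p) \<le>
    (\<Sum>S\<in>sqfree E z. \<Prod>p\<in>S. a p) * (\<Sum>S\<in>sqfree E z. \<Prod>p\<in>S. b p)"
proof -
  have nn: "0 \<le> prod a S" "0 \<le> prod b S" if "S \<in> sqfree E z" for S
    by (intro prod_nonneg ballI; use assms sqfreeD(2,3)[OF that] in blast)+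
  have "(\<Sum>S\<in>sqfree E z. \<Prod>p\<in>S. a p + b p) =
      (\<Sum>S\<in>sqfree E z. \<Sum>T\<in>Pow S. prod a T * prod b (S - T))"
    by (intro sum.cong prod_add) (auto dest: sqfreeD)
  also have "\<dots> = (\<Sum>T\<in>sqfree E z. \<Sum>C\<in>sqfree (E \<union> T) (z / val T). prod a T * prod b C)"
    by (rule sum_factor_pairs)
  also have "\<dots> \<le> (\<Sum>T\<in>sqfree E z. \<Sum>C\<in>sqfree E z. prod a T * prod b C)"
  proof (intro sum_mono sum_mono2)
    fix T assume T: "T \<in> sqfree E z"
    have "z \<ge> 1" using sqfreeD(4,5)[OF T] by linarith
    then have "z / val T \<le> z"
      using sqfreeD(5)[OF T] by (simp add: divide_le_eq_1 field_simps mult_le_cancel_left1)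
    then show "sqfree (E \<union> T) (z / val T) \<subseteq> sqfree E z"
      by (intro sqfree_mono) auto
  qed (use nn in auto)
  also have "\<dots> = (\<Sum>S\<in>sqfree E z. \<Prod>p\<in>S. a p) * (\<Sum>S\<in>sqfree E z. \<Prod>p\<in>S. b p)"
    by (simp add: sum_product)
  finally show ?thesis .
qed

lemma sum_prod_mult_le_power:
  assumes "\<And>p. prime p \<Longrightarrow> p \<notin> E \<Longrightarrow> 0 \<le> (a p :: real)" "1 \<le> z"
  shows "(\<Sum>S\<in>sqfree E z. \<Prod>p\<in>S. real j * a p) \<le> (\<Sum>S\<in>sqfree E z. \<Prod>p\<in>S. a p) ^ j"
proof (induction j)
  case 0
  have "(\<Sum>S\<in>sqfree E z. \<Prod>p\<in>S. real 0 * a p) = (\<Sum>S\<in>sqfree E z. if S = {} then 1 else 0)"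
    by (intro sum.cong) (auto dest: sqfreeD(1))
  also have "\<dots> \<le> 1" by (simp add: sum.delta)
  finally show ?case by simp
next
  case (Suc j)
  have "(\<Sum>S\<in>sqfree E z. \<Prod>p\<in>S. real (Suc j) * a p) = (\<Sum>S\<in>sqfree E z. \<Prod>p\<in>S. a p + real j * a p)"
    by (simp add: algebra_simps)
  also have "\<dots> \<le> (\<Sum>S\<in>sqfree E z. \<Prod>p\<in>S. a p) * (\<Sum>S\<in>sqfree E z. \<Prod>p\<in>S. real j * a p)"
    using assms by (intro sum_prod_add_le) auto
  also have "\<dots> \<le> (\<Sum>S\<in>sqfree E z. \<Prod>p\<in>S. a p) * (\<Sum>S\<in>sqfree E z. \<Prod>p\<in>S. a p) ^ j"
    by (intro mult_left_mono Suc.IH sum_nonneg prod_nonneg ballI) (use assms sqfreeD(2,3) in blast)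
  finally show ?case by simp
qed

text \<open>Writing \<open>n = j * W + a\<close> with \<open>1 \<le> a \<le> W\<close>, each of the \<open>\<phi>(W)\<close> classes contributes at most
  the harmonic sum over \<open>j\<close>, divided by \<open>W\<close>; the terms with \<open>j = 0\<close> go into the constant.\<close>

lemma sum_recip_coprime_le:
  fixes W :: nat
  assumes W: "W > 0"
  shows "(\<Sum>n\<in>{n. n \<in> {1..N} \<and> coprime n W}. 1 / real n) \<le>
    real (totient W) / real W * (ln (real N + 1) + 1) + real (totient W)"
proof -
  define h where "h = (\<lambda>(j, a). 1 / real (j * W + a))"
  define \<phi> where "\<phi> = (\<lambda>n. ((n - 1) div W, (n - 1) mod W + 1))"
  define X where "X = {n. n \<in> {1..N} \<and> coprime n W}"
  have eq: "n = (n - 1) div W * W + ((n - 1) mod W + 1)" if "n \<ge> 1" for n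
    using that by simp
  have "(\<Sum>n\<in>X. 1 / real n) = (\<Sum>n\<in>X. h (\<phi> n))"
  proof (rule sum.cong)
    fix n assume "n \<in> X"
    then have "n = (n - 1) div W * W + ((n - 1) mod W + 1)" by (intro eq) (auto simp: X_def)
    then have "real n = real ((n - 1) div W * W + ((n - 1) mod W + 1))" by (rule arg_cong)
    then show "1 / real n = h (\<phi> n)" unfolding h_def \<phi>_def case_prod_conv by (rule arg_cong)
  qed simp
  also have "\<dots> = sum h (\<phi> ` X)"
  proof (subst sum.reindex)
    show "inj_on \<phi> X"
    proof (rule inj_onI)
      fix x y assume xy: "x \<in> X" "y \<in> X" "\<phi> x = \<phi> y"
      then have "(x - 1) div W = (y - 1) div W" "(x - 1) mod W = (y - 1) mod W"
        by (auto simp: \<phi>_def)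
      moreover have "1 \<le> x" "1 \<le> y" using xy by (auto simp: X_def)
      ultimately show "x = y" using eq[of x] eq[of y] by simp
    qed
  qed simp
  also have "\<dots> \<le> sum h ({0..N} \<times> totatives W)"
  proof (rule sum_mono2)
    show "\<phi> ` X \<subseteq> {0..N} \<times> totatives W"
    proof (rule image_subsetI)
      fix n assume n: "n \<in> X"
      have "gcd W ((n - 1) div W * W + ((n - 1) mod W + 1)) = gcd W ((n - 1) mod W + 1)"
        by (rule gcd_add_mult)
      moreover have "coprime W n" "n \<ge> 1" using n by (auto simp: X_def coprime_commute)
      ultimately have "gcd W ((n - 1) mod W + 1) = 1" using eq[of n] by (metis coprime_imp_gcd_eq_1)
      then have "coprime ((n - 1) mod W + 1) W" by (simp add: coprime_iff_gcd_eq_1 gcd.commute)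
      moreover have "(n - 1) div W \<le> N" using n by (auto simp: X_def intro: order.trans[OF div_le_dividend])
      ultimately show "\<phi> n \<in> {0..N} \<times> totatives W"
        using W by (auto simp: \<phi>_def in_totatives_iff Suc_leI)
    qed
  qed (auto simp: h_def)
  also have "\<dots> = (\<Sum>j\<in>{0..N}. \<Sum>a\<in>totatives W. 1 / real (j * W + a))"
    unfolding h_def by (rule sum.cartesian_product[symmetric])
  also have "\<dots> = (\<Sum>a\<in>totatives W. 1 / real a) + (\<Sum>j\<in>{1..N}. \<Sum>a\<in>totatives W. 1 / real (j * W + a))"
    by (subst sum.atLeast_Suc_atMost) auto
  also have "\<dots> \<le> (\<Sum>a\<in>totatives W. 1) + (\<Sum>j\<in>{1..N}. \<Sum>a\<in>totatives W. 1 / real (j * W))"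
  proof (intro add_mono sum_mono)
    fix a assume "a \<in> totatives W"
    then show "1 / real a \<le> 1" by (auto simp: in_totatives_iff)
  next
    fix j a assume "j \<in> {1..N}"
    then show "1 / real (j * W + a) \<le> 1 / real (j * W)"
      using W by (intro divide_left_mono mult_pos_pos) (auto intro: add_pos_nonneg)
  qed
  also have "\<dots> = real (totient W) + (\<Sum>j\<in>{1..N}. 1 / real j * (real (totient W) / real W))"
    by (simp add: totient_def)
  also have "\<dots> = real (totient W) + real (totient W) / real W * harm N"
    unfolding sum_distrib_right[symmetric] by (simp add: harm_def inverse_eq_divide)
  also have "harm N \<le> ln (real N + 1) + 1"
  proof (cases "N = 0")
    case False
    then have "harm N - ln (real N) \<le> harm 1 - ln (real 1)"
      by (intro euler_mascheroni_sequence_decreasing) auto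
    moreover have "ln (real N) \<le> ln (real N + 1)" using False by simp
    ultimately show ?thesis by (simp add: harm_def[of "Suc 0"])
  qed (simp add: harm_def)
  finally show ?thesis by (simp add: X_def mult_left_mono divide_right_mono add.commute)
qed

lemma one_dim_recip_upper:
  "\<exists>C\<ge>0. \<forall>z\<ge>1. (\<Sum>S\<in>rough w z. \<Prod>p\<in>S. 1 / real p) \<le> sieve_density {..w} * ln z + C"
proof -
  define W where "W = \<Prod>{p. p \<in> {..w} \<and> prime p}"
  have fin: "finite {p. p \<in> {..w} \<and> prime p}" by auto
  have W: "W > 0" unfolding W_def by (rule prod_primes_pos) auto
  have pf: "prime_factors W = {p. p \<in> {..w} \<and> prime p}"
    unfolding W_def by (rule prime_factors_prod_primes) auto
  have dens: "real (totient W) / real W = sieve_density {..w}"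
    using W by (simp add: totient_formula2 pf sieve_density_def)
  \<comment> \<open>The factor 2 allows for the \<open>1\<close> in the bound of the harmonic sum and for \<open>ln (N + 1) \<le> ln z + 1\<close>.\<close>
  define C where "C = 2 * sieve_density {..w} + real (totient W)"
  have "(\<Sum>S\<in>rough w z. \<Prod>p\<in>S. 1 / real p) \<le> sieve_density {..w} * ln z + C"
    if z: "z \<ge> 1" for z
  proof -
    define N where "N = nat \<lfloor>z\<rfloor>"
    have N: "1 \<le> N" "real N \<le> z" using z by (auto simp: N_def le_nat_floor)
    define X where "X = {n. n \<in> {1..N} \<and> coprime n W}"
    have inj: "inj_on (\<lambda>S. \<Prod>S) (rough w z)"
      by (rule inj_on_subset[OF inj_on_prod_primes]) (auto dest: sqfreeD)
    have "(\<Sum>S\<in>rough w z. \<Prod>p\<in>S. 1 / real p) =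
        (\<Sum>S\<in>rough w z. 1 / val S)"
      by (simp add: prod_dividef)
    also have "\<dots> = (\<Sum>n\<in>(\<lambda>S. \<Prod>S) ` rough w z. 1 / real n)"
      by (simp only: sum.reindex[OF inj] o_def)
    also have "\<dots> \<le> (\<Sum>n\<in>X. 1 / real n)"
    proof (rule sum_mono2)
      show "(\<lambda>S. \<Prod>S) ` rough w z \<subseteq> X"
      proof (rule image_subsetI)
        fix S assume S: "S \<in> rough w z"
        note SD = sqfreeD[OF S]
        have "\<Prod>S \<le> N" using SD(4) unfolding N_def by (rule le_nat_floor)
        moreover have "\<Prod>S \<ge> 1" using SD(5) by linarith
        moreover have "coprime (\<Prod>S) W" unfolding W_def
        proof (intro prod_coprime_left prod_coprime_right primes_coprime)
          fix p q assume "p \<in> S" "q \<in> {p. p \<in> {..w} \<and> prime p}"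
          then show "prime p" "prime q" "p \<noteq> q" using SD by auto
        qed
        ultimately show "\<Prod>S \<in> X" by (auto simp: X_def)
      qed
    qed (auto simp: X_def)
    also have "\<dots> \<le> sieve_density {..w} * (ln (real N + 1) + 1) + real (totient W)"
      unfolding X_def dens[symmetric] by (rule sum_recip_coprime_le[OF W])
    also have "ln (real N + 1) \<le> ln z + 1"
    proof -
      have "ln (real N + 1) \<le> ln (exp 1 * z)"
      proof (subst ln_le_cancel_iff)
        have "real N + 1 \<le> 2 * z" using N z by linarith
        also have "\<dots> \<le> exp 1 * z" using z exp_ge_add_one_self[of 1] by (intro mult_right_mono) auto
        finally show "real N + 1 \<le> exp 1 * z" .
      qed (use z in auto)
      also have "\<dots> = ln z + 1" using z by (simp add: ln_mult)
      finally show ?thesis .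
    qed
    finally show ?thesis using sieve_density_pos[of "{..w}"] by (simp add: C_def algebra_simps)
  qed
  moreover have "C \<ge> 0" unfolding C_def using sieve_density_pos[of "{..w}"] by simp
  ultimately show ?thesis by blast
qed

text \<open>The weights are of size \<open>k / p^2\<close>, hence their sum over \<open>p > w\<close> is \<open>O(k / w)\<close>. This controls the
  replacement of \<open>1 / (p - k)\<close> by \<open>1 / p\<close>.\<close>

lemma sum_prod_le_exp:
  fixes k :: real
  assumes w: "1 \<le> w" "2 * k \<le> real w" and k: "0 \<le> k"
  shows "(\<Sum>S\<in>rough w z. \<Prod>p\<in>S. k / (real p * (real p - k))) \<le> exp (2 * k / real w)"
proof -
  define Z where "Z = max w (nat \<lfloor>z\<rfloor>)"
  define f where "f = (\<lambda>p::nat. k / (real p * (real p - k)))"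
  have f0: "0 \<le> f p" if "p \<in> {w<..Z}" for p using that w k by (auto simp: f_def)
  have f1: "f p \<le> 2 * k * (1 / real (p - 1) - 1 / real p)" if "p \<in> {w<..Z}" for p
  proof -
    have p: "real p > real w" "p > 1" using that w by auto
    then have "real p / 2 \<le> real p - k" using w by linarith
    then have "f p \<le> k / (real p * (real p / 2))"
      unfolding f_def using p k by (intro divide_left_mono mult_left_mono mult_pos_pos) auto
    also have "\<dots> \<le> 2 * k * (1 / real (p - 1) - 1 / real p)"
    proof -
      have "1 / (real p * real p) \<le> 1 / ((real p - 1) * real p)"
        using p by (intro divide_left_mono mult_right_mono) auto
      also have "\<dots> = 1 / real (p - 1) - 1 / real p" using p by (simp add: field_simps of_nat_diff)
      finally show ?thesis using k mult_left_mono[of "1 / (real p * real p)" _ "2 * k"]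
        by (simp add: mult.commute[of k])
    qed
    finally show ?thesis .
  qed
  have tele: "(\<Sum>p\<in>{w<..Y}. 1 / real (p - 1) - 1 / real p) = 1 / real w - 1 / real Y" if "w \<le> Y" for Y
    using that
  proof (induction Y rule: dec_induct)
    case (step n)
    have "{w<..Suc n} = insert (Suc n) {w<..n}" using step by auto
    then show ?case using step by simp
  qed simp
  have "(\<Sum>S\<in>rough w z. \<Prod>p\<in>S. f p) \<le> (\<Sum>S\<in>Pow {w<..Z}. \<Prod>p\<in>S. f p)"
  proof (rule sum_mono2)
    show "rough w z \<subseteq> Pow {w<..Z}"
    proof (intro subsetI PowI)
      fix S p assume S: "S \<in> rough w z" "p \<in> S"
      have "p \<le> nat \<lfloor>z\<rfloor>" using sqfree_le[OF S] by (rule le_nat_floor)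
      moreover have "p > w" using sqfreeD(3)[OF S(1)] S(2) by fastforce
      ultimately show "p \<in> {w<..Z}" by (auto simp: Z_def)
    qed
    fix S assume "S \<in> Pow {w<..Z} - rough w z"
    then show "0 \<le> (\<Prod>p\<in>S. f p)" using f0 by (intro prod_nonneg) blast
  qed auto
  also have "\<dots> = (\<Prod>p\<in>{w<..Z}. 1 + f p)"
    using prod_add[of "{w<..Z}" f "\<lambda>_. 1"] by (simp add: add.commute)
  also have "\<dots> \<le> exp (\<Sum>p\<in>{w<..Z}. f p)" using f0 by (intro prod_le_exp_sum)
  also have "(\<Sum>p\<in>{w<..Z}. f p) \<le> (\<Sum>p\<in>{w<..Z}. 2 * k * (1 / real (p - 1) - 1 / real p))"
    using f1 by (intro sum_mono)
  also have "\<dots> = 2 * k * (1 / real w - 1 / real Z)"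
    unfolding sum_distrib_left[symmetric] by (subst tele) (auto simp: Z_def)
  also have "\<dots> \<le> 2 * k / real w" using k by (simp add: right_diff_distrib)
  finally show ?thesis by (simp add: f_def)
qed

text \<open>The identity \<open>1 / (p - k) = k / (p * (p - k)) + 1 / p\<close> splits the sum into a convergent factor
  close to \<open>1\<close> and a sum of reciprocals of integers free of primes up to \<open>w\<close>.\<close>

lemma one_dim_upper:
  fixes k :: real
  assumes w: "1 \<le> w" "2 * k \<le> real w" and k: "0 \<le> k"
  shows "\<exists>C\<ge>0. \<forall>z\<ge>1. (\<Sum>S\<in>rough w z. \<Prod>p\<in>S. 1 / (real p - k)) \<le>
    exp (2 * k / real w) * sieve_density {..w} * ln z + C"
proof -
  obtain C where C: "C \<ge> 0" "\<And>z. z \<ge> 1 \<Longrightarrow>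
      (\<Sum>S\<in>rough w z. \<Prod>p\<in>S. 1 / real p) \<le> sieve_density {..w} * ln z + C"
    using one_dim_recip_upper by blast
  have "(\<Sum>S\<in>rough w z. \<Prod>p\<in>S. 1 / (real p - k)) \<le>
    exp (2 * k / real w) * sieve_density {..w} * ln z + exp (2 * k / real w) * C" if z: "z \<ge> 1" for z
  proof -
    have big: "real p > real w" if "p \<notin> {..w}" for p using that by auto
    have "(\<Sum>S\<in>rough w z. \<Prod>p\<in>S. 1 / (real p - k)) =
        (\<Sum>S\<in>rough w z. \<Prod>p\<in>S. k / (real p * (real p - k)) + 1 / real p)"
    proof (intro sum.cong prod.cong refl)
      fix S p assume S: "S \<in> rough w z" "p \<in> S"
      have "p \<notin> {..w}" using sqfreeD(3)[OF S(1)] S(2) by blast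
      then have "real p - k > 0" "real p > 0" using big[of p] w k by auto
      then show "1 / (real p - k) = k / (real p * (real p - k)) + 1 / real p"
        by (simp add: field_simps)
    qed
    also have "\<dots> \<le> (\<Sum>S\<in>rough w z. \<Prod>p\<in>S. k / (real p * (real p - k))) *
        (\<Sum>S\<in>rough w z. \<Prod>p\<in>S. 1 / real p)"
      using w k by (intro sum_prod_add_le) (auto dest!: big intro!: divide_nonneg_nonneg mult_nonneg_nonneg)
    also have "\<dots> \<le> exp (2 * k / real w) * (sieve_density {..w} * ln z + C)"
      using C z by (intro mult_mono sum_prod_le_exp w k) (auto intro!: sum_nonneg prod_nonneg)
    finally show ?thesis by (simp add: algebra_simps)
  qed
  moreover have "exp (2 * k / real w) * C \<ge> 0" using C by simp
  ultimately show ?thesis by blast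
qed

section \<open>Sums of higher dimension\<close>

text \<open>Splitting \<open>(j + 1) * g = j * g + g\<close> at every prime writes a sum of dimension \<open>j + 1\<close> as a
  convolution of one of dimension \<open>j\<close> with one of dimension one.\<close>

lemma log_moment_Suc_dim:
  "log_moment E (\<lambda>p. real (Suc j) * g p) m z =
    (\<Sum>T\<in>sqfree E z. (\<Prod>p\<in>T. real j * g p) * log_moment (E \<union> T) g m (z / val T))"
proof -
  have "log_moment E (\<lambda>p. real (Suc j) * g p) m z =
      (\<Sum>S\<in>sqfree E z. \<Sum>T\<in>Pow S.
        (\<Prod>p\<in>T. real j * g p) * (\<Prod>p\<in>S - T. g p) * ln (z / val T / val (S - T)) ^ m)"
    unfolding log_moment_def
  proof (rule sum.cong[OF refl])
    fix S assume "S \<in> sqfree E z"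
    note S = sqfreeD[OF this]
    have "(\<Prod>p\<in>S. real (Suc j) * g p) * ln (z / val S) ^ m =
        (\<Prod>p\<in>S. real j * g p + g p) * ln (z / val S) ^ m"
      by (simp add: algebra_simps)
    also have "\<dots> = (\<Sum>T\<in>Pow S. (\<Prod>p\<in>T. real j * g p) * (\<Prod>p\<in>S - T. g p) * ln (z / val S) ^ m)"
      using S(1) by (simp only: prod_add sum_distrib_right)
    also have "\<dots> = (\<Sum>T\<in>Pow S. (\<Prod>p\<in>T. real j * g p) * (\<Prod>p\<in>S - T. g p) *
        ln (z / val T / val (S - T)) ^ m)"
    proof (rule sum.cong[OF refl])
      fix T assume "T \<in> Pow S"
      then have "\<Prod>S = \<Prod>(S - T) * \<Prod>T" using S by (intro prod.subset_diff) auto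
      then have eq: "z / val S = z / val T / val (S - T)" by simp
      show "(\<Prod>p\<in>T. real j * g p) * (\<Prod>p\<in>S - T. g p) * ln (z / val S) ^ m =
          (\<Prod>p\<in>T. real j * g p) * (\<Prod>p\<in>S - T. g p) * ln (z / val T / val (S - T)) ^ m"
        unfolding eq ..
    qed
    finally show "(\<Prod>p\<in>S. real (Suc j) * g p) * ln (z / val S) ^ m =
      (\<Sum>T\<in>Pow S. (\<Prod>p\<in>T. real j * g p) * (\<Prod>p\<in>S - T. g p) * ln (z / val T / val (S - T)) ^ m)" .
  qed
  also have "\<dots> = (\<Sum>T\<in>sqfree E z. \<Sum>C\<in>sqfree (E \<union> T) (z / val T).
      (\<Prod>p\<in>T. real j * g p) * (\<Prod>p\<in>C. g p) * ln (z / val T / val C) ^ m)"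
    by (rule sum_factor_pairs)
  finally show ?thesis by (simp add: log_moment_def sum_distrib_left mult.assoc)
qed

lemma log_moment_zero_dim:
  assumes "1 \<le> z"
  shows "log_moment E (\<lambda>p. 0) m z = ln z ^ m"
proof -
  have "log_moment E (\<lambda>p. 0) m z = (\<Sum>S\<in>sqfree E z. if S = {} then ln z ^ m else 0)"
    unfolding log_moment_def by (intro sum.cong) (auto dest: sqfreeD(1))
  then show ?thesis using assms by simp
qed

lemma log_moment_subset:
  assumes "\<And>p. prime p \<Longrightarrow> p \<notin> E \<Longrightarrow> 0 \<le> g p" "E \<subseteq> E'"
  shows "log_moment E' g m z \<le> log_moment E g m z"
  unfolding log_moment_def
proof (rule sum_mono2)
  show "sqfree E' z \<subseteq> sqfree E z" using assms by (intro sqfree_mono) auto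
  fix S assume "S \<in> sqfree E z - sqfree E' z"
  then have S: "S \<in> sqfree E z" by simp
  note SD = sqfreeD[OF S]
  have "1 \<le> z / val S" using SD(4,5) by (simp add: field_simps)
  then have "0 \<le> ln (z / val S) ^ m" by (intro zero_le_power ln_ge_zero)
  moreover have "0 \<le> (\<Prod>p\<in>S. g p)" using assms(1) SD(2,3) by (intro prod_nonneg) blast
  ultimately show "0 \<le> (\<Prod>p\<in>S. g p) * ln (z / val S) ^ m" by (rule mult_nonneg_nonneg[rotated])
qed simp

text \<open>The replacement of \<open>p - 1\<close> by \<open>p - k\<close> gains enough to absorb up to \<open>k - 1\<close> factors
  \<open>1 - 1 / p\<close>, by Bernoulli's inequality.\<close>

lemma recip_pred_le:
  fixes p k i :: nat
  assumes "k < p" "Suc i \<le> k"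
  shows "1 / (real p - 1) \<le> 1 / (real p - real k) * (1 - 1 / real p) ^ i"
proof -
  have p: "real p > 1" "real p > real k" using assms by auto
  have "(real p - real k) / (real p - 1) \<le> 1 - real i / real p"
  proof -
    have "real (Suc i) * real p \<le> real k * real p" using assms by (intro mult_right_mono) auto
    then have "real p * (real p - real k) \<le> (real p - real i) * (real p - 1)"
      by (simp add: algebra_simps)
    then show ?thesis using p by (simp add: field_simps)
  qed
  also have "\<dots> \<le> (1 - 1 / real p) ^ i"
    using Bernoulli_inequality[of "- (1 / real p)" i] p by simp
  finally show ?thesis using p by (simp add: field_simps)
qed

lemma fact_ratio_shift: "fact (Suc m) / fact (Suc m + j) / real (Suc m) = (fact m / fact (m + Suc j) :: real)"
proof -
  have "fact (Suc m) = real (Suc m) * fact m" by (rule fact_Suc)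
  then show ?thesis unfolding add_Suc_shift by (simp del: fact_Suc of_nat_Suc)
qed

text \<open>Each step of the induction sums out a cofactor coprime to \<open>T\<close>, which costs the density
  \<open>1 - 1 / p\<close> at the primes of \<open>T\<close>. The exponent \<open>i\<close> records how often this has happened. The weights
  \<open>1 / (p - k)\<close> leave room for \<open>k - 1\<close> such losses, so that the bound carries no error term.\<close>

lemma log_moment_dim_lower:
  fixes k :: nat
  assumes w: "k \<le> w" and "1 \<le> k" and "i + j \<le> k" and "1 \<le> z"
  shows "sieve_density {..w} ^ j * (fact m / fact (m + j)) * ln z ^ (m + j) \<le>
    log_moment {..w} (\<lambda>p. real j * (1 / (real p - real k) * (1 - 1 / real p) ^ i)) m z"
  using assms(3,4)
proof (induction j arbitrary: i m z)
  case 0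
  then show ?case by (simp add: log_moment_zero_dim)
next
  case (Suc j)
  define E where "E = {..w}"
  define \<alpha> where "\<alpha> = sieve_density E"
  have \<alpha>: "\<alpha> > 0" unfolding \<alpha>_def by (rule sieve_density_pos)
  define g where "g = (\<lambda>i p. 1 / (real p - real k) * (1 - 1 / real p) ^ i)"
  have big: "k < p \<and> 1 < p" if "p \<notin> E" for p using that w \<open>1 \<le> k\<close> by (auto simp: E_def)
  have g0: "0 \<le> g i p" if "p \<notin> E" for i p using big[OF that] by (auto simp: g_def)
  have inner: "\<alpha> * (\<Prod>p\<in>T. 1 - 1 / real p) * ln (z / val T) ^ Suc m / Suc m \<le>
      log_moment (E \<union> T) (g i) m (z / val T)" if T: "T \<in> sqfree E z" for T
  proof -
    note TD = sqfreeD[OF T]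
    have dens: "\<alpha> * (\<Prod>p\<in>T. 1 - 1 / real p) = sieve_density (E \<union> T)"
      unfolding \<alpha>_def using TD by (subst sieve_density_Un) (auto simp: E_def)
    show ?thesis unfolding dens
    proof (rule log_moment_lower)
      fix z' :: real assume z': "1 \<le> z'"
      have "sieve_density (E \<union> T) * ln z' \<le> (\<Sum>C\<in>sqfree (E \<union> T) z'. \<Prod>p\<in>C. 1 / (real p - 1))"
        using TD by (intro one_dim_lower z') (auto simp: E_def)
      also have "\<dots> \<le> log_moment (E \<union> T) (g i) 0 z'"
        unfolding log_moment_def
      proof (simp, intro sum_mono prod_mono)
        fix S p assume S: "S \<in> sqfree (E \<union> T) z'" "p \<in> S"
        have "p \<notin> E" using sqfreeD(3)[OF S(1)] S(2) by blast
        then show "0 \<le> 1 / (real p - 1) \<and> 1 / (real p - 1) \<le> g i p"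
          using recip_pred_le[of k p i] big[of p] Suc.prems by (auto simp: g_def)
      qed
      finally show "sieve_density (E \<union> T) * ln z' \<le> log_moment (E \<union> T) (g i) 0 z'" .
    next
      show "1 \<le> z / val T" using TD(4,5) by (simp add: field_simps)
    qed
  qed
  have "\<alpha> ^ Suc j * (fact m / fact (m + Suc j)) * ln z ^ (m + Suc j) =
      \<alpha> / Suc m * (\<alpha> ^ j * (fact (Suc m) / fact (Suc m + j)) * ln z ^ (Suc m + j))"
    unfolding fact_ratio_shift[symmetric] by (simp add: mult_ac del: fact_Suc of_nat_Suc)
  also have "\<dots> \<le> \<alpha> / Suc m * log_moment E (\<lambda>p. real j * g (Suc i) p) (Suc m) z"
    using Suc.IH[of "Suc i" z "Suc m"] Suc.prems \<alpha>
    by (intro mult_left_mono) (auto simp: E_def \<alpha>_def g_def)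
  also have "\<dots> = (\<Sum>T\<in>sqfree E z. (\<Prod>p\<in>T. real j * g i p) *
      (\<alpha> * (\<Prod>p\<in>T. 1 - 1 / real p) * ln (z / val T) ^ Suc m / Suc m))"
  proof -
    have "(\<Prod>p\<in>T. real j * g (Suc i) p) = (\<Prod>p\<in>T. real j * g i p) * (\<Prod>p\<in>T. 1 - 1 / real p)" for T
      unfolding prod.distrib[symmetric] by (intro prod.cong) (auto simp: g_def)
    then show ?thesis unfolding log_moment_def sum_distrib_left
      by (intro sum.cong) (auto simp: mult_ac simp del: of_nat_prod of_nat_Suc)
  qed
  also have "\<dots> \<le> (\<Sum>T\<in>sqfree E z. (\<Prod>p\<in>T. real j * g i p) * log_moment (E \<union> T) (g i) m (z / val T))"
  proof (intro sum_mono mult_left_mono inner prod_nonneg)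
    fix T p assume T: "T \<in> sqfree E z" "p \<in> T"
    then have "p \<notin> E" using sqfreeD(3) by blast
    then show "0 \<le> real j * g i p" using g0[of p i] by simp
  qed
  also have "\<dots> = log_moment E (\<lambda>p. real (Suc j) * g i p) m z"
    by (rule log_moment_Suc_dim[symmetric])
  finally show ?case by (simp add: E_def \<alpha>_def g_def)
qed

text \<open>For upper bounds coprimality is simply dropped; the error term of the one-dimensional bound makes
  each step lose lower powers of \<open>ln z\<close>.\<close>

lemma log_moment_dim_upper:
  fixes g :: "nat \<Rightarrow> real"
  assumes g0: "\<And>p. prime p \<Longrightarrow> p \<notin> E \<Longrightarrow> 0 \<le> g p"
    and c: "0 \<le> c" "0 \<le> C" "\<And>z. 1 \<le> z \<Longrightarrow> log_moment E g 0 z \<le> c * ln z + C"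
  shows "\<exists>D\<ge>0. \<forall>z\<ge>1. log_moment E (\<lambda>p. real j * g p) m z \<le>
    c ^ j * (fact m / fact (m + j)) * ln z ^ (m + j) + D * (\<Sum>i<m + j. ln z ^ i)"
proof (induction j arbitrary: m)
  case 0
  then show ?case by (intro exI[of _ 0]) (simp add: log_moment_zero_dim)
next
  case (Suc j)
  obtain D1 where D1: "D1 \<ge> 0" "\<And>z. z \<ge> 1 \<Longrightarrow> log_moment E (\<lambda>p. real j * g p) (Suc m) z \<le>
    c ^ j * (fact (Suc m) / fact (Suc m + j)) * ln z ^ (Suc m + j) + D1 * (\<Sum>i<Suc m + j. ln z ^ i)"
    using Suc.IH by blast
  obtain D2 where D2: "D2 \<ge> 0" "\<And>z. z \<ge> 1 \<Longrightarrow> log_moment E (\<lambda>p. real j * g p) m z \<le>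
    c ^ j * (fact m / fact (m + j)) * ln z ^ (m + j) + D2 * (\<Sum>i<m + j. ln z ^ i)"
    using Suc.IH by blast
  define D where "D = c / Suc m * D1 + C * (c ^ j * (fact m / fact (m + j)) + D2)"
  let ?g = "\<lambda>p. real j * g p" and ?a = "c ^ j * (fact m / fact (m + j))" and ?a' = "c ^ Suc j * (fact m / fact (m + Suc j))"
  let ?a1 = "c ^ j * (fact (Suc m) / fact (Suc m + j))" and ?s = "\<lambda>n z. \<Sum>i<n. ln z ^ i"
  have "log_moment E (\<lambda>p. real (Suc j) * g p) m z \<le>
    ?a' * ln z ^ (m + Suc j) + D * ?s (m + Suc j) z"
    if z: "1 \<le> z" for z
  proof -
    have lnz: "0 \<le> ln z" using z by simp
    have inner: "log_moment (E \<union> T) g m (z / val T) \<le>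
        c * ln (z / val T) ^ Suc m / Suc m + C * ln (z / val T) ^ m"
      if T: "T \<in> sqfree E z" for T
    proof -
      note TD = sqfreeD[OF T]
      have "log_moment (E \<union> T) g m (z / val T) \<le> log_moment E g m (z / val T)"
        by (intro log_moment_subset g0) auto
      also have "\<dots> \<le> c * ln (z / val T) ^ Suc m / Suc m + C * ln (z / val T) ^ m"
      proof (rule log_moment_upper[OF c(3)])
        show "1 \<le> z / val T" using TD(4,5) by (simp add: field_simps)
      qed
      finally show ?thesis .
    qed
    have "log_moment E (\<lambda>p. real (Suc j) * g p) m z =
        (\<Sum>T\<in>sqfree E z. (\<Prod>p\<in>T. real j * g p) * log_moment (E \<union> T) g m (z / val T))"
      by (rule log_moment_Suc_dim)
    also have "\<dots> \<le> (\<Sum>T\<in>sqfree E z. (\<Prod>p\<in>T. real j * g p) *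
        (c * ln (z / val T) ^ Suc m / Suc m + C * ln (z / val T) ^ m))"
    proof (intro sum_mono mult_left_mono inner prod_nonneg)
      fix T p assume T: "T \<in> sqfree E z" "p \<in> T"
      then have "prime p" "p \<notin> E" using sqfreeD(2,3)[OF T(1)] by auto
      then show "0 \<le> real j * g p" using g0[of p] by auto
    qed
    also have "\<dots> = c / Suc m * log_moment E ?g (Suc m) z + C * log_moment E ?g m z"
      unfolding log_moment_def sum_distrib_left sum.distrib[symmetric]
      by (intro sum.cong) (auto simp: algebra_simps simp del: of_nat_prod)
    also have "\<dots> \<le> c / Suc m * (?a1 * ln z ^ (Suc m + j) + D1 * ?s (Suc m + j) z) +
        C * (?a * ln z ^ (m + j) + D2 * ?s (m + j) z)"
      using c by (intro add_mono mult_left_mono D1(2) D2(2) z) auto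
    also have "\<dots> = ?a' * ln z ^ (m + Suc j) +
        (c / Suc m * D1 * ?s (m + Suc j) z +
         C * (?a * ln z ^ (m + j) + D2 * ?s (m + j) z))"
    proof -
      have "c / Suc m * (?a1 * ln z ^ (Suc m + j)) =
          ?a' * ln z ^ (m + Suc j)"
        unfolding fact_ratio_shift[symmetric] by (simp add: mult_ac del: fact_Suc of_nat_Suc)
      then show ?thesis by (simp add: algebra_simps del: fact_Suc of_nat_Suc)
    qed
    finally have "log_moment E (\<lambda>p. real (Suc j) * g p) m z \<le>
        ?a' * ln z ^ (m + Suc j) +
        (c / Suc m * D1 * ?s (m + Suc j) z +
         C * (?a * ln z ^ (m + j) + D2 * ?s (m + j) z))" .
    moreover have "?a * ln z ^ (m + j) + D2 * ?s (m + j) z \<le>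
        (?a + D2) * ?s (m + Suc j) z"
    proof -
      have "ln z ^ (m + j) \<le> ?s (m + Suc j) z" "?s (m + j) z \<le> ?s (m + Suc j) z"
        using lnz by (auto intro: sum_nonneg)
      then show ?thesis unfolding distrib_right using D2(1) c(1)
        by (intro add_mono mult_left_mono) auto
    qed
    ultimately show ?thesis unfolding D_def distrib_right mult.assoc[of C]
      using mult_left_mono[OF _ c(2)] by (meson add_left_mono order.trans)
  qed
  moreover have "D \<ge> 0" unfolding D_def using c D1(1) D2(1)
    by (intro add_nonneg_nonneg mult_nonneg_nonneg) auto
  ultimately show ?case by blast
qed

section \<open>Selberg weights and their quadratic forms\<close>

text \<open>Squaring a divisor sum and counting the multiples of the least common multiple \<open>S \<union> T\<close> leads to
  this quadratic form, with \<open>\<gamma>\<close> the density of the sieved set, and to an error term of the shape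
  \<open>lcm_error\<close>.\<close>

abbreviation lcm_form :: "'a set set \<Rightarrow> ('a set \<Rightarrow> real) \<Rightarrow> ('a \<Rightarrow> real) \<Rightarrow> real" where
  "lcm_form D lam \<gamma> \<equiv> \<Sum>S\<in>D. \<Sum>T\<in>D. lam S * lam T * (\<Prod>p\<in>S \<union> T. \<gamma> p)"

abbreviation lcm_error :: "'a set set \<Rightarrow> ('a set \<Rightarrow> real) \<Rightarrow> ('a set \<Rightarrow> real) \<Rightarrow> real" where
  "lcm_error D lam e \<equiv> \<Sum>S\<in>D. \<Sum>T\<in>D. \<bar>lam S * lam T\<bar> * e (S \<union> T)"

text \<open>Selberg's diagonalization: the product of \<open>\<gamma>\<close> over the least common multiple is the product over
  \<open>S\<close> and \<open>T\<close>, divided by that over the greatest common divisor; and the reciprocal of \<open>\<gamma>\<close> is a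
  divisor sum of the function that is \<open>1 / \<gamma> - 1\<close> at primes.\<close>

lemma quadratic_form_diagonal:
  fixes lam :: "'a set \<Rightarrow> real"
  assumes D: "finite D" "\<And>S. S \<in> D \<Longrightarrow> finite S" "\<And>S T. S \<in> D \<Longrightarrow> T \<subseteq> S \<Longrightarrow> T \<in> D"
    and \<gamma>: "\<And>S p. S \<in> D \<Longrightarrow> p \<in> S \<Longrightarrow> \<gamma> p \<noteq> 0"
  shows "lcm_form D lam \<gamma> =
    (\<Sum>U\<in>D. (\<Prod>p\<in>U. 1 / \<gamma> p - 1) * (\<Sum>S | S \<in> D \<and> U \<subseteq> S. lam S * (\<Prod>p\<in>S. \<gamma> p))\<^sup>2)"
proof -
  define a where "a = (\<lambda>S. lam S * (\<Prod>p\<in>S. \<gamma> p))"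
  define h where "h = (\<lambda>U. \<Prod>p\<in>U. 1 / \<gamma> p - 1)"
  define i where "i = (\<lambda>U S :: 'a set. if U \<subseteq> S then 1 else (0 :: real))"
  have split: "lam S * lam T * (\<Prod>p\<in>S \<union> T. \<gamma> p) = (\<Sum>U\<in>D. h U * (i U S * a S) * (i U T * a T))"
    if S: "S \<in> D" and T: "T \<in> D" for S T
  proof -
    have fin: "finite S" "finite T" using D S T by auto
    have nz: "prod \<gamma> (S \<inter> T) \<noteq> 0" using \<gamma>[OF S] fin by (subst prod_zero_iff) auto
    have "prod \<gamma> (S \<union> T) * prod \<gamma> (S \<inter> T) = prod \<gamma> S * prod \<gamma> T"
      using fin by (rule prod.union_inter)
    then have "lam S * lam T * prod \<gamma> (S \<union> T) = a S * a T * (1 / prod \<gamma> (S \<inter> T))"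
      using nz by (simp add: a_def field_simps)
    also have "1 / prod \<gamma> (S \<inter> T) = (\<Prod>p\<in>S \<inter> T. (1 / \<gamma> p - 1) + 1)"
      by (simp add: prod_dividef)
    also have "\<dots> = (\<Sum>U\<in>Pow (S \<inter> T). h U)"
      using fin by (subst prod_add) (auto simp: h_def)
    also have "\<dots> = (\<Sum>U\<in>D. if U \<subseteq> S \<inter> T then h U else 0)"
    proof (subst sum.inter_filter[symmetric])
      have "Pow (S \<inter> T) = {U \<in> D. U \<subseteq> S \<inter> T}" using D(3) S by blast
      then show "sum h (Pow (S \<inter> T)) = sum h {x \<in> D. x \<subseteq> S \<inter> T}" by simp
    qed (use D in simp)
    also have "a S * a T * \<dots> = (\<Sum>U\<in>D. h U * (i U S * a S) * (i U T * a T))"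
      unfolding sum_distrib_left by (intro sum.cong) (auto simp: i_def)
    finally show ?thesis .
  qed
  have sq: "(\<Sum>S | S \<in> D \<and> U \<subseteq> S. a S)\<^sup>2 = (\<Sum>S\<in>D. \<Sum>T\<in>D. (i U S * a S) * (i U T * a T))" for U
  proof -
    have "(\<Sum>S | S \<in> D \<and> U \<subseteq> S. a S) = (\<Sum>S\<in>D. i U S * a S)"
      using D by (subst sum.inter_filter) (auto simp: i_def intro: sum.cong)
    then show ?thesis by (simp add: power2_eq_square sum_product)
  qed
  have "lcm_form D lam \<gamma> =
      (\<Sum>S\<in>D. \<Sum>T\<in>D. \<Sum>U\<in>D. h U * ((i U S * a S) * (i U T * a T)))"
    using split by (intro sum.cong refl) (simp only: mult.assoc)
  also have "\<dots> = (\<Sum>S\<in>D. \<Sum>U\<in>D. \<Sum>T\<in>D. h U * ((i U S * a S) * (i U T * a T)))"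
    by (intro sum.cong refl sum.swap)
  also have "\<dots> = (\<Sum>U\<in>D. \<Sum>S\<in>D. \<Sum>T\<in>D. h U * ((i U S * a S) * (i U T * a T)))"
    by (rule sum.swap)
  also have "\<dots> = (\<Sum>U\<in>D. h U * (\<Sum>S | S \<in> D \<and> U \<subseteq> S. a S)\<^sup>2)"
    by (simp only: sq sum_distrib_left)
  finally show ?thesis by (simp only: a_def h_def)
qed

text \<open>Moebius inversion with a twist: after exchanging the sums, the inner one runs over the interval
  between \<open>U\<close> and \<open>V\<close> and is a product over primes. For \<open>\<kappa> = 1\<close> only \<open>V = U\<close> survives.\<close>

lemma upset_double_sum:
  fixes v :: "'a set \<Rightarrow> real"
  assumes D: "finite D" "\<And>S. S \<in> D \<Longrightarrow> finite S" "\<And>S T. S \<in> D \<Longrightarrow> T \<subseteq> S \<Longrightarrow> T \<in> D"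
    and U: "U \<in> D"
  shows "(\<Sum>S | S \<in> D \<and> U \<subseteq> S. (\<Prod>p\<in>S. - \<kappa> p) * (\<Sum>V | V \<in> D \<and> S \<subseteq> V. v V)) =
    (\<Prod>p\<in>U. - \<kappa> p) * (\<Sum>V | V \<in> D \<and> U \<subseteq> V. v V * (\<Prod>p\<in>V - U. 1 - \<kappa> p))"
proof -
  let ?k = "\<lambda>S. \<Prod>p\<in>S. - \<kappa> p" and ?q = "\<lambda>S. \<Prod>p\<in>S. 1 - \<kappa> p"
  have inner: "(\<Sum>S | U \<subseteq> S \<and> S \<subseteq> V. ?k S) = ?k U * ?q (V - U)"
    if V: "V \<in> D" "U \<subseteq> V" for V
  proof -
    have fin: "finite V" "finite U" using V D finite_subset by blast+
    \<comment> \<open>The factor at a prime of \<open>V\<close> outside \<open>U\<close> is \<open>1\<close> or \<open>- \<kappa> p\<close>, according to membership in \<open>S\<close>.\<close>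
    have "(\<Sum>S | U \<subseteq> S \<and> S \<subseteq> V. ?k S) = (\<Sum>C\<in>Pow (V - U). ?k (U \<union> C))"
      using V(2) by (intro sum.reindex_bij_witness[where i = "\<lambda>C. U \<union> C" and j = "\<lambda>S. S - U"])
        (auto simp: Un_absorb1)
    also have "\<dots> = (\<Sum>C\<in>Pow (V - U). ?k U * ?k C)"
    proof (intro sum.cong refl prod.union_disjoint)
      fix C assume "C \<in> Pow (V - U)"
      then show "finite C" "U \<inter> C = {}" using fin finite_subset by auto
    qed (use fin in auto)
    also have "\<dots> = ?k U * (\<Prod>p\<in>V - U. - \<kappa> p + 1)"
      using fin by (subst prod_add) (auto simp: sum_distrib_left)
    finally show ?thesis by simp
  qed
  have "(\<Sum>S | S \<in> D \<and> U \<subseteq> S. ?k S * (\<Sum>V | V \<in> D \<and> S \<subseteq> V. v V)) =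
      (\<Sum>S\<in>D. \<Sum>V\<in>D. if U \<subseteq> S \<and> S \<subseteq> V then ?k S * v V else 0)"
    using D(1) unfolding sum_distrib_left sum.inter_filter[OF D(1)]
    by (intro sum.cong) (auto intro!: sum.neutral sum.cong)
  also have "\<dots> = (\<Sum>V\<in>D. \<Sum>S\<in>D. if U \<subseteq> S \<and> S \<subseteq> V then ?k S * v V else 0)"
    by (rule sum.swap)
  also have "\<dots> = (\<Sum>V\<in>D. if U \<subseteq> V then ?k U * (v V * ?q (V - U)) else 0)"
  proof (intro sum.cong refl)
    fix V assume V: "V \<in> D"
    have "(\<Sum>S\<in>D. if U \<subseteq> S \<and> S \<subseteq> V then ?k S * v V else 0) =
        (\<Sum>S | S \<in> D \<and> (U \<subseteq> S \<and> S \<subseteq> V). ?k S * v V)"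
      using D(1) by (simp add: sum.inter_filter)
    also have "{S. S \<in> D \<and> (U \<subseteq> S \<and> S \<subseteq> V)} = {S. U \<subseteq> S \<and> S \<subseteq> V}" using D(3) V by blast
    also have "(\<Sum>S | U \<subseteq> S \<and> S \<subseteq> V. ?k S * v V) =
        (if U \<subseteq> V then ?k U * (v V * ?q (V - U)) else 0)"
    proof (cases "U \<subseteq> V")
      case True
      then show ?thesis using inner[OF V True] unfolding sum_distrib_right[symmetric] by simp
    next
      case False
      then have "{S. U \<subseteq> S \<and> S \<subseteq> V} = {}" by blast
      then show ?thesis using False by (simp only: sum.empty if_False)
    qed
    finally show "(\<Sum>S\<in>D. if U \<subseteq> S \<and> S \<subseteq> V then ?k S * v V else 0) =
        (if U \<subseteq> V then ?k U * (v V * ?q (V - U)) else 0)" .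
  qed
  also have "\<dots> = ?k U * (\<Sum>V | V \<in> D \<and> U \<subseteq> V. v V * ?q (V - U))"
    unfolding sum_distrib_left sum.inter_filter[OF D(1)] by (intro sum.cong) auto
  finally show ?thesis .
qed

text \<open>The inverse of the substitution that diagonalizes the form with density \<open>k / p\<close>. Up to sign and a
  multiplicative factor the function \<open>y\<close> consists of the new variables, so that a simple shape can be
  prescribed for it directly.\<close>

definition selberg_weight :: "nat set set \<Rightarrow> nat \<Rightarrow> (nat set \<Rightarrow> real) \<Rightarrow> nat set \<Rightarrow> real" where
  "selberg_weight D k y S = (-1) ^ card S * (\<Prod>p\<in>S. real p / real k) *
     (\<Sum>V | V \<in> D \<and> S \<subseteq> V. y V * (\<Prod>p\<in>V. real k / (real p - real k)))"

text \<open>The same weights in the form with another density \<open>\<gamma>\<close>. Here \<open>\<kappa>\<close> is the ratio of the two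
  densities; where it differs from \<open>1\<close>, the diagonal variables become sums over multiples.\<close>

lemma selberg_weight_form:
  assumes D: "finite D" "\<And>S. S \<in> D \<Longrightarrow> finite S" "\<And>S T. S \<in> D \<Longrightarrow> T \<subseteq> S \<Longrightarrow> T \<in> D"
    and \<gamma>: "\<And>S p. S \<in> D \<Longrightarrow> p \<in> S \<Longrightarrow> \<gamma> p \<noteq> 0"
    and \<kappa>: "\<And>S p. S \<in> D \<Longrightarrow> p \<in> S \<Longrightarrow> \<kappa> p = \<gamma> p * (real p / real k)"
  shows "lcm_form D (selberg_weight D k y) \<gamma> =
    (\<Sum>U\<in>D. (\<Prod>p\<in>U. (1 / \<gamma> p - 1) * (\<kappa> p)\<^sup>2) *
      (\<Sum>V | V \<in> D \<and> U \<subseteq> V. y V * (\<Prod>p\<in>V. real k / (real p - real k)) * (\<Prod>p\<in>V - U. 1 - \<kappa> p))\<^sup>2)"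
proof -
  define v where "v = (\<lambda>V. y V * (\<Prod>p\<in>V. real k / (real p - real k)))"
  let ?w = "selberg_weight D k y" and ?k = "\<lambda>U. \<Prod>p\<in>U. - \<kappa> p" and ?h = "\<lambda>U. \<Prod>p\<in>U. 1 / \<gamma> p - 1"
  let ?J = "\<lambda>U. \<Sum>V | V \<in> D \<and> U \<subseteq> V. v V * (\<Prod>p\<in>V - U. 1 - \<kappa> p)"
  let ?I = "\<lambda>U. \<Sum>S | S \<in> D \<and> U \<subseteq> S. ?w S * (\<Prod>p\<in>S. \<gamma> p)"
  have w: "?w S * (\<Prod>p\<in>S. \<gamma> p) = ?k S * (\<Sum>V | V \<in> D \<and> S \<subseteq> V. v V)"
    if S: "S \<in> D" for S
  proof -
    have "(-1) ^ card S * (\<Prod>p\<in>S. real p / real k) * (\<Prod>p\<in>S. \<gamma> p) = ?k S"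
      unfolding prod_constant[symmetric] prod.distrib[symmetric]
      using \<kappa>[OF S] by (intro prod.cong) (auto simp: mult_ac)
    then show ?thesis unfolding selberg_weight_def v_def by (simp add: mult_ac)
  qed
  have "lcm_form D ?w \<gamma> =
      (\<Sum>U\<in>D. ?h U *
        (?I U)\<^sup>2)"
    using D \<gamma> by (rule quadratic_form_diagonal)
  also have "\<dots> = (\<Sum>U\<in>D. ?h U *
      (?k U * ?J U)\<^sup>2)"
  proof (intro sum.cong refl)
    fix U assume U: "U \<in> D"
    have "?I U =
        (\<Sum>S | S \<in> D \<and> U \<subseteq> S. ?k S * (\<Sum>V | V \<in> D \<and> S \<subseteq> V. v V))"
      using w by (intro sum.cong) auto
    also have "\<dots> = ?k U * ?J U"
      using D U by (rule upset_double_sum)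
    finally show "?h U *
        (?I U)\<^sup>2 = ?h U *
      (?k U * ?J U)\<^sup>2"
      by simp
  qed
  also have "\<dots> = (\<Sum>U\<in>D. (\<Prod>p\<in>U. (1 / \<gamma> p - 1) * (\<kappa> p)\<^sup>2) *
      (?J U)\<^sup>2)"
  proof (intro sum.cong refl)
    fix U
    have "(?k U)\<^sup>2 = (\<Prod>p\<in>U. (\<kappa> p)\<^sup>2)"
      by (simp only: prod_power_distrib power2_minus)
    then show "?h U *
      (?k U * ?J U)\<^sup>2 =
      (\<Prod>p\<in>U. (1 / \<gamma> p - 1) * (\<kappa> p)\<^sup>2) *
      (?J U)\<^sup>2"
      by (simp only: power_mult_distrib prod.distrib mult.assoc)
  qed
  finally show ?thesis by (simp only: v_def)
qed

definition linear_weight :: "real \<Rightarrow> real \<Rightarrow> real \<Rightarrow> nat set \<Rightarrow> real" where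
  "linear_weight a b R S = a + b * ln (R / val S)"

lemma ln_quotient_bounds:
  assumes "S \<in> sqfree E R"
  shows "0 \<le> ln (R / val S)" "ln (R / val S) \<le> ln R" "1 \<le> R / val S"
proof -
  note S = sqfreeD[OF assms]
  show *: "1 \<le> R / val S" using S(4,5) by (simp add: field_simps)
  then show "0 \<le> ln (R / val S)" by (rule ln_ge_zero)
  have "R \<ge> 1" using S(4,5) by linarith
  then show "ln (R / val S) \<le> ln R"
    using S(5) by (subst ln_div) (auto simp del: of_nat_prod)
qed

text \<open>The density is the one that the weights are made for, so \<open>\<kappa> = 1\<close> and the form is diagonal in \<open>y\<close>.\<close>

lemma form_all_eq:
  fixes k w :: nat and a b R :: real
  assumes k: "1 \<le> k" "k \<le> w"
  defines "D \<equiv> rough w R"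
  shows "lcm_form D (selberg_weight D k y) (\<lambda>p. real k / real p) =
    (\<Sum>U\<in>D. (\<Prod>p\<in>U. real k * (1 / (real p - real k))) * (y U)\<^sup>2)"
proof -
  have big: "real p > real k" "real p > 0" if "S \<in> D" "p \<in> S" for S p
    using that k sqfreeD(3)[of S "{..w}" R] unfolding D_def by (auto simp: disjoint_iff)
  let ?A = "\<lambda>U. \<Prod>p\<in>U. (1 / (real k / real p) - 1) * 1\<^sup>2"
  let ?B = "\<lambda>U. \<Prod>p\<in>U. real k * (1 / (real p - real k))"
  let ?v = "\<lambda>V. y V * (\<Prod>p\<in>V. real k / (real p - real k))"
  let ?J = "\<lambda>U. \<Sum>V | V \<in> D \<and> U \<subseteq> V. ?v V * (\<Prod>p\<in>V - U. 1 - 1)"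
  have "lcm_form D (selberg_weight D k y) (\<lambda>p. real k / real p) =
     (\<Sum>U\<in>D. ?A U *
      (?J U)\<^sup>2)"
    by (rule selberg_weight_form) (use k big sqfree_subset in \<open>auto simp: D_def dest: sqfreeD(1)\<close>)
  also have "\<dots> = (\<Sum>U\<in>D. ?B U * (y U)\<^sup>2)"
  proof (intro sum.cong refl)
    fix U assume U: "U \<in> D"
    have finV: "finite V" if "V \<in> D" for V using that by (auto simp: D_def dest: sqfreeD(1))
    have "(?J U) =
        (\<Sum>V\<in>{U}. ?v V)"
    proof (rule sum.mono_neutral_cong_right)
      show "finite {V. V \<in> D \<and> U \<subseteq> V}" by (simp add: D_def)
      show "\<forall>V\<in>{V. V \<in> D \<and> U \<subseteq> V} - {U}.
          ?v V * (\<Prod>p\<in>V - U. 1 - 1) = 0"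
        using finV by (auto simp: card_eq_0_iff)
    qed (use U in auto)
    then have "?A U *
        (?J U)\<^sup>2 =
        (\<Prod>p\<in>U. (1 / (real k / real p) - 1) * (real k / (real p - real k))\<^sup>2) * (y U)\<^sup>2"
      by (simp add: power_mult_distrib prod_power_distrib[symmetric] prod.distrib)
    also have "(\<Prod>p\<in>U. (1 / (real k / real p) - 1) * (real k / (real p - real k))\<^sup>2) =
        ?B U"
    proof (intro prod.cong refl)
      fix p assume "p \<in> U"
      then have "real p - real k > 0" "real k > 0" using big[OF U] k by auto
      then show "(1 / (real k / real p) - 1) * (real k / (real p - real k))\<^sup>2 = real k * (1 / (real p - real k))"
        by (simp add: divide_simps power2_eq_square)
    qed
    finally show "?A U *
        (?J U)\<^sup>2 =
        ?B U * (y U)\<^sup>2" .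
  qed
  finally show ?thesis .
qed

text \<open>For the primes one shift is lost, and the density is \<open>(k - 1) / (p - 1)\<close>. Then
  \<open>1 - \<kappa> = (p - k) / (k * (p - 1))\<close>, and the diagonal variables are sums of \<open>y\<close> over multiples with
  weights \<open>1 / (p - 1)\<close>. These sums have dimension one, and integrating the linear function
  \<open>a + b * X\<close> turns them into \<open>a * X + b * X^2 / 2\<close>. The factors \<open>1 - 1 / p\<close> from the coprimality
  condition combine with the other local factors to exactly \<open>(k - 1) / (p - k)\<close>.\<close>

lemma form_primes_lower:
  fixes k w :: nat and a b R :: real
  assumes k: "2 \<le> k" "k \<le> w" and ab: "0 \<le> a" "0 \<le> b"
  defines "D \<equiv> rough w R"
  defines "X \<equiv> \<lambda>U. ln (R / val U)"
  defines "lam \<equiv> selberg_weight D k (linear_weight a b R)"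
  shows "(sieve_density {..w})\<^sup>2 *
      (\<Sum>U\<in>D. (\<Prod>p\<in>U. real (k - 1) * (1 / (real p - real k))) * (a * X U + b * (X U)\<^sup>2 / 2)\<^sup>2) \<le>
    lcm_form D lam (\<lambda>p. real (k - 1) / (real p - 1))"
proof -
  define E where "E = {..w}"
  define \<alpha> where "\<alpha> = sieve_density E"
  have \<alpha>: "\<alpha> > 0" unfolding \<alpha>_def by (rule sieve_density_pos)
  define \<kappa> where "\<kappa> = (\<lambda>p. real (k - 1) / (real p - 1) * (real p / real k))"
  have big: "real p > real k" "real p > 1" if "S \<in> D" "p \<in> S" for S p
  proof -
    have "p > w" using that sqfreeD(3)[of S "{..w}" R] unfolding D_def by fastforce
    then show "real p > real k" "real p > 1" using k by auto
  qed
  have big': "real p > real k" "real p > 1" if "p \<notin> E" for p using that k by (auto simp: E_def)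
  have kk: "real (k - 1) = real k - 1" "real k > 1" using k by auto
  let ?A = "\<lambda>U. \<Prod>p\<in>U. (1 / (real (k - 1) / (real p - 1)) - 1) * (\<kappa> p)\<^sup>2"
  let ?B = "\<lambda>U. \<Prod>p\<in>U. real (k - 1) * (1 / (real p - real k))"
  let ?J = "\<lambda>U. \<Sum>V | V \<in> D \<and> U \<subseteq> V. linear_weight a b R V * (\<Prod>p\<in>V. real k / (real p - real k)) * (\<Prod>p\<in>V - U. 1 - \<kappa> p)"
  let ?L = "\<lambda>U m. log_moment (E \<union> U) (\<lambda>p. 1 / (real p - 1)) m (R / val U)"
  let ?Y = "\<lambda>U. a * X U + b * (X U)\<^sup>2 / 2"
  have step: "\<alpha>\<^sup>2 * (?B U * (?Y U)\<^sup>2) \<le>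
      ?A U *
      (?J U)\<^sup>2"
    if U: "U \<in> D" for U
  proof -
    have U': "U \<in> sqfree E R" using U by (simp add: D_def E_def)
    note UD = sqfreeD[OF U']
    define G where "G = sqfree (E \<union> U) (R / val U)"
    have X: "0 \<le> X U" "1 \<le> R / val U" using ln_quotient_bounds[OF U'] by (auto simp: X_def)
    define P where "P = (\<Prod>p\<in>U. real k / (real p - real k))"
    have P: "P \<ge> 0" unfolding P_def using big(1)[OF U] by (intro prod_nonneg) (auto simp: less_imp_le)
    have low: "\<alpha> * (\<Prod>p\<in>U. 1 - 1 / real p) * X U ^ Suc m / Suc m \<le>
        ?L U m" for m
    proof -
      have dens: "\<alpha> * (\<Prod>p\<in>U. 1 - 1 / real p) = sieve_density (E \<union> U)"
        unfolding \<alpha>_def using UD by (subst sieve_density_Un) (auto simp: E_def)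
      show ?thesis unfolding dens X_def
      proof (rule log_moment_lower)
        show "sieve_density (E \<union> U) * ln z \<le> log_moment (E \<union> U) (\<lambda>p. 1 / (real p - 1)) 0 z" if "1 \<le> z" for z
          using one_dim_lower[of "E \<union> U" z] UD that by (simp add: log_moment_def E_def)
      qed (use X in simp)
    qed
    have "?J U =
        (\<Sum>C\<in>G. linear_weight a b R (U \<union> C) * (\<Prod>p\<in>U \<union> C. real k / (real p - real k)) * (\<Prod>p\<in>U \<union> C - U. 1 - \<kappa> p))"
      unfolding D_def G_def E_def using U by (intro sum_upsets) (simp add: D_def)
    also have "\<dots> = (\<Sum>C\<in>G. P * (a * ((\<Prod>p\<in>C. 1 / (real p - 1)) * ln (R / val U / val C) ^ 0) +
        b * ((\<Prod>p\<in>C. 1 / (real p - 1)) * ln (R / val U / val C) ^ 1)))"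
    proof (intro sum.cong refl)
      fix C assume C: "C \<in> G"
      note CD = sqfreeD[OF C[unfolded G_def]]
      note UC = sqfree_Un[OF U' C[unfolded G_def]]
      have disj: "U \<inter> C = {}" by (rule UC(2))
      then have [simp]: "U \<union> C - U = C" by blast
      have e1: "(\<Prod>p\<in>U \<union> C. real k / (real p - real k)) = P * (\<Prod>p\<in>C. real k / (real p - real k))"
        unfolding P_def using UD CD disj by (intro prod.union_disjoint) auto
      have e2: "linear_weight a b R (U \<union> C) = a + b * ln (R / val U / val C)"
        unfolding linear_weight_def UC(3) ..
      \<comment> \<open>In the cofactor the local factors collapse to \<open>1 / (p - 1)\<close>.\<close>
      have e3: "(\<Prod>p\<in>C. real k / (real p - real k)) * (\<Prod>p\<in>C. 1 - \<kappa> p) = (\<Prod>p\<in>C. 1 / (real p - 1))"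
        unfolding prod.distrib[symmetric]
      proof (intro prod.cong refl)
        fix p assume "p \<in> C"
        then have "p \<notin> E" using CD(3) by blast
        then have p: "real p - real k > 0" "real p - 1 > 0" "real k > 0" using big'[of p] k by auto
        have "1 - \<kappa> p = (real p - real k) / (real k * (real p - 1))"
          unfolding \<kappa>_def kk using p by (simp add: field_simps)
        then show "real k / (real p - real k) * (1 - \<kappa> p) = 1 / (real p - 1)" using p by simp
      qed
      show "linear_weight a b R (U \<union> C) * (\<Prod>p\<in>U \<union> C. real k / (real p - real k)) * (\<Prod>p\<in>U \<union> C - U. 1 - \<kappa> p) =
        P * (a * ((\<Prod>p\<in>C. 1 / (real p - 1)) * ln (R / val U / val C) ^ 0) +
        b * ((\<Prod>p\<in>C. 1 / (real p - 1)) * ln (R / val U / val C) ^ 1))"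
        unfolding e1 e2 e3[symmetric] by (simp add: algebra_simps del: of_nat_prod)
    qed
    also have "\<dots> = P * (a * ?L U 0 +
        b * ?L U 1)"
      unfolding log_moment_def G_def sum_distrib_left sum.distrib[symmetric] ..
    finally have sum_eq: "?J U =
      P * (a * ?L U 0 +
        b * ?L U 1)" .
    define Q where "Q = (\<Prod>p\<in>U. 1 - 1 / real p)"
    have Q: "Q \<ge> 0" unfolding Q_def
    proof (rule prod_nonneg)
      fix p assume "p \<in> U"
      then show "0 \<le> 1 - 1 / real p" using big(2)[OF U, of p] by (simp add: field_simps)
    qed
    have "P * (a * (\<alpha> * Q * X U ^ Suc 0 / Suc 0) + b * (\<alpha> * Q * X U ^ Suc 1 / Suc 1)) \<le>
        P * (a * ?L U 0 +
        b * ?L U 1)"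
      using ab P unfolding Q_def by (intro mult_left_mono add_mono low) auto
    also have "P * (a * (\<alpha> * Q * X U ^ Suc 0 / Suc 0) + b * (\<alpha> * Q * X U ^ Suc 1 / Suc 1)) =
        \<alpha> * (P * Q) * ?Y U" by (simp add: algebra_simps power2_eq_square)
    finally have "(\<alpha> * (P * Q) * ?Y U)\<^sup>2 \<le>
        (?J U)\<^sup>2"
      unfolding sum_eq using \<alpha> P Q X ab by (intro power_mono mult_nonneg_nonneg add_nonneg_nonneg) auto
    then have "?A U * (\<alpha> * (P * Q) * ?Y U)\<^sup>2 \<le>
      ?A U * (?J U)\<^sup>2"
    proof (rule mult_left_mono)
      show "0 \<le> ?A U"
      proof (intro prod_nonneg mult_nonneg_nonneg)
        fix p assume "p \<in> U"
        then have "real p - real k > 0" "real p - 1 > 0" using big[OF U] k by auto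
        then show "0 \<le> 1 / (real (k - 1) / (real p - 1)) - 1" unfolding kk using kk(2) by (simp add: field_simps)
      qed auto
    qed
    moreover have "?A U * (P * Q)\<^sup>2 =
        ?B U"
    proof -
      have "?A U * (P * Q)\<^sup>2 =
          (\<Prod>p\<in>U. (1 / (real (k - 1) / (real p - 1)) - 1) * (\<kappa> p)\<^sup>2 * (real k / (real p - real k) * (1 - 1 / real p))\<^sup>2)"
        unfolding P_def Q_def by (simp add: prod.distrib[symmetric] prod_power_distrib)
      also have "\<dots> = ?B U"
      proof (intro prod.cong refl)
        fix p assume "p \<in> U"
        then have p: "real p - real k > 0" "real p - 1 > 0" "real p > 0" "real k > 0" "real k - 1 > 0"
          using big[OF U, of p] kk by auto
        have "\<kappa> p * (real k / (real p - real k) * (1 - 1 / real p)) = (real k - 1) / (real p - real k)"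
        proof -
          have *: "c / A * (P / K) * (K / B * (A / P)) = c / B"
            if "A > 0" "B > 0" "P > 0" "K > 0" for c A B P K :: real
            using that by (simp add: field_simps)
          have "1 - 1 / real p = (real p - 1) / real p" using p by (simp add: field_simps)
          then show ?thesis unfolding \<kappa>_def kk using *[OF p(2,1,3,4)] by simp
        qed
        then have "(\<kappa> p)\<^sup>2 * (real k / (real p - real k) * (1 - 1 / real p))\<^sup>2 = ((real k - 1) / (real p - real k))\<^sup>2"
          by (metis power_mult_distrib)
        moreover have "1 / (real (k - 1) / (real p - 1)) - 1 = (real p - real k) / (real k - 1)"
          unfolding kk using p by (simp add: field_simps)
        ultimately show "(1 / (real (k - 1) / (real p - 1)) - 1) * (\<kappa> p)\<^sup>2 * (real k / (real p - real k) * (1 - 1 / real p))\<^sup>2 =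
            real (k - 1) * (1 / (real p - real k))"
          unfolding kk using p by (simp add: mult.assoc power2_eq_square)
      qed
      finally show ?thesis .
    qed
    moreover have "A * (\<alpha> * (P * Q) * Y)\<^sup>2 = \<alpha>\<^sup>2 * (A * (P * Q)\<^sup>2 * Y\<^sup>2)" for A Y
      by (simp add: power_mult_distrib)
    ultimately show ?thesis by simp
  qed
  have "lcm_form D lam (\<lambda>p. real (k - 1) / (real p - 1)) =
    (\<Sum>U\<in>D. ?A U *
      (?J U)\<^sup>2)"
    unfolding lam_def
  proof (rule selberg_weight_form)
    show "real (k - 1) / (real p - 1) \<noteq> 0" if "S \<in> D" "p \<in> S" for S p using big[OF that] kk by auto
    show "T \<in> D" if "S \<in> D" "T \<subseteq> S" for S T using that sqfree_subset by (auto simp: D_def)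
  qed (auto simp: D_def \<kappa>_def dest: sqfreeD(1))
  also have "\<dots> \<ge> (\<Sum>U\<in>D. \<alpha>\<^sup>2 * (?B U * (?Y U)\<^sup>2))"
    by (intro sum_mono step)
  finally show ?thesis by (simp only: sum_distrib_left \<alpha>_def E_def)
qed

lemma selberg_weight_bound:
  fixes k w :: nat and a b R :: real
  assumes k: "1 \<le> k" "2 * k \<le> w" and ab: "0 \<le> a" "0 \<le> b"
  defines "D \<equiv> rough w R"
  assumes S: "S \<in> D"
  shows "\<bar>selberg_weight D k (linear_weight a b R) S\<bar> \<le>
    2 ^ card S * ((a + b * ln R) * log_moment {..w} (\<lambda>p. real k * (1 / (real p - real k))) 0 R)"
proof -
  define E where "E = {..w}"
  define u where "u = (\<lambda>p. real k / (real p - real k))"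
  have big: "real p \<ge> 2 * real k" "real p > real k" if "p \<notin> E" for p using that k by (auto simp: E_def)
  have S': "S \<in> sqfree E R" using S by (simp add: D_def E_def)
  note SD = sqfreeD[OF S']
  have notE: "p \<notin> E" if "p \<in> T" "T \<in> sqfree E R" for p T using that sqfreeD(3) by blast
  have u0: "0 \<le> (\<Prod>p\<in>T. u p)" if "T \<in> sqfree E R" for T
    unfolding u_def using that notE big(2) by (intro prod_nonneg) (auto simp: less_imp_le)
  have R: "1 \<le> R" using SD(4,5) by linarith
  have y: "0 \<le> linear_weight a b R V \<and> linear_weight a b R V \<le> a + b * ln R" if "V \<in> sqfree E R" for V
    using ln_quotient_bounds[OF that] ab unfolding linear_weight_def by (auto intro: mult_left_mono)
  let ?F = "sqfree E R" and ?G = "sqfree (E \<union> S) (R / val S)"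
  let ?y = "linear_weight a b R" and ?l = "a + b * ln R" and ?u = "\<lambda>V. \<Prod>p\<in>V. u p"
  have "\<bar>selberg_weight D k (?y) S\<bar> =
      (\<Prod>p\<in>S. real p / real k) * \<bar>\<Sum>V | V \<in> D \<and> S \<subseteq> V. ?y V * ?u V\<bar>"
    unfolding selberg_weight_def u_def by (simp add: abs_mult power_abs abs_prod)
  also have "\<bar>\<Sum>V | V \<in> D \<and> S \<subseteq> V. ?y V * ?u V\<bar> =
      (\<Sum>V | V \<in> D \<and> S \<subseteq> V. ?y V * ?u V)"
    using y u0 by (intro abs_of_nonneg sum_nonneg) (auto simp: D_def E_def)
  also have "\<dots> = (\<Sum>C\<in>?G. ?y (S \<union> C) * ?u (S \<union> C))"
    unfolding D_def E_def using S by (intro sum_upsets) (simp add: D_def)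
  also have "\<dots> \<le> (\<Sum>C\<in>?G. ?l * (?u S * ?u C))"
  proof (rule sum_mono)
    fix C assume C: "C \<in> sqfree (E \<union> S) (R / val S)"
    note CD = sqfreeD[OF C]
    note V = sqfree_Un[OF S' C]
    have "?u (S \<union> C) = ?u S * ?u C"
      using SD CD V(2) by (intro prod.union_disjoint) auto
    then show "?y (S \<union> C) * ?u (S \<union> C) \<le> ?l * (?u S * ?u C)"
      using y[OF V(1)] u0[OF V(1)] by (metis mult_right_mono)
  qed
  also have "\<dots> = ?l * ?u S * (\<Sum>C\<in>?G. ?u C)"
    by (simp add: sum_distrib_left mult_ac)
  also have "\<dots> \<le> ?l * ?u S * (\<Sum>C\<in>?F. ?u C)"
  proof (intro mult_left_mono sum_mono2)
    have "R / val S \<le> R" using SD(5) R by (simp add: divide_le_eq mult_le_cancel_left1)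
    then show "?G \<subseteq> ?F" by (intro sqfree_mono) auto
    show "0 \<le> ?l * ?u S" using ab R u0[OF S'] by auto
  qed (use u0 in auto)
  finally have "\<bar>selberg_weight D k (?y) S\<bar> \<le>
      (\<Prod>p\<in>S. real p / real k) * (?l * ?u S * (\<Sum>C\<in>?F. ?u C))"
    by (simp add: mult_left_mono prod_nonneg)
  also have "\<dots> = (\<Prod>p\<in>S. real p / real k * u p) * (?l * (\<Sum>C\<in>?F. ?u C))"
    by (simp only: prod.distrib mult_ac)
  also have "\<dots> \<le> 2 ^ card S * (?l * (\<Sum>C\<in>?F. ?u C))"
  proof (rule mult_right_mono)
    show "0 \<le> ?l * (\<Sum>C\<in>?F. ?u C)"
      using ab R u0 by (intro mult_nonneg_nonneg sum_nonneg add_nonneg_nonneg) auto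
    have "(\<Prod>p\<in>S. real p / real k * u p) \<le> (\<Prod>p\<in>S. 2)"
    proof (intro prod_mono)
      fix p assume "p \<in> S"
      then have p: "real p \<ge> 2 * real k" "real p - real k > 0" "real k > 0" using notE[OF _ S'] big[of p] k by auto
      have eq: "real p / real k * u p = real p / (real p - real k)" unfolding u_def using p by simp
      show "0 \<le> real p / real k * u p \<and> real p / real k * u p \<le> 2"
        unfolding eq using p by (simp add: divide_le_eq)
    qed
    then show "(\<Prod>p\<in>S. real p / real k * u p) \<le> 2 ^ card S" by simp
  qed
  finally show ?thesis by (simp add: log_moment_def E_def u_def)
qed

section \<open>Dyadic intervals with many primes\<close>

lemma ln_increment_le:
  fixes x :: real
  assumes "x > 0"
  shows "ln (x + 1) - ln x \<le> 1 / x"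
proof -
  have "x + 1 = x * (1 + 1 / x)" using assms by (simp add: field_simps)
  moreover have "1 + 1 / x > 0" using assms by (simp add: add_pos_pos)
  ultimately have "ln (x + 1) = ln x + ln (1 + 1 / x)" using assms by (metis ln_mult_pos)
  also have "ln (1 + 1 / x) \<le> 1 / x" using assms by (intro ln_add_one_self_le_self) simp
  finally show ?thesis by simp
qed

text \<open>A weak form of Stirling's formula.\<close>

lemma sum_ln_ge: "real n * ln (real n) - real n \<le> (\<Sum>m\<in>{1..n}. ln (real m))"
proof (induction n)
  case (Suc n)
  have "real n * (ln (real (Suc n)) - ln (real n)) \<le> 1"
  proof (cases "n = 0")
    case False
    then have "ln (real (Suc n)) - ln (real n) \<le> 1 / real n"
      using ln_increment_le[of "real n"] by (simp add: add.commute)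
    then show ?thesis using False by (simp add: field_simps)
  qed simp
  moreover have "(\<Sum>m\<in>{1..Suc n}. ln (real m)) = (\<Sum>m\<in>{1..n}. ln (real m)) + ln (real (Suc n))"
    by simp
  ultimately show ?case using Suc by (simp add: algebra_simps)
qed simp

text \<open>The summands are dominated by differences of consecutive values of \<open>(ln x + 2) / x\<close>, which
  telescope.\<close>

lemma sum_ln_div_le: "n \<ge> 1 \<Longrightarrow> (\<Sum>m\<in>{2..n}. ln (real m) / (real m * (real m - 1))) \<le> 2 - (ln (real n) + 2) / real n"
proof (induction n rule: dec_induct)
  case (step n)
  define x where "x = real n"
  have x: "x \<ge> 1" using step by (simp add: x_def)
  have "ln (x + 1) - ln x \<le> 1 / x" using x by (intro ln_increment_le) simp
  then have "(x + 1) * (ln (x + 1) - ln x) \<le> (x + 1) * (1 / x)" using x by (intro mult_left_mono) auto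
  also have "\<dots> \<le> 2" using x by (simp add: field_simps)
  finally have "ln (x + 1) \<le> (ln x + 2) * (x + 1) - (ln (x + 1) + 2) * x"
    by (simp add: algebra_simps)
  then have "ln (x + 1) / ((x + 1) * x) \<le> ((ln x + 2) * (x + 1) - (ln (x + 1) + 2) * x) / ((x + 1) * x)"
    using x by (intro divide_right_mono) auto
  also have "\<dots> = (ln x + 2) / x - (ln (x + 1) + 2) / (x + 1)"
    using x by (simp add: diff_divide_distrib)
  finally have "ln (x + 1) / ((x + 1) * x) \<le> (ln x + 2) / x - (ln (x + 1) + 2) / (x + 1)" .
  moreover have "{2..Suc n} = insert (Suc n) {2..n}" using step by auto
  ultimately show ?case using step by (simp add: x_def add.commute)
qed simp

text \<open>Legendre's formula for the exponent of \<open>p\<close> in \<open>n!\<close>, with the floors dropped.\<close>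

lemma sum_multiplicity_le:
  fixes p :: nat
  assumes p: "prime p"
  shows "(\<Sum>m\<in>{1..n}. real (multiplicity p m)) \<le> real n / (real p - 1)"
proof -
  have p1: "p > 1" using p by (rule prime_gt_1_nat)
  have mult: "multiplicity p m = (\<Sum>k\<in>{1..n}. if p ^ k dvd m then 1 else 0)" if m: "m \<in> {1..n}" for m
  proof -
    have "p ^ multiplicity p m \<le> m" using m by (intro dvd_imp_le multiplicity_dvd) auto
    moreover have "multiplicity p m < p ^ multiplicity p m" using p1 by (intro power_gt_expt) simp
    ultimately have "multiplicity p m \<le> n" using m by auto
    then have "{k. k \<in> {1..n} \<and> p ^ k dvd m} = {1..multiplicity p m}"
      using m p1 by (auto simp: power_dvd_iff_le_multiplicity)
    then have "card {k. k \<in> {1..n} \<and> p ^ k dvd m} = multiplicity p m" by simp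
    then show ?thesis by (simp add: sum.If_cases Int_def)
  qed
  have multiples: "(\<Sum>m\<in>{1..n}. if d dvd m then 1 else 0) \<le> real n / real d" if "d > 0" for d :: nat
  proof -
    have "{m. m \<in> {1..n} \<and> d dvd m} \<subseteq> (\<lambda>i. d * i) ` {1..n div d}"
    proof
      fix m assume "m \<in> {m. m \<in> {1..n} \<and> d dvd m}"
      then obtain i where i: "m = d * i" "1 \<le> m" "m \<le> n" by auto
      then have "i \<ge> 1" by (cases i) auto
      moreover have "i \<le> n div d" using i that by (simp add: less_eq_div_iff_mult_less_eq mult.commute)
      ultimately show "m \<in> (\<lambda>i. d * i) ` {1..n div d}" using i by auto
    qed
    then have "card {m. m \<in> {1..n} \<and> d dvd m} \<le> card ((\<lambda>i. d * i) ` {1..n div d})"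
      by (intro card_mono) auto
    also have "\<dots> \<le> card {1..n div d}" by (rule card_image_le) simp
    finally have "card {m. m \<in> {1..n} \<and> d dvd m} \<le> n div d" by simp
    moreover have "real (n div d) \<le> real n / real d" by (rule of_nat_div_le_of_nat)
    ultimately have "real (card {m. m \<in> {1..n} \<and> d dvd m}) \<le> real n / real d" by linarith
    then show ?thesis by (simp add: sum.If_cases Int_def)
  qed
  have "(\<Sum>m\<in>{1..n}. real (multiplicity p m)) = (\<Sum>m\<in>{1..n}. \<Sum>k\<in>{1..n}. if p ^ k dvd m then 1 else 0)"
  proof (intro sum.cong refl)
    fix m assume "m \<in> {1..n}"
    then show "real (multiplicity p m) = (\<Sum>k\<in>{1..n}. if p ^ k dvd m then 1 else 0)"
      by (subst mult) (auto simp: of_nat_sum intro!: sum.cong)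
  qed
  also have "\<dots> = (\<Sum>k\<in>{1..n}. \<Sum>m\<in>{1..n}. if p ^ k dvd m then 1 else 0)" by (rule sum.swap)
  also have "\<dots> \<le> (\<Sum>k\<in>{1..n}. real n / real (p ^ k))" using p1 by (intro sum_mono multiples) auto
  also have "\<dots> = real n * (\<Sum>k\<in>{1..n}. (1 / real p) ^ k)" by (simp add: sum_distrib_left power_divide)
  also have "\<dots> \<le> real n * (1 / (real p - 1))"
  proof (rule mult_left_mono)
    have "(\<Sum>k\<in>{1..n}. (1 / real p) ^ k) = (\<Sum>k\<le>n. (1 / real p) ^ k) - 1"
      by (simp add: atMost_atLeast0 sum.atLeast_Suc_atMost)
    also have "(\<Sum>k\<le>n. (1 / real p) ^ k) = (1 - (1 / real p) ^ Suc n) / (1 - 1 / real p)"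
      using p1 by (subst sum_gp0) auto
    also have "\<dots> \<le> 1 / (1 - 1 / real p)" using p1 by (intro divide_right_mono) auto
    also have "1 / (1 - 1 / real p) - 1 = 1 / (real p - 1)" using p1 by (simp add: field_simps)
    finally show "(\<Sum>k\<in>{1..n}. (1 / real p) ^ k) \<le> 1 / (real p - 1)" by simp
  qed simp
  finally show ?thesis by simp
qed

text \<open>The lower half of Mertens' first theorem, by factoring \<open>n!\<close>.\<close>

lemma mertens_lower:
  assumes n: "n \<ge> 1"
  shows "ln (real n) - 3 \<le> (\<Sum>p | p \<in> {1..n} \<and> prime p. ln (real p) / real p)"
proof -
  define P where "P = {p. p \<in> {1..n} \<and> prime p}"
  have "real n * ln (real n) - real n \<le> (\<Sum>m\<in>{1..n}. ln (real m))" by (rule sum_ln_ge)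
  also have "\<dots> = (\<Sum>m\<in>{1..n}. \<Sum>p\<in>P. real (multiplicity p m) * ln (real p))"
  proof (intro sum.cong refl)
    fix m assume m: "m \<in> {1..n}"
    have "m = (\<Prod>p\<in>prime_factors m. p ^ multiplicity p m)"
      using m by (intro prime_factorization_nat) simp
    then have "real m = real (\<Prod>p\<in>prime_factors m. p ^ multiplicity p m)" by (rule arg_cong)
    also have "\<dots> = (\<Prod>p\<in>prime_factors m. real p ^ multiplicity p m)" by simp
    finally have "ln (real m) = ln (\<Prod>p\<in>prime_factors m. real p ^ multiplicity p m)" by simp
    also have "\<dots> = (\<Sum>p\<in>prime_factors m. ln (real p ^ multiplicity p m))"
      by (intro ln_prod) (auto dest: in_prime_factors_imp_prime prime_gt_0_nat)
    also have "\<dots> = (\<Sum>p\<in>prime_factors m. real (multiplicity p m) * ln (real p))"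
      by (intro sum.cong refl ln_realpow)
    also have "\<dots> = (\<Sum>p\<in>P. real (multiplicity p m) * ln (real p))"
    proof (rule sum.mono_neutral_left)
      show "prime_factors m \<subseteq> P"
      proof
        fix p assume p: "p \<in> prime_factors m"
        then have "p dvd m" "prime p" by (auto simp: in_prime_factors_iff)
        moreover have "p \<le> m" using \<open>p dvd m\<close> m by (intro dvd_imp_le) auto
        ultimately show "p \<in> P" using m by (auto simp: P_def Suc_leI prime_gt_0_nat)
      qed
    qed (auto simp: P_def prime_factors_multiplicity)
    finally show "ln (real m) = (\<Sum>p\<in>P. real (multiplicity p m) * ln (real p))" .
  qed
  also have "\<dots> = (\<Sum>p\<in>P. ln (real p) * (\<Sum>m\<in>{1..n}. real (multiplicity p m)))"
    by (subst sum.swap) (simp add: sum_distrib_left mult.commute)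
  also have "\<dots> \<le> (\<Sum>p\<in>P. ln (real p) * (real n / (real p - 1)))"
    by (intro sum_mono mult_left_mono sum_multiplicity_le) (auto simp: P_def Suc_le_eq)
  also have "\<dots> = (\<Sum>p\<in>P. real n * (ln (real p) / real p + ln (real p) / (real p * (real p - 1))))"
  proof (intro sum.cong refl)
    fix p assume "p \<in> P"
    then have "real p > 1" by (auto simp: P_def dest: prime_gt_1_nat)
    then show "ln (real p) * (real n / (real p - 1)) = real n * (ln (real p) / real p + ln (real p) / (real p * (real p - 1)))"
      by (simp add: divide_simps) (simp add: algebra_simps)
  qed
  also have "\<dots> = real n * ((\<Sum>p\<in>P. ln (real p) / real p) + (\<Sum>p\<in>P. ln (real p) / (real p * (real p - 1))))"
    by (simp add: sum_distrib_left sum.distrib distrib_left)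
  also have "(\<Sum>p\<in>P. ln (real p) / (real p * (real p - 1))) \<le> 2"
  proof -
    have "(\<Sum>p\<in>P. ln (real p) / (real p * (real p - 1))) \<le> (\<Sum>m\<in>{2..n}. ln (real m) / (real m * (real m - 1)))"
      by (rule sum_mono2) (auto simp: P_def intro: prime_ge_2_nat)
    also have "\<dots> \<le> 2 - (ln (real n) + 2) / real n" using n by (rule sum_ln_div_le)
    also have "\<dots> \<le> 2" using n by simp
    finally show ?thesis .
  qed
  finally have "real n * (ln (real n) - 1) \<le> real n * ((\<Sum>p\<in>P. ln (real p) / real p) + 2)"
    by (simp add: algebra_simps mult_left_mono mult_right_mono)
  then have "ln (real n) - 1 \<le> (\<Sum>p\<in>P. ln (real p) / real p) + 2"
    using n by (simp add: mult_le_cancel_left)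
  then show ?thesis by (simp add: P_def)
qed

definition chebyshev_sum :: "nat \<Rightarrow> real" where
  "chebyshev_sum n = (\<Sum>p | p \<in> {1..n} \<and> prime p. ln (real p))"

lemma abel_sum_reciprocal:
  fixes a :: "nat \<Rightarrow> real"
  assumes "a 0 = 0"
  shows "(\<Sum>m\<in>{1..n}. (a m - a (m - 1)) / real m) =
    a n / real (n + 1) + (\<Sum>m\<in>{1..n}. a m / (real m * real (m + 1)))"
proof (induction n)
  case (Suc n)
  have "a n / real (n + 1) + (a (Suc n) - a n) / real (Suc n) =
      a (Suc n) / real (Suc n + 1) + a (Suc n) / (real (Suc n) * real (Suc n + 1))"
    by (simp add: divide_simps) (simp add: algebra_simps)
  then show ?case using Suc by simp
qed (use assms in simp)

text \<open>By partial summation, \<open>\<theta>(n) \<le> d * n + K\<close> would bound the sum of \<open>ln p / p\<close> by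
  \<open>d * ln n + O(1)\<close>, contradicting Mertens.\<close>

lemma chebyshev_sum_not_small:
  assumes d: "0 \<le> d" "d < 1" and K: "0 \<le> K"
  shows "\<not> (\<forall>n. chebyshev_sum n \<le> d * real n + K)"
proof
  assume small: "\<forall>n. chebyshev_sum n \<le> d * real n + K"
  have bound: "(1 - d) * ln (real n) \<le> 2 * d + 2 * K + 3" if n: "n \<ge> 1" for n
  proof -
    have step: "chebyshev_sum m - chebyshev_sum (m - 1) = (if prime m then ln (real m) else 0)"
      if m: "m \<in> {1..n}" for m
    proof -
      have "{1..m} = insert m {1..m - 1}" using m by auto
      then have "{p. p \<in> {1..m} \<and> prime p} = (if prime m then insert m else id) {p. p \<in> {1..m - 1} \<and> prime p}"
        by auto
      then show ?thesis using m by (auto simp: chebyshev_sum_def)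
    qed
    have "(\<Sum>p | p \<in> {1..n} \<and> prime p. ln (real p) / real p) =
        (\<Sum>m\<in>{1..n}. (chebyshev_sum m - chebyshev_sum (m - 1)) / real m)"
    proof (subst sum.inter_filter, simp, intro sum.cong refl)
      fix m assume "m \<in> {1..n}"
      then show "(if prime m then ln (real m) / real m else 0) = (chebyshev_sum m - chebyshev_sum (m - 1)) / real m"
        using step[of m] by simp
    qed
    also have "\<dots> = chebyshev_sum n / real (n + 1) + (\<Sum>m\<in>{1..n}. chebyshev_sum m / (real m * real (m + 1)))"
      by (rule abel_sum_reciprocal) (simp add: chebyshev_sum_def)
    also have "\<dots> \<le> (d + K) + (\<Sum>m\<in>{1..n}. d * (1 / real m) + K * (1 / real m - 1 / real (m + 1)))"
    proof (intro add_mono sum_mono)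
      have "chebyshev_sum n \<le> d * real n + K" using small by blast
      also have "\<dots> \<le> (d + K) * real (n + 1)" using d K by (simp add: algebra_simps)
      finally show "chebyshev_sum n / real (n + 1) \<le> d + K" by (simp add: divide_le_eq)
    next
      fix m assume m: "m \<in> {1..n}"
      have "chebyshev_sum m / (real m * real (m + 1)) \<le> (d * real m + K) / (real m * real (m + 1))"
        using small by (intro divide_right_mono) auto
      also have "\<dots> = d * (1 / real (m + 1)) + K * (1 / real m - 1 / real (m + 1))"
        using m by (simp add: divide_simps)
      also have "\<dots> \<le> d * (1 / real m) + K * (1 / real m - 1 / real (m + 1))"
        using d m by (intro add_right_mono mult_left_mono divide_left_mono) auto
      finally show "chebyshev_sum m / (real m * real (m + 1)) \<le> d * (1 / real m) + K * (1 / real m - 1 / real (m + 1))" .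
    qed
    also have "\<dots> = (d + K) + (d * harm n + K * (\<Sum>m\<in>{1..n}. 1 / real m - 1 / real (m + 1)))"
      by (simp add: sum.distrib sum_distrib_left harm_def inverse_eq_divide)
    also have "(\<Sum>m\<in>{1..n}. 1 / real m - 1 / real (m + 1)) = 1 - 1 / real (n + 1)"
      by (induction n) (simp_all add: add.commute)
    also have "K * (1 - 1 / real (n + 1)) \<le> K * 1" using K by (intro mult_left_mono) auto
    also have "harm n \<le> ln (real n) + 1"
      using euler_mascheroni_sequence_decreasing[of 1 n] n by (simp add: harm_def[of "Suc 0"])
    finally have "(\<Sum>p | p \<in> {1..n} \<and> prime p. ln (real p) / real p) \<le> (d + K) + (d * (ln (real n) + 1) + K)"
      using d by (simp add: mult_left_mono)
    then show ?thesis using mertens_lower[OF n] by (simp add: algebra_simps)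
  qed
  obtain n :: nat where n: "exp ((2 * d + 2 * K + 4) / (1 - d)) < real n" using reals_Archimedean2 by blast
  then have "real n > 0" by (meson exp_gt_zero order.strict_trans)
  then have "(2 * d + 2 * K + 4) / (1 - d) < ln (real n)" using n by (metis exp_less_cancel_iff exp_ln)
  then have "2 * d + 2 * K + 4 < (1 - d) * ln (real n)" using d by (simp add: field_simps)
  moreover have "n \<ge> 1" using \<open>real n > 0\<close> by simp
  ultimately show False using bound[of n] by linarith
qed

text \<open>The lower half of the prime number theorem for infinitely many dyadic intervals, which is all the sieve asks
  for. If all intervals beyond some point had fewer primes, then summing over dyadic intervals would give
  \<open>\<theta>(n) \<le> d * n + O(1)\<close> with \<open>d < 1\<close>.\<close>

lemma dyadic_primes_lower:
  fixes c :: real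
  assumes c: "0 < c" "c < 1"
  shows "\<exists>N\<ge>N0. c * real N / ln (real N) \<le> real (card {p. N < p \<and> p \<le> 2 * N \<and> prime p})"
proof (rule ccontr)
  assume "\<not> ?thesis"
  then have few: "real (card {p. N < p \<and> p \<le> 2 * N \<and> prime p}) < c * real N / ln (real N)" if "N \<ge> N0" for N
    using that by (meson not_le)
  \<comment> \<open>The midpoint of \<open>c\<close> and \<open>1\<close> leaves room for the quotient \<open>ln (2 * m) / ln m\<close> and for the prime that is
    lost when \<open>n\<close> is odd.\<close>
  define d where "d = (1 + c) / 2"
  have d: "c < d" "d < 1" "0 \<le> d" using c by (auto simp: d_def field_simps)
  have "((\<lambda>m. ln (2 * real m + 1) * (c * real m / ln (real m) + 1) / real m) \<longlongrightarrow> c) sequentially"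
    by real_asymp
  then have "eventually (\<lambda>m. ln (2 * real m + 1) * (c * real m / ln (real m) + 1) / real m < d) sequentially"
    using d by (intro order_tendstoD(2))
  then obtain N1 where N1: "\<And>m. m \<ge> N1 \<Longrightarrow> ln (2 * real m + 1) * (c * real m / ln (real m) + 1) / real m < d"
    by (auto simp: eventually_at_top_linorder)
  define M where "M = max (max N0 N1) 1"
  have mono: "chebyshev_sum a \<le> chebyshev_sum b" if "a \<le> b" for a b
    unfolding chebyshev_sum_def using that by (intro sum_mono2) auto
  have "chebyshev_sum n \<le> d * real n + chebyshev_sum (2 * M)" for n
  proof (induction n rule: less_induct)
    case (less n)
    show ?case
    proof (cases "n \<le> 2 * M")
      case True
      then show ?thesis using mono[OF True] d by (simp add: add_increasing)
    next
      case False
      define m where "m = n div 2"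
      have m: "m \<ge> M" "m < n" "n \<le> 2 * m + 1" "2 * m \<le> n" "m \<ge> 1" using False by (auto simp: m_def M_def)
      define A where "A = {p. m < p \<and> p \<le> 2 * m \<and> prime p}"
      have "chebyshev_sum n \<le> (\<Sum>p\<in>{p. p \<in> {1..m} \<and> prime p} \<union> insert n A. ln (real p))"
        unfolding chebyshev_sum_def
      proof (rule sum_mono2)
        show "{p. p \<in> {1..n} \<and> prime p} \<subseteq> {p. p \<in> {1..m} \<and> prime p} \<union> insert n A"
          using m by (auto simp: A_def)
        show "0 \<le> ln (real b)" if "b \<in> {p \<in> {1..m}. prime p} \<union> insert n A - {p \<in> {1..n}. prime p}" for b
          using that by (auto simp: A_def ln_ge_zero_iff Suc_le_eq intro!: ln_ge_zero) (use m in auto)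
      qed (auto simp: A_def)
      also have "\<dots> = chebyshev_sum m + (\<Sum>p\<in>insert n A. ln (real p))"
        unfolding chebyshev_sum_def using m by (intro sum.union_disjoint) (auto simp: A_def)
      also have "(\<Sum>p\<in>insert n A. ln (real p)) \<le> real (card (insert n A)) * ln (2 * real m + 1)"
        by (rule sum_bounded_above) (use m in \<open>auto simp: A_def\<close>)
      also have "\<dots> \<le> (c * real m / ln (real m) + 1) * ln (2 * real m + 1)"
      proof (rule mult_right_mono)
        have "card (insert n A) \<le> card A + 1" by (simp add: card_insert_if A_def)
        then show "real (card (insert n A)) \<le> c * real m / ln (real m) + 1"
          using few[of m] m by (simp add: A_def M_def)
      qed simp
      also have "\<dots> \<le> d * real m"
        using N1[of m] m by (simp add: M_def divide_less_eq mult.commute)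
      finally have "chebyshev_sum n \<le> chebyshev_sum m + d * real m" by simp
      also have "\<dots> \<le> d * real m + chebyshev_sum (2 * M) + d * real m" using less[of m] m by simp
      also have "\<dots> \<le> d * real n + chebyshev_sum (2 * M)"
      proof -
        have "d * (2 * real m) \<le> d * real n" using m d by (intro mult_left_mono) auto
        then show ?thesis by simp
      qed
      finally show ?thesis .
    qed
  qed
  moreover have "chebyshev_sum (2 * M) \<ge> 0" unfolding chebyshev_sum_def by (intro sum_nonneg) auto
  ultimately show False using chebyshev_sum_not_small[of d "chebyshev_sum (2 * M)"] d by blast
qed

section \<open>Counting in residue classes\<close>

text \<open>For a finite set \<open>Q\<close> of primes: the product of \<open>Q\<close> divides the product of the \<open>n + h\<close>.\<close>

definition hits :: "nat set \<Rightarrow> nat set \<Rightarrow> nat \<Rightarrow> bool" where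
  "hits H Q n \<longleftrightarrow> (\<forall>p\<in>Q. \<exists>h\<in>H. p dvd n + h)"

lemma card_residue_class_below:
  fixes m r :: nat
  assumes "r < m"
  shows "card {n. n < x \<and> n mod m = r} = (x + (m - 1 - r)) div m"
proof (induction x)
  case 0
  then show ?case using assms by (simp add: div_less)
next
  case (Suc x)
  have iff: "x mod m = r \<longleftrightarrow> (Suc (x + (m - 1 - r))) mod m = 0"
  proof -
    have "(x + m) mod m = r mod m \<longleftrightarrow> m dvd (x + m - r)"
      using assms by (intro mod_eq_dvd_iff_nat) auto
    moreover have "x + m - r = Suc (x + (m - 1 - r))" using assms by simp
    ultimately show ?thesis using assms by (simp add: dvd_eq_mod_eq_0)
  qed
  have "{n. n < Suc x \<and> n mod m = r} = (if x mod m = r then insert x else id) {n. n < x \<and> n mod m = r}"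
    by (auto simp: less_Suc_eq)
  then have "card {n. n < Suc x \<and> n mod m = r} = card {n. n < x \<and> n mod m = r} + (if x mod m = r then 1 else 0)"
    by simp
  then show ?case using Suc iff by (simp add: div_Suc)
qed

lemma card_residue_class_interval:
  fixes m c :: nat
  assumes m: "m > 0"
  shows "\<bar>real (card {n. N < n \<and> n \<le> N + L \<and> [n = c] (mod m)}) - real L / real m\<bar> \<le> 2"
proof -
  define r where "r = c mod m"
  have r: "r < m" using m by (simp add: r_def)
  \<comment> \<open>An initial segment has an exact count, and the interval is a difference of two of them.\<close>
  define f where "f = (\<lambda>x. card {n. n < x \<and> n mod m = r})"
  have bounds: "real (f x) \<le> real x / real m + 1" "real x / real m - 1 \<le> real (f x)" for x
  proof -
    define a where "a = x + (m - 1 - r)"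
    have fa: "f x = a div m" unfolding f_def a_def by (rule card_residue_class_below[OF r])
    have "a = a div m * m + a mod m" by simp
    then have "real a = real (a div m) * real m + real (a mod m)" by (metis of_nat_add of_nat_mult)
    moreover have "real (a mod m) < real m" "real (a mod m) \<ge> 0" using m by auto
    moreover have "real x \<le> real a" "real a \<le> real x + real m" by (auto simp: a_def)
    ultimately have "real (f x) * real m \<le> real x + real m" "real x - real m \<le> real (f x) * real m"
      unfolding fa by linarith+
    then show "real (f x) \<le> real x / real m + 1" "real x / real m - 1 \<le> real (f x)"
      using m by (auto simp: field_simps)
  qed
  have "{n. n < N + L + 1 \<and> n mod m = r} =
      {n. n < N + 1 \<and> n mod m = r} \<union> {n. N < n \<and> n \<le> N + L \<and> [n = c] (mod m)}"
    by (auto simp: Cong.cong_def r_def)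
  then have "f (N + L + 1) = card ({n. n < N + 1 \<and> n mod m = r} \<union> {n. N < n \<and> n \<le> N + L \<and> [n = c] (mod m)})"
    unfolding f_def by simp
  also have "\<dots> = f (N + 1) + card {n. N < n \<and> n \<le> N + L \<and> [n = c] (mod m)}"
    unfolding f_def by (rule card_Un_disjoint) auto
  finally have "real (card {n. N < n \<and> n \<le> N + L \<and> [n = c] (mod m)}) = real (f (N + L + 1)) - real (f (N + 1))"
    by simp
  moreover have "real (N + L + 1) / real m - real (N + 1) / real m = real L / real m"
    by (simp add: diff_divide_distrib[symmetric])
  ultimately show ?thesis using bounds[of "N + L + 1"] bounds[of "N + 1"] by linarith
qed

text \<open>Chinese remainder theorem: the prime \<open>p\<close> prescribes the class of \<open>- a p\<close>.\<close>

lemma crt_residue: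
  fixes W :: nat
  assumes "finite Q" "\<And>p. p \<in> Q \<Longrightarrow> prime p \<and> coprime p W"
  shows "\<exists>c. \<forall>n. ([n = b] (mod W) \<and> (\<forall>p\<in>Q. p dvd n + a p)) \<longleftrightarrow> [n = c] (mod (W * \<Prod>Q))"
  using assms
proof (induction Q rule: finite_induct)
  case empty
  then show ?case by auto
next
  case (insert p Q)
  define M where "M = W * \<Prod>Q"
  obtain c where c: "\<And>n. ([n = b] (mod W) \<and> (\<forall>p\<in>Q. p dvd n + a p)) \<longleftrightarrow> [n = c] (mod M)"
    using insert unfolding M_def by auto
  have p: "prime p" "coprime p W" using insert by auto
  have "coprime p (\<Prod>Q)"
    using insert by (intro prod_coprime_right) (metis insertCI primes_coprime)
  then have cop: "coprime M p" unfolding M_def using p by (simp add: coprime_commute)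
  have pu: "p dvd a p * (p - 1) + a p"
  proof -
    have "a p * (p - 1) + a p = a p * p" using prime_gt_0_nat[OF p(1)] by (cases p) auto
    then show ?thesis by simp
  qed
  obtain x where x: "[x = c] (mod M)" "[x = a p * (p - 1)] (mod p)"
    using binary_chinese_remainder_nat[OF cop] by blast
  have "([n = b] (mod W) \<and> (\<forall>q\<in>insert p Q. q dvd n + a q)) \<longleftrightarrow> [n = x] (mod (W * \<Prod>(insert p Q)))" for n
  proof -
    have "p dvd n + a p \<longleftrightarrow> [n + a p = a p * (p - 1) + a p] (mod p)"
      using pu by (metis cong_0_iff cong_sym cong_trans)
    also have "\<dots> \<longleftrightarrow> [n = a p * (p - 1)] (mod p)" by (rule cong_add_rcancel_nat)
    also have "\<dots> \<longleftrightarrow> [n = x] (mod p)" using x(2) by (metis cong_sym cong_trans)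
    finally have 1: "p dvd n + a p \<longleftrightarrow> [n = x] (mod p)" .
    have 2: "[n = c] (mod M) \<longleftrightarrow> [n = x] (mod M)" using x(1) by (metis cong_sym cong_trans)
    have "[n = x] (mod M) \<and> [n = x] (mod p) \<longleftrightarrow> [n = x] (mod (M * p))"
      using cop by (meson coprime_cong_mult_nat cong_modulus_mult_nat dvd_triv_left dvd_triv_right cong_dvd_modulus_nat)
    moreover have "W * \<Prod>(insert p Q) = M * p" using insert by (simp add: M_def mult_ac)
    ultimately show ?thesis using 1 2 c[of n] by auto
  qed
  then show ?case by blast
qed

text \<open>Choosing for each prime the shift that it divides partitions the solutions. It also counts the
  residue classes, as \<open>card H ^ card Q\<close>, without any appeal to multiplicativity.\<close>

lemma sum_hits_eq:
  fixes f :: "nat \<Rightarrow> real"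
  assumes fin: "finite I" "finite Q" "finite H"
    and uniq: "\<And>p h h' n. p \<in> Q \<Longrightarrow> h \<in> H \<Longrightarrow> h' \<in> H \<Longrightarrow> p dvd n + h \<Longrightarrow> p dvd n + h' \<Longrightarrow> h = h'"
  shows "(\<Sum>n | n \<in> I \<and> hits H Q n. f n) =
    (\<Sum>a\<in>(\<Pi>\<^sub>E p\<in>Q. H). \<Sum>n | n \<in> I \<and> (\<forall>p\<in>Q. p dvd n + a p). f n)"
proof -
  define A where "A = (\<lambda>a. {n. n \<in> I \<and> (\<forall>p\<in>Q. p dvd n + a p)})"
  have "{n. n \<in> I \<and> hits H Q n} = (\<Union>a\<in>(\<Pi>\<^sub>E p\<in>Q. H). A a)"
  proof
    show "{n. n \<in> I \<and> hits H Q n} \<subseteq> (\<Union>a\<in>(\<Pi>\<^sub>E p\<in>Q. H). A a)"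
    proof
      fix n assume n: "n \<in> {n. n \<in> I \<and> hits H Q n}"
      then have "\<forall>p\<in>Q. \<exists>h. h \<in> H \<and> p dvd n + h" unfolding hits_def by blast
      then obtain a where a: "\<forall>p\<in>Q. a p \<in> H \<and> p dvd n + a p" 
        using bchoice[of Q "\<lambda>p h. h \<in> H \<and> p dvd n + h"] by auto
      then have "restrict a Q \<in> (\<Pi>\<^sub>E p\<in>Q. H)" "n \<in> A (restrict a Q)" using n by (auto simp: A_def)
      then show "n \<in> (\<Union>a\<in>(\<Pi>\<^sub>E p\<in>Q. H). A a)" by blast
    qed
    show "(\<Union>a\<in>(\<Pi>\<^sub>E p\<in>Q. H). A a) \<subseteq> {n. n \<in> I \<and> hits H Q n}"
      by (auto simp: A_def hits_def PiE_iff)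
  qed
  then have "(\<Sum>n | n \<in> I \<and> hits H Q n. f n) = sum f (\<Union>a\<in>(\<Pi>\<^sub>E p\<in>Q. H). A a)" by simp
  also have "\<dots> = (\<Sum>a\<in>(\<Pi>\<^sub>E p\<in>Q. H). sum f (A a))"
  proof (rule sum.UNION_disjoint)
    show "finite (\<Pi>\<^sub>E p\<in>Q. H)" using fin by (intro finite_PiE) auto
    show "\<forall>a\<in>(\<Pi>\<^sub>E p\<in>Q. H). finite (A a)" using fin by (auto simp: A_def)
    show "\<forall>a\<in>(\<Pi>\<^sub>E p\<in>Q. H). \<forall>a'\<in>(\<Pi>\<^sub>E p\<in>Q. H). a \<noteq> a' \<longrightarrow> A a \<inter> A a' = {}"
    proof (intro ballI impI)
      fix a a' assume a: "a \<in> (\<Pi>\<^sub>E p\<in>Q. H)" "a' \<in> (\<Pi>\<^sub>E p\<in>Q. H)" "a \<noteq> a'"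
      have "a = a'" if "n \<in> A a" "n \<in> A a'" for n
        using a(1,2)
      proof (rule PiE_ext)
        fix p assume p: "p \<in> Q"
        have "a p \<in> H" "a' p \<in> H" "p dvd n + a p" "p dvd n + a' p"
          using that a p by (auto simp: A_def PiE_iff)
        then show "a p = a' p" using uniq[OF p] by blast
      qed
      then show "A a \<inter> A a' = {}" using a(3) by blast
    qed
  qed
  finally show ?thesis by (simp only: A_def)
qed

lemma sieve_square_expand:
  fixes f lam :: "_ \<Rightarrow> real"
  assumes "finite I" "finite D"
  shows "(\<Sum>n\<in>I. f n * (\<Sum>S | S \<in> D \<and> hits H S n. lam S)\<^sup>2) =
    (\<Sum>S\<in>D. \<Sum>T\<in>D. lam S * lam T * (\<Sum>n | n \<in> I \<and> hits H (S \<union> T) n. f n))"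
proof -
  define i where "i = (\<lambda>S n. if hits H S n then 1 else (0 :: real))"
  have ii: "i S n * i T n = i (S \<union> T) n" for S T n by (auto simp: i_def hits_def)
  have "(\<Sum>n\<in>I. f n * (\<Sum>S | S \<in> D \<and> hits H S n. lam S)\<^sup>2) = (\<Sum>n\<in>I. f n * (\<Sum>S\<in>D. i S n * lam S)\<^sup>2)"
    unfolding sum.inter_filter[OF assms(2)]
    by (intro sum.cong refl arg_cong2[where f = "(*)"] arg_cong[where f = power2]) (simp add: i_def)
  also have "\<dots> = (\<Sum>n\<in>I. \<Sum>S\<in>D. \<Sum>T\<in>D. lam S * lam T * (i (S \<union> T) n * f n))"
  proof (intro sum.cong refl)
    fix n
    have "(\<Sum>S\<in>D. i S n * lam S)\<^sup>2 = (\<Sum>S\<in>D. \<Sum>T\<in>D. (i S n * lam S) * (i T n * lam T))"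
      by (simp only: power2_eq_square sum_product)
    then have "f n * (\<Sum>S\<in>D. i S n * lam S)\<^sup>2 = (\<Sum>S\<in>D. \<Sum>T\<in>D. f n * ((i S n * lam S) * (i T n * lam T)))"
      by (simp only: sum_distrib_left)
    also have "\<dots> = (\<Sum>S\<in>D. \<Sum>T\<in>D. lam S * lam T * (i (S \<union> T) n * f n))"
      by (intro sum.cong refl) (simp add: ii[symmetric] mult_ac)
    finally show "f n * (\<Sum>S\<in>D. i S n * lam S)\<^sup>2 = (\<Sum>S\<in>D. \<Sum>T\<in>D. lam S * lam T * (i (S \<union> T) n * f n))" .
  qed
  also have "\<dots> = (\<Sum>S\<in>D. \<Sum>n\<in>I. \<Sum>T\<in>D. lam S * lam T * (i (S \<union> T) n * f n))" by (rule sum.swap)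
  also have "\<dots> = (\<Sum>S\<in>D. \<Sum>T\<in>D. \<Sum>n\<in>I. lam S * lam T * (i (S \<union> T) n * f n))"
    by (intro sum.cong refl sum.swap)
  also have "\<dots> = (\<Sum>S\<in>D. \<Sum>T\<in>D. lam S * lam T * (\<Sum>n | n \<in> I \<and> hits H (S \<union> T) n. f n))"
    unfolding sum.inter_filter[OF assms(1)] sum_distrib_left
    by (intro sum.cong refl) (simp add: i_def)
  finally show ?thesis .
qed

text \<open>\<open>Q\<close> is the least common multiple of two sieving moduli and \<open>f\<close> is either constant or the indicator
  of primality of one \<open>n + h\<close>. The estimate in a single class is needed only for classes where the
  congruences themselves are solved, which for primes guarantees coprimality to the modulus.\<close>

lemma hits_count_approx:
  fixes f :: "nat \<Rightarrow> real" and W :: nat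
  assumes fin: "finite I" "finite Q" "finite H"
    and Q: "\<And>p. p \<in> Q \<Longrightarrow> prime p \<and> coprime p W"
    and uniq: "\<And>p h h' n. p \<in> Q \<Longrightarrow> h \<in> H \<Longrightarrow> h' \<in> H \<Longrightarrow> p dvd n + h \<Longrightarrow> p dvd n + h' \<Longrightarrow> h = h'"
    and approx: "\<And>c. [c = b] (mod W) \<Longrightarrow> hits H Q c \<Longrightarrow>
      \<bar>(\<Sum>n | n \<in> I \<and> [n = c] (mod (W * \<Prod>Q)). f n) - x\<bar> \<le> e"
  shows "\<bar>(\<Sum>n | n \<in> I \<and> [n = b] (mod W) \<and> hits H Q n. f n) - real (card H) ^ card Q * x\<bar> \<le>
    real (card H) ^ card Q * e"
proof -
  define P where "P = (\<Pi>\<^sub>E p\<in>Q. H)"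
  have cardP: "real (card P) = real (card H) ^ card Q" unfolding P_def using fin by (simp add: card_PiE)
  let ?I = "{n. n \<in> I \<and> [n = b] (mod W)}"
  let ?s = "\<lambda>a. \<Sum>n | n \<in> ?I \<and> (\<forall>p\<in>Q. p dvd n + a p). f n" and ?t = "\<Sum>n | n \<in> ?I \<and> hits H Q n. f n"
  have each: "\<bar>?s a - x\<bar> \<le> e"
    if a: "a \<in> P" for a
  proof -
    obtain c where c: "\<And>n. ([n = b] (mod W) \<and> (\<forall>p\<in>Q. p dvd n + a p)) \<longleftrightarrow> [n = c] (mod (W * \<Prod>Q))"
      using crt_residue[OF fin(2) Q] by blast
    have "[c = b] (mod W) \<and> (\<forall>p\<in>Q. p dvd c + a p)" using c[of c] by simp
    moreover from this have "hits H Q c" using a unfolding hits_def P_def by (auto simp: PiE_iff)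
    ultimately have "\<bar>(\<Sum>n | n \<in> I \<and> [n = c] (mod (W * \<Prod>Q)). f n) - x\<bar> \<le> e" using approx by blast
    moreover have "{n. n \<in> ?I \<and> (\<forall>p\<in>Q. p dvd n + a p)} =
        {n. n \<in> I \<and> [n = c] (mod (W * \<Prod>Q))}" using c by auto
    ultimately show ?thesis by simp
  qed
  have "?t =
      (\<Sum>a\<in>P. ?s a)"
    unfolding P_def using fin uniq by (intro sum_hits_eq) auto
  also have "\<dots> - real (card P) * x =
      (\<Sum>a\<in>P. ?s a - x)"
    by (simp add: sum_subtractf)
  finally have "\<bar>?t - real (card P) * x\<bar> =
      \<bar>\<Sum>a\<in>P. ?s a - x\<bar>"
    by (rule arg_cong)
  also have "\<dots> \<le> (\<Sum>a\<in>P. \<bar>?s a - x\<bar>)"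
    by (rule sum_abs)
  also have "\<dots> \<le> (\<Sum>a\<in>P. e)" by (rule sum_mono[OF each])
  finally have "\<bar>?t - real (card P) * x\<bar> \<le> (\<Sum>a\<in>P. e)" .
  then show ?thesis unfolding cardP[symmetric] by (simp add: conj_assoc)
qed

lemma EH_error_bound:
  assumes m: "m > 1" and c: "coprime c m"
  shows "\<bar>real (primes_pi_mod x m c) - real (primes_pi x) / real (totient m)\<bar> \<le> EH_error x m"
proof -
  have "c mod m \<in> totatives m"
  proof -
    have cop: "coprime (c mod m) m" using m c by simp
    have "c mod m \<noteq> 0"
    proof
      assume "c mod m = 0"
      with cop have "coprime 0 m" by (simp only:)
      then show False using m by simp
    qed
    then show ?thesis using cop m by (auto simp: in_totatives_iff intro: less_imp_le)
  qed
  moreover have "primes_pi_mod x m c = primes_pi_mod x m (c mod m)"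
    unfolding primes_pi_mod_def by (simp add: Cong.cong_def)
  ultimately show ?thesis unfolding EH_error_def by (simp add: Max_ge)
qed

lemma EH_error_nonneg: "m > 0 \<Longrightarrow> EH_error x m \<ge> 0"
proof -
  assume m: "m > 0"
  have "1 \<in> totatives m" using m by (simp add: in_totatives_iff)
  then have "\<bar>real (primes_pi_mod x m 1) - real (primes_pi x) / real (totient m)\<bar> \<le> EH_error x m"
    unfolding EH_error_def by (intro Max_ge) auto
  then show ?thesis by linarith
qed

lemma finite_primes_le: "finite {p::nat. prime p \<and> real p \<le> x \<and> P p}"
  by (rule finite_subset[of _ "{..nat \<lfloor>x\<rfloor>}"]) (auto simp: le_nat_floor)

lemma prime_count_residue_class:
  fixes m c h N :: nat
  assumes m: "m > 1" and c: "coprime (c + h) m"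
  shows "\<bar>(\<Sum>n | n \<in> {N<..2 * N} \<and> [n = c] (mod m). if prime (n + h) then 1 else 0) -
    (real (primes_pi (real (2 * N + h))) - real (primes_pi (real (N + h)))) / real (totient m)\<bar> \<le>
    EH_error (real (2 * N + h)) m + EH_error (real (N + h)) m"
proof -
  define A where "A = (\<lambda>x. {p. prime p \<and> real p \<le> real x \<and> [p = c + h] (mod m)})"
  define B where "B = {n. n \<in> {N<..2 * N} \<and> [n = c] (mod m) \<and> prime (n + h)}"
  have finA: "finite (A x)" for x unfolding A_def by (rule finite_primes_le)
  have "A (2 * N + h) = A (N + h) \<union> (\<lambda>n. n + h) ` B"
  proof (intro equalityI subsetI)
    fix p assume p: "p \<in> A (2 * N + h)"
    show "p \<in> A (N + h) \<union> (\<lambda>n. n + h) ` B"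
    proof (cases "p \<le> N + h")
      case True
      then show ?thesis using p by (auto simp: A_def)
    next
      case False
      then have "[p - h + h = c + h] (mod m)" using p by (auto simp: A_def)
      then have "[p - h = c] (mod m)" by (simp only: cong_add_rcancel_nat)
      then have "p - h \<in> B" "p = (p - h) + h" using p False by (auto simp: A_def B_def)
      then show ?thesis by blast
    qed
  next
    fix p assume "p \<in> A (N + h) \<union> (\<lambda>n. n + h) ` B"
    then show "p \<in> A (2 * N + h)" by (auto simp: A_def B_def cong_add_rcancel_nat)
  qed
  moreover have "A (N + h) \<inter> (\<lambda>n. n + h) ` B = {}" by (auto simp: A_def B_def)
  moreover have "finite B" by (rule finite_subset[of _ "{N<..2 * N}"]) (auto simp: B_def)
  ultimately have "card (A (2 * N + h)) = card (A (N + h)) + card B"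
    using finA by (simp add: card_Un_disjoint card_image)
  then have B: "real (card B) = real (primes_pi_mod (real (2 * N + h)) m (c + h)) - real (primes_pi_mod (real (N + h)) m (c + h))"
    unfolding primes_pi_mod_def A_def by simp
  have "(\<Sum>n | n \<in> {N<..2 * N} \<and> [n = c] (mod m). if prime (n + h) then 1 else 0) = real (card B)"
    by (subst sum.inter_filter[symmetric]) (auto simp: B_def intro!: arg_cong[where f = card])
  then show ?thesis unfolding B diff_divide_distrib
    using EH_error_bound[OF m c, of "real (2 * N + h)"] EH_error_bound[OF m c, of "real (N + h)"] by linarith
qed

section \<open>Sieve sums over a residue class\<close>

definition primes_prod :: "nat \<Rightarrow> nat" where
  "primes_prod w = \<Prod>{p. p \<in> {..w} \<and> prime p}"

lemma primes_prod_pos: "primes_prod w > 0"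
  unfolding primes_prod_def by (rule prod_primes_pos) auto

lemma prime_factors_primes_prod: "prime_factors (primes_prod w) = {p. p \<in> {..w} \<and> prime p}"
  unfolding primes_prod_def by (rule prime_factors_prod_primes) auto

lemma sieve_density_eq_totient: "sieve_density {..w} = real (totient (primes_prod w)) / real (primes_prod w)"
  using primes_prod_pos[of w] by (simp add: totient_formula2 prime_factors_primes_prod sieve_density_def)

lemma coprime_primes_prod: "prime p \<Longrightarrow> w < p \<Longrightarrow> coprime p (primes_prod w)"
  unfolding primes_prod_def by (intro prod_coprime_right primes_coprime) auto

lemma coprime_prod_primes_prod:
  assumes "\<And>p. p \<in> Q \<Longrightarrow> prime p \<and> w < p"
  shows "coprime (\<Prod>Q) (primes_prod w)"
  using assms by (intro prod_coprime_left coprime_primes_prod) auto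

lemma totient_prod_primes:
  assumes "finite Q" "\<And>p. p \<in> Q \<Longrightarrow> prime p"
  shows "totient (\<Prod>Q) = (\<Prod>p\<in>Q. p - 1)"
proof -
  have "totient (\<Prod>Q) = (\<Prod>p\<in>Q. totient p)"
    using assms by (intro totient_prod_coprime) (auto intro!: pairwiseI primes_coprime)
  also have "\<dots> = (\<Prod>p\<in>Q. p - 1)" using assms by (intro prod.cong refl totient_prime) auto
  finally show ?thesis .
qed

lemma totient_primes_prod_mult:
  assumes "finite Q" "\<And>p. p \<in> Q \<Longrightarrow> prime p \<and> w < p"
  shows "real (totient (primes_prod w * \<Prod>Q)) = real (totient (primes_prod w)) * (\<Prod>p\<in>Q. real p - 1)"
proof -
  have "coprime (primes_prod w) (\<Prod>Q)"
    using coprime_prod_primes_prod[OF assms(2)] by (simp add: coprime_commute)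
  then have "totient (primes_prod w * \<Prod>Q) = totient (primes_prod w) * (\<Prod>p\<in>Q. p - 1)"
    using assms by (simp add: totient_mult_coprime totient_prod_primes)
  moreover have "real (\<Prod>p\<in>Q. p - 1) = (\<Prod>p\<in>Q. real p - 1)"
    unfolding of_nat_prod
  proof (intro prod.cong refl)
    fix p assume "p \<in> Q"
    then have "p \<ge> 1" using assms(2) prime_ge_1_nat by blast
    then show "real (p - 1) = real p - 1" by simp
  qed
  ultimately show ?thesis by simp
qed

text \<open>A prime exceeding all differences of shifts divides at most one of the shifted numbers.\<close>

lemma prime_hits_unique:
  fixes p h h' n w :: nat
  assumes "w < p" "p dvd n + h" "p dvd n + h'" "h \<le> h' + w" "h' \<le> h + w"
  shows "h = h'"
proof (rule ccontr)
  assume ne: "h \<noteq> h'"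
  have "p dvd (n + h) - (n + h')" "p dvd (n + h') - (n + h)" 
    by (rule dvd_diff_nat; fact)+
  then have "p dvd h - h'" "p dvd h' - h" by auto
  then have "h - h' = 0 \<or> p \<le> h - h'" "h' - h = 0 \<or> p \<le> h' - h" by (auto dest: dvd_imp_le)
  then show False using ne assms(1,4,5) by auto
qed

lemma sieve_union_props:
  assumes "S \<in> rough w R" "T \<in> rough w R"
  shows "finite (S \<union> T)" "\<And>p. p \<in> S \<union> T \<Longrightarrow> prime p \<and> w < p"
  using sqfreeD(1-3)[OF assms(1)] sqfreeD(1-3)[OF assms(2)] by (auto simp: disjoint_iff not_le)

lemma sieve_sum_upper:
  fixes H :: "nat set" and w N b :: nat and lam :: "nat set \<Rightarrow> real" and R :: real
  assumes H: "finite H" "\<And>h h'. h \<in> H \<Longrightarrow> h' \<in> H \<Longrightarrow> h \<le> h' + w"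
  defines "D \<equiv> rough w R" and "W \<equiv> primes_prod w"
  shows "(\<Sum>n | n \<in> {N<..2 * N} \<and> [n = b] (mod W). (\<Sum>S | S \<in> D \<and> hits H S n. lam S)\<^sup>2) \<le>
    real N / real W * lcm_form D lam (\<lambda>p. real (card H) / real p) +
    lcm_error D lam (\<lambda>Q. real (card H) ^ card Q * 2)"
proof -
  define I where "I = {n. n \<in> {N<..2 * N} \<and> [n = b] (mod W)}"
  have W: "W > 0" unfolding W_def by (rule primes_prod_pos)
  have "(\<Sum>n\<in>I. (\<Sum>S | S \<in> D \<and> hits H S n. lam S)\<^sup>2) =
      (\<Sum>n\<in>I. 1 * (\<Sum>S | S \<in> D \<and> hits H S n. lam S)\<^sup>2)" by simp
  also have "\<dots> = (\<Sum>S\<in>D. \<Sum>T\<in>D. lam S * lam T * (\<Sum>n | n \<in> I \<and> hits H (S \<union> T) n. 1))"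
    by (rule sieve_square_expand) (auto simp: I_def D_def)
  also have "\<dots> \<le> (\<Sum>S\<in>D. \<Sum>T\<in>D. real N / real W * (lam S * lam T * (\<Prod>p\<in>S \<union> T. real (card H) / real p)) +
      \<bar>lam S * lam T\<bar> * (real (card H) ^ card (S \<union> T) * 2))"
  proof (intro sum_mono)
    fix S T assume S: "S \<in> D" and T: "T \<in> D"
    define Q where "Q = S \<union> T"
    let ?c = "lam S * lam T" and ?k = "real (card H)" and ?C = "\<lambda>c. {n. N < n \<and> n \<le> N + N \<and> [n = c] (mod (W * \<Prod>Q))}"
    have Q: "finite Q" "\<And>p. p \<in> Q \<Longrightarrow> prime p \<and> w < p"
      using sieve_union_props[OF S[unfolded D_def] T[unfolded D_def]] by (auto simp: Q_def)
    define cnt :: real where "cnt = (\<Sum>n | n \<in> I \<and> hits H Q n. 1)"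
    define x where "x = real N / real (W * \<Prod>Q)"
    have "\<bar>(\<Sum>n | n \<in> {N<..2 * N} \<and> [n = b] (mod W) \<and> hits H Q n. 1) - ?k ^ card Q * x\<bar> \<le>
      ?k ^ card Q * 2"
    proof (rule hits_count_approx)
      show "prime p \<and> coprime p W" if "p \<in> Q" for p
        using Q(2)[OF that] coprime_primes_prod by (simp add: W_def)
      show "h = h'" if "p \<in> Q" "h \<in> H" "h' \<in> H" "p dvd n + h" "p dvd n + h'" for p h h' n
        using prime_hits_unique[of w p n h h'] that Q(2) H(2) by blast
      fix c
      have "\<Prod>Q > 0" using Q by (intro prod_primes_pos) auto
      then have "W * \<Prod>Q > 0" using W by simp
      then have "\<bar>real (card (?C c)) - x\<bar> \<le> 2"
        unfolding x_def by (rule card_residue_class_interval)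
      moreover have "{n. n \<in> {N<..2 * N} \<and> [n = c] (mod (W * \<Prod>Q))} = ?C c"
        by auto
      ultimately show "\<bar>(\<Sum>n | n \<in> {N<..2 * N} \<and> [n = c] (mod (W * \<Prod>Q)). 1) - x\<bar> \<le> 2" by simp
    qed (use Q H in auto)
    then have "\<bar>cnt - ?k ^ card Q * x\<bar> \<le> ?k ^ card Q * 2"
      by (simp add: cnt_def I_def conj_assoc)
    then have "\<bar>?c\<bar> * \<bar>cnt - ?k ^ card Q * x\<bar> \<le> \<bar>?c\<bar> * (?k ^ card Q * 2)"
      by (intro mult_left_mono) auto
    then have "?c * (cnt - ?k ^ card Q * x) \<le> \<bar>?c\<bar> * (?k ^ card Q * 2)"
      unfolding abs_mult[symmetric] by linarith
    moreover have "?k ^ card Q * x = real N / real W * (\<Prod>p\<in>Q. ?k / real p)"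
      by (simp add: x_def prod_dividef prod_constant)
    moreover have "L * c \<le> A * (L * B) + err" if "L * (c - P) \<le> err" "P = A * B" for L c P A B err :: real
      using that by (simp add: algebra_simps)
    ultimately have "?c * cnt \<le> real N / real W * (?c * (\<Prod>p\<in>Q. ?k / real p)) +
        \<bar>?c\<bar> * (?k ^ card Q * 2)" by blast
    then show "?c * (\<Sum>n | n \<in> I \<and> hits H (S \<union> T) n. 1) \<le>
      real N / real W * (?c * (\<Prod>p\<in>S \<union> T. ?k / real p)) +
      \<bar>?c\<bar> * (?k ^ card (S \<union> T) * 2)"
      by (simp only: Q_def cnt_def)
  qed
  finally show ?thesis by (simp only: I_def sum.distrib sum_distrib_left)
qed

text \<open>The prime \<open>n + h\<close> exceeds \<open>R\<close>, so no sieving prime divides it: the shift \<open>h\<close> may be removed from the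
  tuple, and the remaining conditions leave \<open>n + h\<close> in residue classes coprime to the modulus. There the
  primes are counted with the error measured by the Elliott--Halberstam conjecture.\<close>

lemma sieve_sum_primes_lower:
  fixes H :: "nat set" and w N b h :: nat and lam :: "nat set \<Rightarrow> real" and R :: real
  assumes H: "finite H" "\<And>h h'. h \<in> H \<Longrightarrow> h' \<in> H \<Longrightarrow> h \<le> h' + w" and h: "h \<in> H"
    and b: "coprime (b + h) (primes_prod w)" and w: "w \<ge> 2" and R: "R \<le> real N"
  defines "D \<equiv> rough w R" and "W \<equiv> primes_prod w"
  defines "k \<equiv> card H - 1"
  defines "\<Delta> \<equiv> real (primes_pi (real (2 * N + h))) - real (primes_pi (real (N + h)))"
  shows "\<Delta> / real (totient W) * lcm_form D lam (\<lambda>p. real k / (real p - 1)) -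
    lcm_error D lam (\<lambda>Q. real k ^ card Q *
      (EH_error (real (2 * N + h)) (W * \<Prod>Q) + EH_error (real (N + h)) (W * \<Prod>Q))) \<le>
    (\<Sum>n | n \<in> {N<..2 * N} \<and> [n = b] (mod W).
      (if prime (n + h) then 1 else 0) * (\<Sum>S | S \<in> D \<and> hits H S n. lam S)\<^sup>2)"
proof -
  define I where "I = {n. n \<in> {N<..2 * N} \<and> [n = b] (mod W)}"
  define H' where "H' = H - {h}"
  define f :: "nat \<Rightarrow> real" where "f = (\<lambda>n. if prime (n + h) then 1 else 0)"
  define e where "e = (\<lambda>Q. EH_error (real (2 * N + h)) (W * \<Prod>Q) + EH_error (real (N + h)) (W * \<Prod>Q))"
  have W: "W > 0" unfolding W_def by (rule primes_prod_pos)
  have W2: "W \<ge> 2"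
  proof -
    have "2 \<in> prime_factors W" unfolding W_def prime_factors_primes_prod using w by auto
    then show ?thesis using W by (auto dest!: in_prime_factors_imp_dvd dvd_imp_le)
  qed
  have card': "card H' = k" using H h by (simp add: H'_def k_def)
  have "(\<Sum>S\<in>D. \<Sum>T\<in>D. \<Delta> / real (totient W) * (lam S * lam T * (\<Prod>p\<in>S \<union> T. real k / (real p - 1))) -
      \<bar>lam S * lam T\<bar> * (real k ^ card (S \<union> T) * e (S \<union> T))) \<le>
    (\<Sum>S\<in>D. \<Sum>T\<in>D. lam S * lam T * (\<Sum>n | n \<in> I \<and> hits H' (S \<union> T) n. f n))"
  proof (intro sum_mono)
    fix S T assume S: "S \<in> D" and T: "T \<in> D"
    define Q where "Q = S \<union> T"
    let ?c = "lam S * lam T" and ?k = "real k ^ card Q"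
    have Q: "finite Q" "\<And>p. p \<in> Q \<Longrightarrow> prime p \<and> w < p"
      using sieve_union_props[OF S[unfolded D_def] T[unfolded D_def]] by (auto simp: Q_def)
    define cnt :: real where "cnt = (\<Sum>n | n \<in> I \<and> hits H' Q n. f n)"
    define x where "x = \<Delta> / real (totient (W * \<Prod>Q))"
    have Qpos: "\<Prod>Q > 0" using Q by (intro prod_primes_pos) auto
    have "\<bar>(\<Sum>n | n \<in> {N<..2 * N} \<and> [n = b] (mod W) \<and> hits H' Q n. f n) - real (card H') ^ card Q * x\<bar> \<le>
      real (card H') ^ card Q * e Q"
    proof (rule hits_count_approx)
      show "prime p \<and> coprime p W" if "p \<in> Q" for p
        using Q(2)[OF that] coprime_primes_prod by (simp add: W_def)
      show "h = h'" if "p \<in> Q" "h \<in> H'" "h' \<in> H'" "p dvd n + h" "p dvd n + h'" for p h h' n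
        using prime_hits_unique[of w p n h h'] that Q(2) H(2) by (auto simp: H'_def)
      fix c assume c: "[c = b] (mod W)" "hits H' Q c"
      have "[c + h = b + h] (mod W)" using c(1) by (simp add: cong_add_rcancel_nat)
      then have c1: "coprime (c + h) W" using b unfolding W_def[symmetric] by (metis cong_imp_coprime cong_sym)
      have c2: "coprime (c + h) (\<Prod>Q)"
      proof (rule prod_coprime_right)
        fix p assume p: "p \<in> Q"
        obtain h' where h': "h' \<in> H'" "p dvd c + h'" using c(2) p unfolding hits_def by blast
        have "\<not> p dvd c + h"
        proof
          assume "p dvd c + h"
          then have "h = h'"
            using prime_hits_unique[of w p c h h'] h' Q(2)[OF p] H(2) h by (auto simp: H'_def)
          then show False using h' by (simp add: H'_def)
        qed
        then show "coprime (c + h) p" using Q(2)[OF p] by (simp add: prime_imp_coprime coprime_commute)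
      qed
      have "1 < W * \<Prod>Q"
      proof -
        have "W * 1 \<le> W * \<Prod>Q" using Qpos by (intro mult_left_mono) auto
        then show ?thesis using W2 by linarith
      qed
      then show "\<bar>(\<Sum>n | n \<in> {N<..2 * N} \<and> [n = c] (mod (W * \<Prod>Q)). f n) - x\<bar> \<le> e Q"
        unfolding f_def x_def \<Delta>_def e_def using c1 c2 by (intro prime_count_residue_class) auto
    qed (use Q H in \<open>auto simp: H'_def\<close>)
    then have "\<bar>cnt - ?k * x\<bar> \<le> ?k * e Q"
      by (simp add: cnt_def I_def conj_assoc card')
    then have "\<bar>?c\<bar> * \<bar>cnt - ?k * x\<bar> \<le> \<bar>?c\<bar> * (?k * e Q)"
      by (intro mult_left_mono) auto
    then have "- (?c * (cnt - ?k * x)) \<le> \<bar>?c\<bar> * (?k * e Q)"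
      unfolding abs_mult[symmetric] by linarith
    moreover have "?k * x = \<Delta> / real (totient W) * (\<Prod>p\<in>Q. real k / (real p - 1))"
    proof -
      have "real (totient (W * \<Prod>Q)) = real (totient W) * (\<Prod>p\<in>Q. real p - 1)"
        unfolding W_def using Q by (intro totient_primes_prod_mult) auto
      then show ?thesis by (simp add: x_def prod_dividef prod_constant)
    qed
    moreover have "A * (L * B) - err \<le> L * c" if "- (L * (c - P)) \<le> err" "P = A * B" for L c P A B err :: real
      using that by (simp add: algebra_simps)
    ultimately have "\<Delta> / real (totient W) * (?c * (\<Prod>p\<in>Q. real k / (real p - 1))) -
        \<bar>?c\<bar> * (?k * e Q) \<le> ?c * cnt" by blast
    then show "\<Delta> / real (totient W) * (?c * (\<Prod>p\<in>S \<union> T. real k / (real p - 1))) -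
        \<bar>?c\<bar> * (real k ^ card (S \<union> T) * e (S \<union> T)) \<le>
        ?c * (\<Sum>n | n \<in> I \<and> hits H' (S \<union> T) n. f n)"
      by (simp only: Q_def cnt_def)
  qed
  also have "\<dots> = (\<Sum>n\<in>I. f n * (\<Sum>S | S \<in> D \<and> hits H' S n. lam S)\<^sup>2)"
    by (rule sieve_square_expand[symmetric]) (auto simp: I_def D_def)
  also have "\<dots> = (\<Sum>n\<in>I. f n * (\<Sum>S | S \<in> D \<and> hits H S n. lam S)\<^sup>2)"
  proof (intro sum.cong refl)
    fix n assume n: "n \<in> I"
    show "f n * (\<Sum>S | S \<in> D \<and> hits H' S n. lam S)\<^sup>2 = f n * (\<Sum>S | S \<in> D \<and> hits H S n. lam S)\<^sup>2"
    proof (cases "prime (n + h)")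
      case True
      have "hits H S n \<longleftrightarrow> hits H' S n" if S: "S \<in> D" for S
      proof -
        have "\<not> p dvd n + h" if p: "p \<in> S" for p
        proof
          assume "p dvd n + h"
          moreover have "prime p" using sqfreeD(2) S p unfolding D_def by blast
          ultimately have "p = n + h" using True by (simp add: primes_dvd_imp_eq)
          moreover have "real p \<le> R" using S p unfolding D_def by (rule sqfree_le)
          ultimately show False using n R by (auto simp: I_def)
        qed
        then show ?thesis unfolding hits_def H'_def by blast
      qed
      then have "{S. S \<in> D \<and> hits H' S n} = {S. S \<in> D \<and> hits H S n}" by blast
      then show ?thesis by simp
    qed (simp add: f_def)
  qed
  finally show ?thesis unfolding I_def f_def e_def by (simp only: sum_subtractf sum_distrib_left)
qed

text \<open>Collecting the pairs by their least common multiple \<open>Q\<close>: there are at most \<open>4 ^ card Q\<close> of them,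
  and each carries two weights of size at most \<open>2 ^ card Q * L\<close>.\<close>

lemma pair_error_le:
  fixes lam e :: "nat set \<Rightarrow> real"
  assumes lam: "\<And>S. S \<in> sqfree E R \<Longrightarrow> \<bar>lam S\<bar> \<le> 2 ^ card S * L"
    and e: "\<And>Q. Q \<in> sqfree E (R * R) \<Longrightarrow> 0 \<le> e Q"
  shows "lcm_error (sqfree E R) lam (\<lambda>Q. real j ^ card Q * e Q) \<le>
    L\<^sup>2 * (\<Sum>Q\<in>sqfree E (R * R). real (16 * j) ^ card Q * e Q)"
proof -
  define D where "D = sqfree E R"
  define g where "g = (\<lambda>(S, T). \<bar>lam S * lam T\<bar> * (real j ^ card (S \<union> T) * e (S \<union> T)))"
  let ?P = "\<lambda>Q. {x. x \<in> D \<times> D \<and> (\<lambda>(S, T). S \<union> T) x = Q}"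
  have un: "S \<union> T \<in> sqfree E (R * R)" if "S \<in> D" "T \<in> D" for S T
  proof -
    note S = sqfreeD[OF that(1)[unfolded D_def]] and T = sqfreeD[OF that(2)[unfolded D_def]]
    have "\<Prod>(S \<union> T) * \<Prod>(S \<inter> T) = \<Prod>S * \<Prod>T" using S T by (intro prod.union_inter) auto
    moreover have "\<Prod>(S \<inter> T) > 0" using S by (intro prod_primes_pos) auto
    ultimately have "\<Prod>(S \<union> T) \<le> \<Prod>S * \<Prod>T"
      by (metis dvd_triv_left dvd_imp_le S(2) T(2) nat_0_less_mult_iff prod_primes_pos)
    then have "val (S \<union> T) \<le> val S * val T" by (metis of_nat_le_iff of_nat_mult)
    also have "\<dots> \<le> R * R" using S(4,5) T(4,5) by (intro mult_mono) auto
    finally show ?thesis using S T by (auto simp: sqfree_def)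
  qed
  have "lcm_error D lam (\<lambda>Q. real j ^ card Q * e Q) = sum g (D \<times> D)"
    by (simp add: sum.cartesian_product g_def)
  also have "\<dots> = (\<Sum>Q\<in>sqfree E (R * R). sum g (?P Q))"
    by (rule sum.group[symmetric]) (use un in \<open>auto simp: D_def\<close>)
  also have "\<dots> \<le> (\<Sum>Q\<in>sqfree E (R * R). L\<^sup>2 * (real (16 * j) ^ card Q * e Q))"
  proof (rule sum_mono)
    fix Q assume Q: "Q \<in> sqfree E (R * R)"
    note QD = sqfreeD[OF Q]
    define B where "B = L\<^sup>2 * (4 ^ card Q * (real j ^ card Q * e Q))"
    have "sum g (?P Q) \<le>
        real (card (?P Q)) * B"
    proof (rule sum_bounded_above)
      fix x assume "x \<in> (?P Q)"
      then obtain S T where x: "x = (S, T)" "S \<in> D" "T \<in> D" "S \<union> T = Q" by auto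
      have L: "\<bar>lam S\<bar> \<le> 2 ^ card S * L" "\<bar>lam T\<bar> \<le> 2 ^ card T * L" using lam x by (auto simp: D_def)
      have "0 \<le> 2 ^ card S * L" using L(1) by (rule order.trans[OF abs_ge_zero])
      then have L0: "0 \<le> L"
        using mult_pos_neg[of "2 ^ card S" L] by (meson not_le zero_less_numeral zero_less_power)
      have "card S \<le> card Q" "card T \<le> card Q" using x QD(1) by (auto intro!: card_mono)
      then have "(2::real) ^ card S * L \<le> 2 ^ card Q * L" "(2::real) ^ card T * L \<le> 2 ^ card Q * L"
        using L0 by (auto intro!: mult_right_mono power_increasing)
      then have "\<bar>lam S * lam T\<bar> \<le> (2 ^ card Q * L) * (2 ^ card Q * L)"
        unfolding abs_mult using L by (intro mult_mono) auto
      also have "\<dots> = L\<^sup>2 * 4 ^ card Q"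
        by (simp add: power2_eq_square mult_ac flip: power_mult_distrib)
      finally have "\<bar>lam S * lam T\<bar> \<le> L\<^sup>2 * 4 ^ card Q" .
      then have "\<bar>lam S * lam T\<bar> * (real j ^ card Q * e Q) \<le> L\<^sup>2 * 4 ^ card Q * (real j ^ card Q * e Q)"
        using e[OF Q] by (intro mult_right_mono) auto
      then show "g x \<le> B" by (simp add: g_def x B_def mult.assoc)
    qed
    also have "\<dots> \<le> 4 ^ card Q * B"
    proof (rule mult_right_mono)
      have "(?P Q) \<subseteq> Pow Q \<times> Pow Q" by auto
      then have "card (?P Q) \<le> card (Pow Q \<times> Pow Q)"
        using QD(1) by (intro card_mono) auto
      also have "\<dots> = 4 ^ card Q" using QD(1) by (simp add: card_cartesian_product card_Pow flip: power_mult_distrib)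
      finally have "real (card (?P Q)) \<le> real (4 ^ card Q)"
        by (rule of_nat_mono)
      then show "real (card (?P Q)) \<le> 4 ^ card Q"
        by simp
      show "0 \<le> B" unfolding B_def using e[OF Q] by simp
    qed
    also have "\<dots> = L\<^sup>2 * (real (16 * j) ^ card Q * e Q)"
    proof -
      have "real (16 * j) ^ card Q = 4 ^ card Q * 4 ^ card Q * real j ^ card Q"
      proof -
        have "real (16 * j) = 4 * 4 * real j" by simp
        then show ?thesis by (simp only: power_mult_distrib)
      qed
      then show ?thesis by (simp add: B_def del: of_nat_mult)
    qed
    finally show "sum g (?P Q) \<le> L\<^sup>2 * (real (16 * j) ^ card Q * e Q)" .
  qed
  finally show ?thesis by (simp only: D_def sum_distrib_left)
qed

lemma sum_power_card_recip_le:
  "\<exists>C\<ge>0. \<forall>z\<ge>exp 1. (\<Sum>Q\<in>rough w z. real j ^ card Q / val Q) \<le> C * ln z ^ j"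
proof -
  obtain C where C: "C \<ge> 0" "\<And>z. z \<ge> 1 \<Longrightarrow>
      (\<Sum>S\<in>rough w z. \<Prod>p\<in>S. 1 / real p) \<le> sieve_density {..w} * ln z + C"
    using one_dim_recip_upper by blast
  define K where "K = sieve_density {..w} + C"
  have "(\<Sum>Q\<in>rough w z. real j ^ card Q / val Q) \<le> K ^ j * ln z ^ j" if z: "z \<ge> exp 1" for z
  proof -
    have z1: "z \<ge> 1" using z exp_ge_add_one_self[of 1] by linarith
    have lnz: "ln z \<ge> 1" using z z1 by (metis exp_gt_zero ln_exp ln_mono order_less_le_trans)
    have "(\<Sum>Q\<in>rough w z. real j ^ card Q / val Q) =
        (\<Sum>Q\<in>rough w z. \<Prod>p\<in>Q. real j * (1 / real p))"
      by (simp add: prod_dividef prod_constant)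
    also have "\<dots> \<le> (\<Sum>Q\<in>rough w z. \<Prod>p\<in>Q. 1 / real p) ^ j"
      by (rule sum_prod_mult_le_power) (use z1 in auto)
    also have "\<dots> \<le> (K * ln z) ^ j"
    proof (rule power_mono)
      have "(\<Sum>Q\<in>rough w z. \<Prod>p\<in>Q. 1 / real p) \<le> sieve_density {..w} * ln z + C"
        using C(2) z1 by blast
      also have "C \<le> C * ln z" using C(1) lnz by (simp add: mult_le_cancel_left1)
      finally show "(\<Sum>Q\<in>rough w z. \<Prod>p\<in>Q. 1 / real p) \<le> K * ln z"
        by (simp add: K_def algebra_simps)
    qed (intro sum_nonneg prod_nonneg; simp)
    finally show ?thesis by (simp add: power_mult_distrib)
  qed
  moreover have "K ^ j \<ge> 0" using C(1) sieve_density_pos[of "{..w}"] by (simp add: K_def)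
  ultimately show ?thesis by blast
qed

text \<open>A residue class modulo \<open>m \<le> x\<close> contains at most \<open>x / m + 2\<close> integers up to \<open>x\<close>, and
  \<open>\<phi>(Q) \<ge> Q / 2 ^ card Q\<close>.\<close>

lemma EH_error_trivial:
  assumes Q: "finite Q" "\<And>p. p \<in> Q \<Longrightarrow> prime p \<and> w < p" and x: "real (primes_prod w * \<Prod>Q) \<le> x"
  shows "EH_error x (primes_prod w * \<Prod>Q) \<le> 5 * x * (2 ^ card Q / val Q)"
proof -
  define m where "m = primes_prod w * \<Prod>Q"
  have Qpos: "\<Prod>Q > 0" using Q by (intro prod_primes_pos) auto
  then have m: "m > 0" unfolding m_def using primes_prod_pos[of w] by simp
  have x0: "x \<ge> 1" using x m unfolding m_def[symmetric] by linarith
  define X where "X = nat \<lfloor>x\<rfloor>"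
  have X: "real X \<le> x" using x0 by (simp add: X_def)
  have mQ: "val Q \<le> real m" unfolding m_def using primes_prod_pos[of w] by (simp add: mult_le_cancel_right1 Suc_le_eq del: of_nat_prod)
  have P: "val Q > 0" using Qpos by (simp del: of_nat_prod)
  have pow2: "1 \<le> (2::real) ^ card Q" by simp
  let ?q = "2 ^ card Q / val Q" and ?C = "\<lambda>a. {n. 0 < n \<and> n \<le> 0 + X \<and> [n = a] (mod m)}"
  let ?d = "\<lambda>a. \<bar>real (primes_pi_mod x m a) - real (primes_pi x) / real (totient m)\<bar>"
  have bound1: "real (primes_pi_mod x m a) \<le> 3 * x * ?q" for a
  proof -
    have "{p. prime p \<and> real p \<le> x \<and> [p = a] (mod m)} \<subseteq> ?C a"
      by (auto simp: X_def le_nat_floor prime_gt_0_nat)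
    then have "primes_pi_mod x m a \<le> card (?C a)"
      unfolding primes_pi_mod_def by (intro card_mono) auto
    moreover have "\<bar>real (card (?C a)) - real X / real m\<bar> \<le> 2"
      using m by (rule card_residue_class_interval)
    ultimately have "real (primes_pi_mod x m a) \<le> real X / real m + 2" by linarith
    also have "real X / real m \<le> x / real m" using X by (intro divide_right_mono) auto
    also have "x / real m + 2 \<le> 3 * (x / real m)" using x m unfolding m_def[symmetric] by (simp add: field_simps)
    also have "\<dots> \<le> 3 * (x / val Q)" using mQ P x0 m by (intro mult_left_mono divide_left_mono mult_pos_pos) auto
    also have "\<dots> \<le> 3 * (x / val Q) * 2 ^ card Q" 
      using mult_left_mono[OF pow2, of "3 * (x / val Q)"] x0 P by (simp del: of_nat_prod)
    finally show ?thesis by (simp add: mult_ac)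
  qed
  have bound2: "real (primes_pi x) / real (totient m) \<le> x * ?q"
  proof -
    have "{p. prime p \<and> real p \<le> x} \<subseteq> {1..X}"
      by (auto simp: X_def le_nat_floor Suc_le_eq prime_gt_0_nat)
    then have "primes_pi x \<le> card {1..X}" unfolding primes_pi_def by (intro card_mono) auto
    then have 1: "real (primes_pi x) \<le> x" using X by simp
    have "real (totient m) = real (totient (primes_prod w)) * (\<Prod>p\<in>Q. real p - 1)"
      unfolding m_def using Q by (rule totient_primes_prod_mult)
    also have "\<dots> \<ge> 1 * (\<Prod>p\<in>Q. real p / 2)"
    proof (intro mult_mono prod_mono conjI)
      show "1 \<le> real (totient (primes_prod w))"
        using primes_prod_pos[of w] totient_gt_0_iff[of "primes_prod w"] by linarith
      fix p assume "p \<in> Q"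
      then have "p \<ge> 2" using Q(2) prime_ge_2_nat by blast
      then show "real p / 2 \<le> real p - 1" by simp
    qed (auto intro!: prod_nonneg)
    finally have "val Q / 2 ^ card Q \<le> real (totient m)" by (simp add: prod_dividef)
    then have "real (primes_pi x) / real (totient m) \<le> x / (val Q / 2 ^ card Q)"
      using 1 P x0 by (intro frac_le) auto
    then show ?thesis by simp
  qed
  have "EH_error x m \<le> 3 * x * ?q + x * ?q"
    unfolding EH_error_def
  proof (subst Max_le_iff)
    show "?d ` totatives m \<noteq> {}"
      using m by (auto simp: in_totatives_iff intro: exI[of _ 1])
    show "\<forall>a\<in>?d ` totatives m.
       a \<le> 3 * x * ?q + x * ?q"
    proof clarify
      fix a
      have abs_diff_le: "\<bar>r - s\<bar> \<le> B + C" if "0 \<le> r" "0 \<le> s" "r \<le> B" "s \<le> C" for r s B C :: real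
        using that by linarith
      have "0 \<le> real (primes_pi_mod x m a)" "0 \<le> real (primes_pi x) / real (totient m)" by auto
      then show "?d a \<le>
          3 * x * ?q + x * ?q"
        using bound1[of a] bound2 abs_diff_le[of "real (primes_pi_mod x m a)" "real (primes_pi x) / real (totient m)"]
        by blast
    qed
  qed simp
  also have "\<dots> \<le> 5 * x * ?q" using x0 P by (simp add: divide_right_mono)
  finally show ?thesis by (simp only: m_def)
qed

text \<open>The factor \<open>c ^ card Q\<close> is not bounded, but \<open>u \<le> t + u^2 / t\<close> separates it from the error: the
  first term is controlled by the conjecture, the second by the trivial bound, which costs only a power
  of \<open>ln x\<close>. Taking \<open>t\<close> a power of \<open>ln x\<close> larger than this loss, and the exponent of the conjecture larger
  still, leaves any prescribed saving.\<close>

lemma EH_weighted_sum: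
  assumes EH: "Elliott_Halberstam" and \<theta>: "0 < \<theta>" "\<theta> < 1"
  shows "\<exists>K x0. 0 \<le> K \<and> (\<forall>x\<ge>x0. \<forall>z\<ge>exp 1. real (primes_prod w) * z \<le> x powr \<theta> \<longrightarrow>
    (\<Sum>Q\<in>rough w z. real c ^ card Q * EH_error x (primes_prod w * \<Prod>Q)) \<le> K * x / ln x ^ F)"
proof -
  define W where "W = primes_prod w"
  \<comment> \<open>The trivial bound contributes \<open>2 ^ card Q\<close>, the square of the weight \<open>(c^2) ^ card Q\<close>.\<close>
  define j where "j = 2 * c\<^sup>2"
  \<comment> \<open>\<open>j + F\<close> for the size of \<open>t\<close>, \<open>F\<close> for the saving; the final \<open>1\<close> makes \<open>A\<close> positive.\<close>
  define A where "A = real (j + F + F) + 1"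
  obtain C where C: "C \<ge> 0" "\<And>z. z \<ge> exp 1 \<Longrightarrow>
      (\<Sum>Q\<in>rough w z. real j ^ card Q / val Q) \<le> C * ln z ^ j"
    using sum_power_card_recip_le by blast
  have "(\<lambda>x. \<Sum>q | 1 \<le> q \<and> real q \<le> x powr \<theta>. EH_error x q) \<in> O[at_top](\<lambda>x. x / ln x powr A)"
    using EH \<theta> unfolding Elliott_Halberstam_def by (auto simp: A_def)
  then obtain K where K: "K > 0"
    "eventually (\<lambda>x. norm (\<Sum>q | 1 \<le> q \<and> real q \<le> x powr \<theta>. EH_error x q) \<le> K * norm (x / ln x powr A)) at_top"
    by (elim landau_o.bigE)
  then obtain x1 where x1: "\<And>x. x \<ge> x1 \<Longrightarrow>
      norm (\<Sum>q | 1 \<le> q \<and> real q \<le> x powr \<theta>. EH_error x q) \<le> K * norm (x / ln x powr A)"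
    by (auto simp: eventually_at_top_linorder)
  define x0 where "x0 = max x1 (exp 1)"
  have "(\<Sum>Q\<in>rough w z. real c ^ card Q * EH_error x (W * \<Prod>Q)) \<le> (K + 5 * C) * x / ln x ^ F"
    if x: "x \<ge> x0" and z: "z \<ge> exp 1" "real W * z \<le> x powr \<theta>" for x z
  proof -
    have W: "W \<ge> 1" using primes_prod_pos[of w] by (simp add: W_def)
    have xe: "x \<ge> exp 1" using x by (simp add: x0_def)
    have xp: "x > 1" using xe exp_ge_add_one_self[of 1] by linarith
    have lnx: "ln x \<ge> 1" using xe xp by (metis exp_gt_zero ln_exp ln_mono order_less_le_trans)
    have xth: "x powr \<theta> \<le> x" using xp \<theta> powr_mono[of \<theta> 1 x] by simp
    have z0: "z > 0" using z(1) exp_gt_zero[of 1] by linarith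
    have "z * 1 \<le> z * real W" using W z0 by (intro mult_left_mono) auto
    then have zx: "z \<le> x" using z(2) xth by (simp add: mult.commute)
    have lnz: "0 \<le> ln z" "ln z \<le> ln x" using z(1) zx xp exp_ge_add_one_self[of 1] by auto
    define t where "t = ln x ^ (j + F)"
    have t: "t > 0" unfolding t_def using lnx by (intro zero_less_power) linarith
    let ?F = "rough w z" and ?e = "\<lambda>Q. EH_error x (W * \<Prod>Q)"
    let ?r = "\<lambda>Q. real j ^ card Q / val Q" and ?s = "\<lambda>Q. 5 * x * (2 ^ card Q / val Q)"
    let ?EH = "\<Sum>q | 1 \<le> q \<and> real q \<le> x powr \<theta>. EH_error x q"
    have m_le: "real (W * \<Prod>Q) \<le> x powr \<theta>" "W * \<Prod>Q \<ge> 1" if "Q \<in> ?F" for Q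
    proof -
      note QD = sqfreeD[OF that]
      have "real (W * \<Prod>Q) = real W * val Q" by (rule of_nat_mult)
      also have "\<dots> \<le> real W * z" using QD(4) by (intro mult_left_mono) auto
      finally show "real (W * \<Prod>Q) \<le> x powr \<theta>" using z(2) by linarith
      have "\<Prod>Q \<ge> 1" using QD(5) by linarith
      then show "W * \<Prod>Q \<ge> 1" using W by (metis mult_le_mono nat_mult_1)
    qed
    have e0: "0 \<le> ?e Q" if "Q \<in> ?F" for Q
      using m_le(2)[OF that] by (intro EH_error_nonneg) linarith
    have "(\<Sum>Q\<in>?F. real c ^ card Q * ?e Q) \<le>
        (\<Sum>Q\<in>?F. t * ?e Q + 5 * x / t * ?r Q)"
    proof (rule sum_mono)
      fix Q assume Q: "Q \<in> ?F"
      note QD = sqfreeD[OF Q]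
      define u where "u = real c ^ card Q"
      have "0 \<le> (u - t / 2)\<^sup>2" by simp
      then have "u * t \<le> u\<^sup>2 + t\<^sup>2 / 4" by (simp add: power2_eq_square algebra_simps)
      also have "\<dots> \<le> u\<^sup>2 + t\<^sup>2" by simp
      finally have "u \<le> (u\<^sup>2 + t\<^sup>2) / t" using t by (simp add: field_simps)
      then have "u \<le> t + u\<^sup>2 / t" using t by (simp add: power2_eq_square add_divide_distrib)
      then have "u * ?e Q \<le> (t + u\<^sup>2 / t) * ?e Q"
        using e0[OF Q] by (intro mult_right_mono)
      also have "\<dots> = t * ?e Q + u\<^sup>2 / t * ?e Q" by (rule distrib_right)
      also have "u\<^sup>2 / t * ?e Q \<le> u\<^sup>2 / t * ?s Q"
      proof (rule mult_left_mono)
        have "real (W * \<Prod>Q) \<le> x" using m_le(1)[OF Q] xth by linarith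
        then show "?e Q \<le> ?s Q"
          unfolding W_def using QD(1,2,3)
          by (intro EH_error_trivial) (auto simp: disjoint_iff not_le)
      qed (use t in simp)
      also have "u\<^sup>2 / t * ?s Q = 5 * x / t * ?r Q"
      proof -
        have "real j ^ card Q = 2 ^ card Q * u\<^sup>2"
          by (simp add: j_def u_def power_mult_distrib mult.commute flip: power_mult)
        then show ?thesis by simp
      qed
      finally show "real c ^ card Q * ?e Q \<le>
          t * ?e Q + 5 * x / t * ?r Q" by (simp add: u_def)
    qed
    also have "\<dots> = t * (\<Sum>Q\<in>?F. ?e Q) +
        5 * x / t * (\<Sum>Q\<in>?F. ?r Q)"
      by (simp only: sum.distrib sum_distrib_left)
    also have "\<dots> \<le> t * (K * (x / ln x powr A)) + 5 * x / t * (C * ln x ^ j)"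
    proof (intro add_mono mult_left_mono)
      have inj: "inj_on (\<lambda>Q. W * \<Prod>Q) (?F)"
      proof (rule inj_onI)
        fix Q Q' assume Q: "Q \<in> ?F" "Q' \<in> ?F" "W * \<Prod>Q = W * \<Prod>Q'"
        then have "\<Prod>Q = \<Prod>Q'" using W by simp
        then show "Q = Q'" using inj_on_prod_primes sqfreeD(1,2)[OF Q(1)] sqfreeD(1,2)[OF Q(2)]
          by (auto dest!: inj_onD)
      qed
      have fin: "finite {q. 1 \<le> q \<and> real q \<le> x powr \<theta>}"
        by (rule finite_subset[of _ "{..nat \<lfloor>x powr \<theta>\<rfloor>}"]) (auto simp: le_nat_floor)
      have "(\<Sum>Q\<in>?F. ?e Q) =
          (\<Sum>q\<in>(\<lambda>Q. W * \<Prod>Q) ` ?F. EH_error x q)"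
        by (simp only: sum.reindex[OF inj] o_def)
      also have "\<dots> \<le> ?EH"
        using fin by (rule sum_mono2) (use m_le in \<open>auto intro!: EH_error_nonneg simp del: of_nat_mult of_nat_prod\<close>)
      also have "\<dots> \<le> norm ?EH" by simp
      also have "\<dots> \<le> K * norm (x / ln x powr A)" using x by (intro x1) (simp add: x0_def)
      also have "norm (x / ln x powr A) = x / ln x powr A" using xp by simp
      finally show "(\<Sum>Q\<in>?F. ?e Q) \<le> K * (x / ln x powr A)" .
      have "(\<Sum>Q\<in>?F. ?r Q) \<le> C * ln z ^ j" using C(2) z(1) by blast
      also have "\<dots> \<le> C * ln x ^ j" using lnz C(1) by (intro mult_left_mono power_mono) auto
      finally show "(\<Sum>Q\<in>?F. ?r Q) \<le> C * ln x ^ j" .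
      show "0 \<le> 5 * x / t" using xp t by simp
    qed (use t in simp)
    also have "5 * x / t * (C * ln x ^ j) = 5 * C * x / ln x ^ F"
      unfolding t_def using lnx by (simp add: power_add)
    also have "t * (K * (x / ln x powr A)) \<le> K * x / ln x ^ F"
    proof -
      have "ln x ^ (j + F + F) = ln x powr real (j + F + F)" using lnx by (subst powr_realpow) auto
      also have "\<dots> \<le> ln x powr A" using lnx by (intro powr_mono) (auto simp: A_def)
      finally have "t * ln x ^ F \<le> ln x powr A" by (simp add: t_def power_add)
      then have "K * x * (t * ln x ^ F) \<le> K * x * ln x powr A" using K(1) xp by (intro mult_left_mono) auto
      moreover have "ln x ^ F > 0" "ln x powr A > 0" using lnx by auto
      ultimately show ?thesis by (simp add: field_simps)
    qed
    finally show ?thesis by (simp add: distrib_right add_divide_distrib)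
  qed
  moreover have "0 \<le> K + 5 * C" using K(1) C(1) by simp
  ultimately show ?thesis unfolding W_def by blast
qed

section \<open>Six shifts\<close>

lemma ln_ge_one: "exp 1 \<le> z \<Longrightarrow> 1 \<le> ln (z::real)"
  by (metis exp_gt_zero ln_exp ln_mono order_less_le_trans)

text \<open>The sum of lower powers is absorbed into the highest of them, as \<open>ln z \<ge> 1\<close>.\<close>

lemma moment_upper:
  fixes k w :: nat
  assumes w: "1 \<le> w" "2 * k \<le> w"
  shows "\<exists>D\<ge>0. \<forall>z\<ge>exp 1. log_moment {..w} (\<lambda>p. real k * (1 / (real p - real k))) m z \<le>
    (exp (2 * real k / real w) * sieve_density {..w}) ^ k * (fact m / fact (m + k)) * ln z ^ (m + k) +
    D * ln z ^ (m + k - 1)"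
proof -
  define c where "c = exp (2 * real k / real w) * sieve_density {..w}"
  define g where "g = (\<lambda>p. 1 / (real p - real k))"
  have c: "c \<ge> 0" unfolding c_def using sieve_density_pos[of "{..w}"] by simp
  obtain C where C: "C \<ge> 0" "\<And>z. z \<ge> 1 \<Longrightarrow> (\<Sum>S\<in>rough w z. \<Prod>p\<in>S. g p) \<le> c * ln z + C"
    using one_dim_upper[of w "real k"] w unfolding g_def c_def by auto
  have g0: "0 \<le> g p" if "p \<notin> {..w}" for p using that w by (auto simp: g_def)
  obtain D where D: "D \<ge> 0" "\<And>z. z \<ge> 1 \<Longrightarrow> log_moment {..w} (\<lambda>p. real k * g p) m z \<le>
      c ^ k * (fact m / fact (m + k)) * ln z ^ (m + k) + D * (\<Sum>i<m + k. ln z ^ i)"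
    using log_moment_dim_upper[of "{..w}" g c C k m] g0 c C by (auto simp: log_moment_def)
  have "log_moment {..w} (\<lambda>p. real k * g p) m z \<le>
      c ^ k * (fact m / fact (m + k)) * ln z ^ (m + k) + D * real (m + k) * ln z ^ (m + k - 1)"
    if z: "z \<ge> exp 1" for z
  proof -
    have z1: "z \<ge> 1" using z exp_ge_add_one_self[of 1] by linarith
    have l: "ln z \<ge> 1" using z by (rule ln_ge_one)
    have "(\<Sum>i<m + k. ln z ^ i) \<le> real (card {..<m + k}) * ln z ^ (m + k - 1)"
      using l by (intro sum_bounded_above power_increasing) auto
    then have "D * (\<Sum>i<m + k. ln z ^ i) \<le> D * (real (m + k) * ln z ^ (m + k - 1))"
      using D(1) by (intro mult_left_mono) auto
    then show ?thesis using D(2)[OF z1] by (simp only: mult.assoc)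
  qed
  moreover have "D * real (m + k) \<ge> 0" using D(1) by simp
  ultimately show ?thesis unfolding c_def g_def by blast
qed

text \<open>The slope 12 nearly maximizes the ratio of the two forms among linear functions: with
  \<open>y = ln R + s * X\<close> it is governed by a quotient of quadratic polynomials in \<open>s\<close>. If \<open>R\<close> could be
  the square root of \<open>N\<close>, every \<open>s > 4\<close> would suffice.\<close>

definition gpy_weight :: "nat \<Rightarrow> real \<Rightarrow> nat set \<Rightarrow> real" where
  "gpy_weight w R = selberg_weight (rough w R) 6 (linear_weight (ln R) 12 R)"

definition form_all :: "nat \<Rightarrow> real \<Rightarrow> real" where
  "form_all w R = lcm_form (rough w R) (gpy_weight w R) (\<lambda>p. 6 / real p)"

definition form_primes :: "nat \<Rightarrow> real \<Rightarrow> real" where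
  "form_primes w R = lcm_form (rough w R) (gpy_weight w R) (\<lambda>p. 5 / (real p - 1))"

text \<open>\<open>67 / 5040 = 1 / 720 + 2 * 12 / 5040 + 144 * 2 / 40320\<close>, the moments of order 0, 1 and 2 in
  dimension six.\<close>

lemma gpy_form_all_upper:
  assumes w: "12 \<le> w"
  shows "\<exists>D\<ge>0. \<forall>R\<ge>exp 1. form_all w R \<le>
    exp (72 / real w) * sieve_density {..w} ^ 6 * (67 / 5040) * ln R ^ 8 + D * ln R ^ 7"
proof -
  define k :: nat where "k = 6"
  define c where "c = exp (2 * real k / real w) * sieve_density {..w}"
  define M where "M = log_moment {..w} (\<lambda>p. real k * (1 / (real p - real k)))"
  have w': "1 \<le> w" "2 * k \<le> w" using w by (auto simp: k_def)
  obtain D0 where D0: "D0 \<ge> 0" "\<And>z. z \<ge> exp 1 \<Longrightarrow> M 0 z \<le> c ^ k * (fact 0 / fact (0 + k)) * ln z ^ (0 + k) + D0 * ln z ^ (0 + k - 1)"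
    using moment_upper[OF w', of 0] unfolding M_def c_def by blast
  obtain D1 where D1: "D1 \<ge> 0" "\<And>z. z \<ge> exp 1 \<Longrightarrow> M 1 z \<le> c ^ k * (fact 1 / fact (1 + k)) * ln z ^ (1 + k) + D1 * ln z ^ (1 + k - 1)"
    using moment_upper[OF w', of 1] unfolding M_def c_def by blast
  obtain D2 where D2: "D2 \<ge> 0" "\<And>z. z \<ge> exp 1 \<Longrightarrow> M 2 z \<le> c ^ k * (fact 2 / fact (2 + k)) * ln z ^ (2 + k) + D2 * ln z ^ (2 + k - 1)"
    using moment_upper[OF w', of 2] unfolding M_def c_def by blast
  have ck: "c ^ k = exp (72 / real w) * sieve_density {..w} ^ 6"
    unfolding c_def k_def power_mult_distrib by (simp flip: exp_of_nat_mult)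
  have "form_all w R \<le>
    exp (72 / real w) * sieve_density {..w} ^ 6 * (67 / 5040) * ln R ^ 8 + (D0 + 24 * D1 + 144 * D2) * ln R ^ 7"
    if R: "R \<ge> exp 1" for R
  proof -
    define l where "l = ln R"
    have l: "l \<ge> 1" unfolding l_def using R by (rule ln_ge_one)
    have "lcm_form (rough w R) (gpy_weight w R) (\<lambda>p. real k / real p) =
        (\<Sum>U\<in>rough w R. (\<Prod>p\<in>U. real k * (1 / (real p - real k))) * (linear_weight (ln R) 12 R U)\<^sup>2)"
      unfolding gpy_weight_def k_def[symmetric] by (rule form_all_eq) (use w' in \<open>auto simp: k_def\<close>)
    also have "\<dots> = l\<^sup>2 * M 0 R + 24 * l * M 1 R + 144 * M 2 R"
      unfolding M_def log_moment_def sum_distrib_left sum.distrib[symmetric] linear_weight_def l_def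
      by (intro sum.cong refl) (simp add: power2_eq_square algebra_simps del: of_nat_prod)
    also have "\<dots> \<le> l\<^sup>2 * (c ^ k * (1 / 720) * l ^ 6 + D0 * l ^ 5) + 24 * l * (c ^ k * (1 / 5040) * l ^ 7 + D1 * l ^ 6) +
        144 * (c ^ k * (2 / 40320) * l ^ 8 + D2 * l ^ 7)"
      using D0(2)[OF R] D1(2)[OF R] D2(2)[OF R] l unfolding l_def
      by (intro add_mono mult_left_mono) (auto simp: k_def fact_numeral)
    also have "\<dots> = c ^ k * (67 / 5040) * l ^ 8 + (D0 + 24 * D1 + 144 * D2) * l ^ 7"
      by (simp add: algebra_simps eval_nat_numeral)
    finally show ?thesis unfolding ck l_def by (simp add: k_def form_all_def)
  qed
  moreover have "D0 + 24 * D1 + 144 * D2 \<ge> 0" using D0(1) D1(1) D2(1) by simp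
  ultimately show ?thesis by blast
qed

text \<open>\<open>23 / 5040 = 2 / 5040 + 12 * 6 / 40320 + 36 * 24 / 362880\<close>, the moments of order 2, 3 and 4 of
  \<open>(ln R * X + 6 * X^2)^2\<close> in dimension five. The density enters to the seventh power, as two
  more factors come from the square of the inner sums.\<close>

lemma gpy_form_primes_lower:
  assumes w: "12 \<le> w" and R: "exp 1 \<le> R"
  shows "sieve_density {..w} ^ 7 * (23 / 5040) * ln R ^ 9 \<le> form_primes w R"
proof -
  define k :: nat where "k = 6"
  define \<alpha> where "\<alpha> = sieve_density {..w}"
  define l where "l = ln R"
  define M where "M = log_moment {..w} (\<lambda>p. real (k - 1) * (1 / (real p - real k)))"
  have \<alpha>: "\<alpha> > 0" unfolding \<alpha>_def by (rule sieve_density_pos)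
  have l: "l \<ge> 1" unfolding l_def using R by (rule ln_ge_one)
  have R1: "1 \<le> R" using R exp_ge_add_one_self[of 1] by linarith
  have M: "\<alpha> ^ (k - 1) * (fact m / fact (m + (k - 1))) * l ^ (m + (k - 1)) \<le> M m R" for m
    using log_moment_dim_lower[of k w 0 "k - 1" R m] w R1 unfolding M_def \<alpha>_def l_def by (simp add: k_def)
  have "\<alpha> ^ 7 * (23 / 5040) * l ^ 9 =
      \<alpha>\<^sup>2 * (l\<^sup>2 * (\<alpha> ^ 5 * (2 / 5040) * l ^ 7) + 12 * l * (\<alpha> ^ 5 * (6 / 40320) * l ^ 8) + 36 * (\<alpha> ^ 5 * (24 / 362880) * l ^ 9))"
    by (simp add: algebra_simps eval_nat_numeral)
  also have "\<dots> \<le> \<alpha>\<^sup>2 * (l\<^sup>2 * M 2 R + 12 * l * M 3 R + 36 * M 4 R)"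
    using M[of 2] M[of 3] M[of 4] l by (intro mult_left_mono add_mono) (auto simp: k_def fact_numeral)
  also have "l\<^sup>2 * M 2 R + 12 * l * M 3 R + 36 * M 4 R =
      (\<Sum>U\<in>rough w R. (\<Prod>p\<in>U. real (k - 1) * (1 / (real p - real k))) *
        (ln R * ln (R / val U) + 12 * (ln (R / val U))\<^sup>2 / 2)\<^sup>2)"
    unfolding M_def log_moment_def sum_distrib_left sum.distrib[symmetric] l_def
    by (intro sum.cong refl) (simp add: power2_eq_square eval_nat_numeral algebra_simps del: of_nat_prod)
  also have "\<alpha>\<^sup>2 * \<dots> \<le> lcm_form (rough w R) (gpy_weight w R) (\<lambda>p. real (k - 1) / (real p - 1))"
    unfolding gpy_weight_def k_def[symmetric] \<alpha>_def
    by (rule form_primes_lower) (use w l in \<open>auto simp: k_def l_def\<close>)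
  finally show ?thesis by (simp add: k_def \<alpha>_def l_def form_primes_def)
qed

lemma gpy_weight_bound:
  assumes w: "12 \<le> w"
  shows "\<exists>K\<ge>0. \<forall>R\<ge>exp 1. \<forall>S\<in>rough w R. \<bar>gpy_weight w R S\<bar> \<le> 2 ^ card S * (K * ln R ^ 7)"
proof -
  define k :: nat where "k = 6"
  define M where "M = log_moment {..w} (\<lambda>p. real k * (1 / (real p - real k)))"
  define c where "c = (exp (2 * real k / real w) * sieve_density {..w}) ^ k * (fact 0 / fact (0 + k))"
  have w': "1 \<le> w" "2 * k \<le> w" using w by (auto simp: k_def)
  have c: "c \<ge> 0" unfolding c_def using sieve_density_pos[of "{..w}"] by simp
  obtain D where D: "D \<ge> 0" "\<And>z. z \<ge> exp 1 \<Longrightarrow> M 0 z \<le> c * ln z ^ (0 + k) + D * ln z ^ (0 + k - 1)"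
    using moment_upper[OF w', of 0] unfolding M_def c_def by blast
  have "\<bar>gpy_weight w R S\<bar> \<le> 2 ^ card S * (13 * (c + D) * ln R ^ 7)"
    if R: "R \<ge> exp 1" and S: "S \<in> rough w R" for R S
  proof -
    have l: "ln R \<ge> 1" using R by (rule ln_ge_one)
    have "\<bar>gpy_weight w R S\<bar> \<le> 2 ^ card S * ((ln R + 12 * ln R) * M 0 R)"
      unfolding gpy_weight_def M_def k_def[symmetric] by (rule selberg_weight_bound) (use w' l S in \<open>auto simp: k_def\<close>)
    also have "\<dots> \<le> 2 ^ card S * ((ln R + 12 * ln R) * ((c + D) * ln R ^ 6))"
    proof (intro mult_left_mono)
      have "M 0 R \<le> c * ln R ^ 6 + D * ln R ^ 5" using D(2)[OF R] by (simp add: k_def)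
      also have "D * ln R ^ 5 \<le> D * ln R ^ 6" using D(1) l by (intro mult_left_mono power_increasing) auto
      finally show "M 0 R \<le> (c + D) * ln R ^ 6" by (simp add: distrib_right)
    qed (use l in auto)
    also have "(ln R + 12 * ln R) * ((c + D) * ln R ^ 6) = 13 * (c + D) * ln R ^ 7"
      by (simp add: algebra_simps eval_nat_numeral)
    finally show ?thesis .
  qed
  moreover have "13 * (c + D) \<ge> 0" using c D(1) by simp
  ultimately show ?thesis by blast
qed

text \<open>An admissible tuple cannot contain seven numbers whose differences are free of the prime 7, so six
  is the largest possible size here.\<close>

definition sextuple :: "nat set" where
  "sextuple = {0, 4, 6, 10, 12, 16}"

lemma card_sextuple: "finite sextuple" "card sextuple = 6"
  by (auto simp: sextuple_def)

lemma sextuple_le: "h \<in> sextuple \<Longrightarrow> h \<le> 16"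
  by (auto simp: sextuple_def)

lemma sextuple_diff_smooth:
  assumes "h \<in> sextuple" "h' \<in> sextuple" "h \<noteq> h'"
  shows "int h - int h' \<in> smooth_ints 5"
proof -
  have aux: "x \<in> smooth_ints 5" if "\<bar>x\<bar> \<in> {2, 4, 6, 8, 10, 12, 16}" for x :: int
    unfolding smooth_ints_def
  proof (intro CollectI allI impI)
    fix p :: nat assume p: "prime p" "int p dvd x"
    have "nat \<bar>x\<bar> dvd 2 ^ 4 * 3 * 5"
      using that by (auto simp: dvd_def intro: exI[of _ "240 div nat \<bar>x\<bar>"])
    moreover have "p dvd nat \<bar>x\<bar>" using p(2) by (metis int_dvd_int_iff abs_ge_zero dvd_abs_iff int_nat_eq nat_0_le)
    ultimately have "p dvd 2 ^ 4 * 3 * 5" using dvd_trans by blast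
    then have "p dvd 2 \<or> p dvd 3 \<or> p dvd 5"
      using p(1) by (metis prime_dvd_mult_iff prime_dvd_power)
    then have "p \<le> 5" by (auto dest!: dvd_imp_le)
    then show "real p \<le> 5" by simp
  qed
  show ?thesis by (rule aux) (use assms in \<open>auto simp: sextuple_def\<close>)
qed

text \<open>The tuples \<open>97 + h\<close> and \<open>7 + h\<close> consist of primes, which lie above 23 and at most at 23,
  respectively. So one of them avoids the multiples of any given prime.\<close>

lemma sextuple_admissible: "\<exists>b. \<forall>h\<in>sextuple. coprime (b + h) (primes_prod w)"
proof -
  define P where "P = {p. p \<in> {..w} \<and> prime p}"
  define u :: "nat \<Rightarrow> nat" where "u = (\<lambda>p. if p \<le> 23 then 97 else 7)"
  have "\<exists>x. \<forall>p\<in>P. [x = u p] (mod p)"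
    by (rule chinese_remainder_nat) (auto simp: P_def intro!: primes_coprime)
  then obtain b where b: "\<And>p. p \<in> P \<Longrightarrow> [b = u p] (mod p)" by blast
  have "coprime (b + h) (primes_prod w)" if h: "h \<in> sextuple" for h
    unfolding primes_prod_def P_def[symmetric]
  proof (rule prod_coprime_right)
    fix p assume p: "p \<in> P"
    have "prime p" using p by (simp add: P_def)
    have "coprime (u p + h) p"
    proof (cases "p \<le> 23")
      case True
      have "prime (97 + h)" "97 + h > 23" using h by (auto simp: sextuple_def)
      then show ?thesis using True \<open>prime p\<close> by (simp add: u_def primes_coprime)
    next
      case False
      have "prime (7 + h)" "7 + h \<le> 23" using h by (auto simp: sextuple_def)
      then show ?thesis using False \<open>prime p\<close> by (simp add: u_def primes_coprime)
    qed
    moreover have "[u p + h = b + h] (mod p)" using b[OF p] by (simp add: cong_add_rcancel_nat cong_sym)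
    ultimately show "coprime (b + h) p" by (metis cong_imp_coprime)
  qed
  then show ?thesis by blast
qed

lemma primes_shifted_dyadic:
  "real (card {p. N < p \<and> p \<le> 2 * N \<and> prime p}) - real h \<le>
    real (primes_pi (real (2 * N + h))) - real (primes_pi (real (N + h)))"
proof -
  define A where "A = (\<lambda>x. {p::nat. prime p \<and> real p \<le> real x})"
  have finA: "finite (A x)" for x
    by (rule finite_subset[of _ "{..x}"]) (auto simp: A_def)
  let ?P = "{p. N < p \<and> p \<le> 2 * N \<and> prime p}"
  have "A (N + h) \<union> ?P \<subseteq> A (2 * N + h)" by (auto simp: A_def)
  then have "card (A (N + h) \<union> ?P) \<le> card (A (2 * N + h))"
    by (rule card_mono[OF finA])
  moreover have "?P \<subseteq> (?P - A (N + h)) \<union> {N<..N + h}"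
    by (auto simp: A_def)
  then have "card ?P \<le> card ((?P - A (N + h)) \<union> {N<..N + h})"
    by (intro card_mono) auto
  moreover have "card ((?P - A (N + h)) \<union> {N<..N + h}) \<le>
      card (?P - A (N + h)) + h"
    using card_Un_le[of "?P - A (N + h)" "{N<..N + h}"] by simp
  moreover have "card (A (N + h) \<union> ?P) =
      card (A (N + h)) + card (?P - A (N + h))"
    by (subst card_Un_disjoint[symmetric]) (auto simp: finA)
  ultimately have "card (A (N + h)) + card ?P \<le> card (A (2 * N + h)) + h" by linarith
  then have "real (card (A (N + h))) + real (card ?P) \<le> real (card (A (2 * N + h))) + real h"
    by (metis of_nat_add of_nat_mono)
  moreover have pi: "primes_pi (real x) = card (A x)" for x by (simp add: primes_pi_def A_def)
  ultimately show ?thesis unfolding pi by linarith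
qed

text \<open>The exponent is slightly less than 1/2: then \<open>W * R^2\<close>, the largest modulus, stays below
  \<open>N powr 0.995\<close> for large \<open>N\<close>, and \<open>6 * 0.495 * 23 > 67\<close> still holds.\<close>

definition sieve_level :: "nat \<Rightarrow> real" where
  "sieve_level N = real N powr 0.495"

definition error_all :: "nat \<Rightarrow> nat \<Rightarrow> real" where
  "error_all w N = (let R = sieve_level N in lcm_error (rough w R) (gpy_weight w R) (\<lambda>Q. 6 ^ card Q * 2))"

definition error_primes :: "nat \<Rightarrow> nat \<Rightarrow> nat \<Rightarrow> real" where
  "error_primes w N h = (let R = sieve_level N in lcm_error (rough w R) (gpy_weight w R)
     (\<lambda>Q. 5 ^ card Q * (EH_error (real (2 * N + h)) (primes_prod w * \<Prod>Q) +
       EH_error (real (N + h)) (primes_prod w * \<Prod>Q))))"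

lemma gpy_error_all:
  assumes w: "12 \<le> w"
  shows "eventually (\<lambda>N. error_all w N \<le> real N) sequentially"
proof -
  obtain K where K: "K \<ge> 0" "\<And>R S. R \<ge> exp 1 \<Longrightarrow> S \<in> rough w R \<Longrightarrow> \<bar>gpy_weight w R S\<bar> \<le> 2 ^ card S * (K * ln R ^ 7)"
    using gpy_weight_bound[OF w] by blast
  define j :: nat where "j = 96"
  obtain C where C: "C \<ge> 0" "\<And>z. z \<ge> exp 1 \<Longrightarrow> (\<Sum>Q\<in>rough w z. real j ^ card Q / val Q) \<le> C * ln z ^ j"
    using sum_power_card_recip_le by blast
  have ev1: "eventually (\<lambda>N. sieve_level N \<ge> exp 1) sequentially"
    unfolding sieve_level_def by real_asymp
  obtain a d :: real where ad: "a = 0.495" "d = 0.99" by blast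
  define c where "c = K\<^sup>2 * 2 * C * a ^ 14 * d ^ 96"
  have collect: "(K * (a * y) ^ 7)\<^sup>2 * (2 * r * (C * (d * y) ^ j)) = c * (y ^ 110 * r)" for y r
  proof -
    have "y ^ 110 = (y ^ 7)\<^sup>2 * y ^ 96" by (simp flip: power_mult power_add)
    moreover have "a ^ 14 = (a ^ 7)\<^sup>2" by (simp flip: power_mult)
    ultimately show ?thesis by (simp add: c_def j_def power_mult_distrib mult_ac)
  qed
  have "((\<lambda>N. ln (real N) ^ 110 * (real N powr 0.99) / real N) \<longlongrightarrow> 0) sequentially"
    by real_asymp
  then have "((\<lambda>N. c * (ln (real N) ^ 110 * (real N powr 0.99) / real N)) \<longlongrightarrow> 0) sequentially"
    by (rule tendsto_mult_right_zero)
  then have ev2: "eventually (\<lambda>N. c * (ln (real N) ^ 110 * (real N powr 0.99) / real N) < 1) sequentially"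
    by (rule order_tendstoD) simp
  have ev3: "eventually (\<lambda>N. N > (0::nat)) sequentially" by (rule eventually_gt_at_top)
  show ?thesis using ev1 ev2 ev3
  proof eventually_elim
    case (elim N)
    define R where "R = sieve_level N"
    have R: "R \<ge> exp 1" using elim by (simp add: R_def)
    have RR: "R * R = real N powr 0.99" unfolding R_def sieve_level_def by (simp flip: powr_add)
    have lnR: "ln R = 0.495 * ln (real N)" unfolding R_def sieve_level_def using elim by (simp add: ln_powr)
    have lnRR: "ln (R * R) = 0.99 * ln (real N)" unfolding RR using elim by (simp add: ln_powr)
    have R1: "R \<ge> 1" using R exp_ge_add_one_self[of 1] by linarith
    have RRe: "R * R \<ge> exp 1" using R R1 mult_mono[of 1 R "exp 1" R] by simp
    have "lcm_error (rough w R) (gpy_weight w R) (\<lambda>Q. real 6 ^ card Q * 2) \<le>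
        (K * ln R ^ 7)\<^sup>2 * (\<Sum>Q\<in>rough w (R * R). real (16 * 6) ^ card Q * 2)"
      by (rule pair_error_le) (use K R in auto)
    also have "\<dots> \<le> (K * ln R ^ 7)\<^sup>2 * (\<Sum>Q\<in>rough w (R * R). 2 * (R * R) * (real j ^ card Q / val Q))"
    proof (intro mult_left_mono sum_mono)
      fix Q assume "Q \<in> rough w (R * R)"
      note Q = sqfreeD[OF this]
      have "real j ^ card Q * val Q \<le> real j ^ card Q * (R * R)" using Q by (intro mult_left_mono) auto
      then have "real j ^ card Q \<le> (R * R) * (real j ^ card Q / val Q)"
        using Q(5) by (simp add: field_simps del: of_nat_prod)
      then show "real (16 * 6) ^ card Q * 2 \<le> 2 * (R * R) * (real j ^ card Q / val Q)"
        by (simp add: j_def del: of_nat_prod)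
    qed simp
    also have "\<dots> = (K * ln R ^ 7)\<^sup>2 * (2 * (R * R) * (\<Sum>Q\<in>rough w (R * R). real j ^ card Q / val Q))"
      by (simp only: sum_distrib_left)
    also have "\<dots> \<le> (K * ln R ^ 7)\<^sup>2 * (2 * (R * R) * (C * ln (R * R) ^ j))"
      using RRe R1 by (intro mult_left_mono C(2)) auto
    also have "\<dots> = c * (ln (real N) ^ 110 * real N powr 0.99)"
      unfolding lnRR unfolding lnR RR ad[symmetric] by (rule collect)
    also have "\<dots> \<le> real N" using elim by (simp add: divide_less_eq)
    finally show ?case by (simp add: error_all_def Let_def R_def sieve_level_def)
  qed
qed

lemma gpy_error_primes:
  assumes EH: "Elliott_Halberstam" and w: "12 \<le> w"
  shows "\<exists>B. eventually (\<lambda>N. \<forall>h\<le>16. error_primes w N h \<le> B * real N) sequentially"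
proof -
  define W where "W = primes_prod w"
  obtain K where K: "K \<ge> 0" "\<And>R S. R \<ge> exp 1 \<Longrightarrow> S \<in> rough w R \<Longrightarrow> \<bar>gpy_weight w R S\<bar> \<le> 2 ^ card S * (K * ln R ^ 7)"
    using gpy_weight_bound[OF w] by blast
  \<comment> \<open>\<open>80 = 16 * 5\<close>; the saving \<open>ln x ^ 14\<close> cancels the square of the bound \<open>K * ln R ^ 7\<close> for the weights.\<close>
  have "\<exists>K x0. 0 \<le> K \<and> (\<forall>x\<ge>x0. \<forall>z\<ge>exp 1. real W * z \<le> x powr 0.995 \<longrightarrow>
      (\<Sum>Q\<in>rough w z. real 80 ^ card Q * EH_error x (W * \<Prod>Q)) \<le> K * x / ln x ^ 14)"
    unfolding W_def by (rule EH_weighted_sum[OF EH]) auto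
  then obtain K' x0 where K': "0 \<le> K'" "\<And>x z. x \<ge> x0 \<Longrightarrow> z \<ge> exp 1 \<Longrightarrow> real W * z \<le> x powr 0.995 \<Longrightarrow>
      (\<Sum>Q\<in>rough w z. real 80 ^ card Q * EH_error x (W * \<Prod>Q)) \<le> K' * x / ln x ^ 14"
    by blast
  have ev1: "eventually (\<lambda>N. sieve_level N \<ge> exp 1) sequentially"
    unfolding sieve_level_def by real_asymp
  have ev2: "eventually (\<lambda>N. real N \<ge> max x0 16) sequentially" by real_asymp
  have ev3: "eventually (\<lambda>N. real W * real N powr 0.99 \<le> real N powr 0.995) sequentially" by real_asymp
  have "eventually (\<lambda>N. \<forall>h\<le>16. error_primes w N h \<le> (K\<^sup>2 * K' * 5) * real N) sequentially"
    using ev1 ev2 ev3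
  proof eventually_elim
    case (elim N)
    define R where "R = sieve_level N"
    have N: "real N \<ge> 16" using elim by simp
    have R: "R \<ge> exp 1" using elim by (simp add: R_def)
    have RR: "R * R = real N powr 0.99" unfolding R_def sieve_level_def by (simp flip: powr_add)
    have lnR: "ln R = 0.495 * ln (real N)" unfolding R_def sieve_level_def using N by (simp add: ln_powr)
    have R1: "R \<ge> 1" using R exp_ge_add_one_self[of 1] by linarith
    have RRe: "R * R \<ge> exp 1" using R R1 mult_mono[of 1 R "exp 1" R] by simp
    have l: "ln (real N) > 0" using N by simp
    have W: "W > 0" unfolding W_def by (rule primes_prod_pos)
    have Eh: "(\<Sum>Q\<in>rough w (R * R). real 80 ^ card Q * EH_error x (W * \<Prod>Q)) \<le> K' * x / ln (real N) ^ 14"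
      if x: "real N \<le> x" for x
    proof -
      have "real N powr 0.995 \<le> x powr 0.995" using x by (intro powr_mono2) auto
      then have "(\<Sum>Q\<in>rough w (R * R). real 80 ^ card Q * EH_error x (W * \<Prod>Q)) \<le> K' * x / ln x ^ 14"
        using elim x RRe by (intro K'(2)) (auto simp: RR)
      also have "\<dots> \<le> K' * x / ln (real N) ^ 14"
      proof (intro divide_left_mono power_mono)
        show "ln (real N) \<le> ln x" using x N by simp
        then show "0 < ln x ^ 14 * ln (real N) ^ 14" using l by simp
      qed (use K' x l in auto)
      finally show ?thesis .
    qed
    show ?case
    proof (intro allI impI)
      fix h :: nat assume h: "h \<le> 16"
      define e where "e = (\<lambda>Q. EH_error (real (2 * N + h)) (W * \<Prod>Q) + EH_error (real (N + h)) (W * \<Prod>Q))"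
      have "lcm_error (rough w R) (gpy_weight w R) (\<lambda>Q. real 5 ^ card Q * e Q) \<le>
          (K * ln R ^ 7)\<^sup>2 * (\<Sum>Q\<in>rough w (R * R). real (16 * 5) ^ card Q * e Q)"
      proof (rule pair_error_le)
        fix Q assume "Q \<in> rough w (R * R)"
        note Q = sqfreeD[OF this]
        have "\<Prod>Q > 0" using Q(2) by (intro prod_primes_pos) auto
        then have "W * \<Prod>Q > 0" using W by simp
        then show "0 \<le> e Q" unfolding e_def by (intro add_nonneg_nonneg EH_error_nonneg)
      qed (use K R in auto)
      also have "(\<Sum>Q\<in>rough w (R * R). real (16 * 5) ^ card Q * e Q) =
          (\<Sum>Q\<in>rough w (R * R). real 80 ^ card Q * EH_error (real (2 * N + h)) (W * \<Prod>Q)) +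
          (\<Sum>Q\<in>rough w (R * R). real 80 ^ card Q * EH_error (real (N + h)) (W * \<Prod>Q))"
        unfolding e_def sum.distrib[symmetric] by (intro sum.cong) (auto simp: distrib_left)
      also have "\<dots> \<le> K' * real (2 * N + h) / ln (real N) ^ 14 + K' * real (N + h) / ln (real N) ^ 14"
        by (intro add_mono Eh) auto
      also have "\<dots> = K' / ln (real N) ^ 14 * (real (2 * N + h) + real (N + h))"
      proof -
        have "c * x / y + c * z / y = c / y * (x + z)" for c x y z :: real
          by (simp add: add_divide_distrib distrib_left)
        then show ?thesis .
      qed
      also have "\<dots> \<le> K' / ln (real N) ^ 14 * (5 * real N)"
        using h N K'(1) l by (intro mult_left_mono) auto
      also have "(K * ln R ^ 7)\<^sup>2 * (K' / ln (real N) ^ 14 * (5 * real N)) \<le> (K\<^sup>2 * K' * 5) * real N"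
      proof -
        have "(K * ln R ^ 7)\<^sup>2 = K\<^sup>2 * (0.495 ^ 14 * ln (real N) ^ 14)"
        proof -
          have "(K * (c * y) ^ 7)\<^sup>2 = K\<^sup>2 * (c ^ 14 * y ^ 14)" for c y :: real
            by (simp add: power_mult_distrib flip: power_mult)
          then show ?thesis unfolding lnR .
        qed
        then have "(K * ln R ^ 7)\<^sup>2 * (K' / ln (real N) ^ 14 * (5 * real N)) = 0.495 ^ 14 * ((K\<^sup>2 * K' * 5) * real N)"
          using l by simp
        also have "\<dots> \<le> 1 * ((K\<^sup>2 * K' * 5) * real N)" using K K' by (intro mult_right_mono power_le_one) auto
        finally show ?thesis by simp
      qed
      finally show "error_primes w N h \<le> (K\<^sup>2 * K' * 5) * real N"
        by (simp add: error_primes_def Let_def R_def sieve_level_def e_def W_def mult_left_mono)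
    qed
  qed
  then show ?thesis by blast
qed

text \<open>Otherwise each weight would be counted at most once by the six sums over primes, whose total could
  then not exceed the sum over all integers. After division by \<open>N / W\<close> the main terms are
  \<open>6 * 0.495 * 23 / 5040\<close> and \<open>67 / 5040\<close> times \<open>\<alpha>^6 * (ln R)^8\<close>, and the first is the larger one.\<close>

lemma two_primes_in_sextuple:
  assumes "Elliott_Halberstam"
  shows "\<exists>n\<ge>N0. \<exists>h\<in>sextuple. \<exists>h'\<in>sextuple. h \<noteq> h' \<and> prime (n + h) \<and> prime (n + h')"
proof (rule ccontr)
  assume none: "\<not> ?thesis"
  have few: "(\<Sum>h\<in>sextuple. if prime (n + h) then 1 else 0 :: real) \<le> 1" if n: "n \<ge> N0" for n
  proof -
    have "card {h \<in> sextuple. prime (n + h)} \<le> Suc 0"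
      using none n by (subst card_le_Suc0_iff_eq) (auto simp: card_sextuple)
    then show ?thesis using card_sextuple(1) by (simp add: sum.If_cases Int_def)
  qed
  \<comment> \<open>The margin of the method is about 2 percent; \<open>w\<close> is so large that the sieve loses
    less than half a percent.\<close>
  have "exp (1 / 500 :: real) \<le> 1 + 1 / 500 + (1 / 500)\<^sup>2" by (rule exp_bound) auto
  then have "16 \<le> (36000::nat) \<and> exp (72 / real 36000) \<le> 1.005" by (simp add: power2_eq_square)
  then obtain w :: nat where w: "16 \<le> w" "exp (72 / real w) \<le> 1.005" by blast
  have w12: "12 \<le> w" using w by simp
  define W where "W = primes_prod w"
  define \<alpha> where "\<alpha> = sieve_density {..w}"
  define \<phi> where "\<phi> = real (totient W)"
  have W: "real W > 0" using primes_prod_pos[of w] by (simp add: W_def)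
  have \<phi>: "\<phi> > 0" using W by (simp add: \<phi>_def)
  have \<alpha>: "\<alpha> > 0" "\<alpha> = \<phi> / real W"
    using sieve_density_pos[of "{..w}"] sieve_density_eq_totient[of w] by (simp_all add: \<alpha>_def \<phi>_def W_def)
  obtain b where b: "\<And>h. h \<in> sextuple \<Longrightarrow> coprime (b + h) (primes_prod w)"
    using sextuple_admissible by blast
  obtain D where D: "D \<ge> 0" "\<And>R. R \<ge> exp 1 \<Longrightarrow> form_all w R \<le>
    exp (72 / real w) * sieve_density {..w} ^ 6 * (67 / 5040) * ln R ^ 8 + D * ln R ^ 7"
    using gpy_form_all_upper[OF w12] by blast
  obtain B where ev1: "eventually (\<lambda>N. \<forall>h\<le>16. error_primes w N h \<le> B * real N) sequentially"
    using gpy_error_primes[OF assms w12] by blast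
  \<comment> \<open>\<open>M\<close> collects the error terms, relative to \<open>N / W\<close>. Beyond the threshold \<open>x\<close> for
    \<open>ln R\<close> the surplus of the main terms, of order \<open>(ln R)^8\<close>, exceeds \<open>M\<close> and the lower-order
    term of the form over all integers.\<close>
  define M where "M = real W * (1 + 6 * \<bar>B\<bar>)"
  have M: "M \<ge> 0" unfolding M_def using W by simp
  define x where "x = (D + M) / (0.0001 * \<alpha> ^ 6)"
  have ev2: "eventually (\<lambda>N. sieve_level N \<ge> exp 1) sequentially"
    unfolding sieve_level_def by real_asymp
  \<comment> \<open>16, the largest shift, bounds the number of primes lost by shifting the interval.\<close>
  have ev3: "eventually (\<lambda>N. 0.997 * real N / ln (real N) - 16 \<ge> 0.996 * real N / ln (real N)) sequentially"
    by real_asymp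
  have ev4: "eventually (\<lambda>N. 0.495 * ln (real N) > x) sequentially" by real_asymp
  have ev5: "eventually (\<lambda>N. N \<ge> max N0 2) sequentially" by (rule eventually_ge_at_top)
  have "eventually (\<lambda>N. (\<forall>h\<le>16. error_primes w N h \<le> B * real N) \<and> error_all w N \<le> real N \<and>
      sieve_level N \<ge> exp 1 \<and> 0.997 * real N / ln (real N) - 16 \<ge> 0.996 * real N / ln (real N) \<and>
      0.495 * ln (real N) > x \<and> N \<ge> max N0 2) sequentially"
    by (intro eventually_conj ev1 gpy_error_all[OF w12] ev2 ev3 ev4 ev5)
  then obtain N1 where "\<forall>N\<ge>N1. (\<forall>h\<le>16. error_primes w N h \<le> B * real N) \<and> error_all w N \<le> real N \<and>
      sieve_level N \<ge> exp 1 \<and> 0.997 * real N / ln (real N) - 16 \<ge> 0.996 * real N / ln (real N) \<and>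
      0.495 * ln (real N) > x \<and> N \<ge> max N0 2"
    unfolding eventually_at_top_linorder by blast
  moreover obtain N where N: "N \<ge> N1" "0.997 * real N / ln (real N) \<le> real (card {p. N < p \<and> p \<le> 2 * N \<and> prime p})"
    using dyadic_primes_lower[of "0.997" N1] by auto
  ultimately have err_primes: "\<And>h. h \<le> 16 \<Longrightarrow> error_primes w N h \<le> B * real N"
    and err_all: "error_all w N \<le> real N"
    and level: "sieve_level N \<ge> exp 1"
    and dyadic: "0.997 * real N / ln (real N) - 16 \<ge> 0.996 * real N / ln (real N)"
    and large: "0.495 * ln (real N) > x" "N \<ge> max N0 2"
    by auto
  define R where "R = sieve_level N"
  let ?sq = "\<lambda>n. (\<Sum>S | S \<in> rough w R \<and> hits sextuple S n. gpy_weight w R S)\<^sup>2"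
  define S1 where "S1 = (\<Sum>n | n \<in> {N<..2 * N} \<and> [n = b] (mod W). ?sq n)"
  define S2 where "S2 = (\<lambda>h. \<Sum>n | n \<in> {N<..2 * N} \<and> [n = b] (mod W). (if prime (n + h) then 1 else 0) * ?sq n)"
  define l where "l = 0.495 * ln (real N)"
  have R: "R \<ge> exp 1" using level by (simp add: R_def)
  have N2: "N \<ge> N0" "N \<ge> 2" using large by auto
  have lnR: "ln R = l" unfolding R_def sieve_level_def l_def using N2 by (simp add: ln_powr)
  have l: "l \<ge> 1" unfolding lnR[symmetric] using R by (rule ln_ge_one)
  have lx: "l > x" using large by (simp add: l_def)
  have RN: "R \<le> real N" unfolding R_def sieve_level_def using N2 powr_mono[of "0.495" 1 "real N"] by simp
  have spread: "h \<le> h' + w" if "h \<in> sextuple" "h' \<in> sextuple" for h h'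
    using sextuple_le[OF that(1)] w(1) by linarith
  have upper: "S1 \<le> real N / real W * form_all w R + real N"
  proof -
    have "S1 \<le> real N / real W * lcm_form (rough w R) (gpy_weight w R) (\<lambda>p. real (card sextuple) / real p) +
        lcm_error (rough w R) (gpy_weight w R) (\<lambda>Q. real (card sextuple) ^ card Q * 2)"
      unfolding S1_def W_def by (rule sieve_sum_upper[OF card_sextuple(1) spread])
    also have "\<dots> = real N / real W * form_all w R + error_all w N"
      by (simp add: card_sextuple form_all_def error_all_def R_def Let_def)
    finally show ?thesis using err_all by linarith
  qed
  define \<delta> where "\<delta> = 0.996 * real N / ln (real N)"
  have \<delta>0: "\<delta> \<ge> 0" unfolding \<delta>_def using N2 by simp
  let ?main = "\<delta> / \<phi> * (\<alpha> ^ 7 * (23 / 5040) * l ^ 9)"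
  have G2: "\<alpha> ^ 7 * (23 / 5040) * l ^ 9 \<le> form_primes w R"
    using gpy_form_primes_lower[OF w12 R] unfolding \<alpha>_def lnR .
  have lower: "?main - \<bar>B\<bar> * real N \<le> S2 h" if h: "h \<in> sextuple" for h
  proof -
    define \<Delta> where "\<Delta> = real (primes_pi (real (2 * N + h))) - real (primes_pi (real (N + h)))"
    have h16: "h \<le> 16" using h by (rule sextuple_le)
    have "0.997 * real N / ln (real N) - 16 \<le> \<Delta>"
      unfolding \<Delta>_def using primes_shifted_dyadic[of N h] N(2) h16 by linarith
    then have \<Delta>: "\<delta> \<le> \<Delta>" unfolding \<delta>_def using dyadic by linarith
    have "\<Delta> / \<phi> * form_primes w R - error_primes w N h \<le> S2 h"
      using sieve_sum_primes_lower[OF card_sextuple(1) spread h b[OF h] _ RN, of "gpy_weight w R"] w(1)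
      by (simp add: card_sextuple form_primes_def error_primes_def Let_def R_def S2_def W_def \<Delta>_def \<phi>_def)
    moreover have "error_primes w N h \<le> B * real N" using h16 by (rule err_primes)
    moreover have "B * real N \<le> \<bar>B\<bar> * real N" by (intro mult_right_mono) auto
    moreover have "?main \<le> \<Delta> / \<phi> * form_primes w R"
      using \<Delta> \<delta>0 \<phi> \<alpha>(1) l G2 by (intro mult_mono divide_right_mono) auto
    ultimately show ?thesis by linarith
  qed
  have "6 * (?main - \<bar>B\<bar> * real N) =
      (\<Sum>h\<in>sextuple. ?main - \<bar>B\<bar> * real N)"
    by (simp add: card_sextuple)
  also have "\<dots> \<le> (\<Sum>h\<in>sextuple. S2 h)" by (rule sum_mono[OF lower])
  also have "\<dots> = (\<Sum>n | n \<in> {N<..2 * N} \<and> [n = b] (mod W). 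
      (\<Sum>h\<in>sextuple. if prime (n + h) then 1 else 0) * ?sq n)"
    unfolding S2_def sum_distrib_right by (rule sum.swap)
  also have "\<dots> \<le> (\<Sum>n | n \<in> {N<..2 * N} \<and> [n = b] (mod W). 1 * ?sq n)"
    using N2 by (intro sum_mono mult_right_mono few) auto
  also have "\<dots> = S1" by (simp add: S1_def)
  also have "\<dots> \<le> real N / real W * form_all w R + real N" by (rule upper)
  also have "\<dots> \<le> real N / real W * (1.005 * \<alpha> ^ 6 * (67 / 5040) * l ^ 8 + D * l ^ 7) + real N"
  proof (intro add_mono mult_left_mono)
    have "form_all w R \<le> exp (72 / real w) * \<alpha> ^ 6 * (67 / 5040) * l ^ 8 + D * l ^ 7"
      using D(2)[OF R] unfolding \<alpha>_def lnR .
    also have "\<dots> \<le> 1.005 * \<alpha> ^ 6 * (67 / 5040) * l ^ 8 + D * l ^ 7"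
      using w(2) \<alpha>(1) l by (intro add_mono mult_right_mono) auto
    finally show "form_all w R \<le> 1.005 * \<alpha> ^ 6 * (67 / 5040) * l ^ 8 + D * l ^ 7" .
  qed auto
  finally have ineq: "6 * (?main - \<bar>B\<bar> * real N) \<le>
      real N / real W * (1.005 * \<alpha> ^ 6 * (67 / 5040) * l ^ 8 + D * l ^ 7) + real N" .
  define y where "y = \<alpha> ^ 6 * l ^ 8"
  have main: "?main = real N / real W * (0.996 * 0.495 * (23 / 5040) * y)"
  proof -
    have "ln (real N) > 0" using N2 by simp
    then have 1: "\<delta> * l = 0.996 * 0.495 * real N" by (simp add: \<delta>_def l_def)
    have 2: "\<alpha> / \<phi> = 1 / real W" using \<alpha>(2) \<phi> W by simp
    have "?main = (\<delta> * l) * (\<alpha> / \<phi>) * ((23 / 5040) * y)"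
      by (simp add: y_def eval_nat_numeral)
    also have "\<dots> = (0.996 * 0.495 * real N) * (1 / real W) * ((23 / 5040) * y)"
      by (simp only: 1 2)
    finally show ?thesis by (simp add: mult_ac)
  qed
  have compare: "6 * (0.996 * 0.495 * (23 / 5040) * y) \<le> 1.005 * (67 / 5040) * y + D * l ^ 7 + M"
  proof -
    have "real N / real W * (6 * (0.996 * 0.495 * (23 / 5040) * y)) \<le>
        real N / real W * (1.005 * (67 / 5040) * y + D * l ^ 7) + real N * (1 + 6 * \<bar>B\<bar>)"
    proof -
      have "1.005 * \<alpha> ^ 6 * (67 / 5040) * l ^ 8 = 1.005 * (67 / 5040) * y" by (simp add: y_def)
      moreover have "k * (6 * a) \<le> k * c + r * (1 + 6 * s)" if "6 * (k * a - s * r) \<le> k * c + r" for k a c r s :: real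
        using that by (simp add: algebra_simps)
      ultimately show ?thesis using ineq unfolding main by metis
    qed
    also have "real N * (1 + 6 * \<bar>B\<bar>) = real N / real W * M" using W by (simp add: M_def)
    finally have "real N / real W * (6 * (0.996 * 0.495 * (23 / 5040) * y)) \<le>
        real N / real W * (1.005 * (67 / 5040) * y + D * l ^ 7 + M)" by (simp only: distrib_left)
    moreover have "real N / real W > 0" using N2 W by simp
    ultimately show ?thesis by (rule mult_left_le_imp_le)
  qed
  \<comment> \<open>Both constants over a common denominator: this is where the sieve wins,
    \<open>6 * 0.996 * 0.495 * 23 > 1.005 * 67\<close>.\<close>
  have "0.0001 * y \<le> 6803676 / 504000000 * y - 6733500 / 504000000 * y"
    unfolding y_def using \<alpha>(1) l by simp
  also have "\<dots> = 6 * (0.996 * 0.495 * (23 / 5040) * y) - 1.005 * (67 / 5040) * y" by simp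
  also have "\<dots> \<le> D * l ^ 7 + M" using compare by (simp only: diff_le_eq add_ac)
  finally have "0.0001 * y \<le> D * l ^ 7 + M" .
  also have "D * l ^ 7 + M \<le> (D + M) * l ^ 7"
    using mult_left_mono[OF one_le_power[OF l, of 7] M] by (simp add: distrib_right)
  also have "\<dots> < 0.0001 * \<alpha> ^ 6 * l * l ^ 7"
  proof (rule mult_strict_right_mono)
    show "D + M < 0.0001 * \<alpha> ^ 6 * l" using lx \<alpha>(1) by (simp add: x_def divide_less_eq mult.commute)
  qed (use l in simp)
  also have "\<dots> = 0.0001 * y" by (simp add: y_def eval_nat_numeral)
  finally show False by simp
qed

theorem theorem1p3:
  assumes "Elliott_Halberstam"
  shows "infinite {(p::nat, q::nat). prime p \<and> prime q \<and> int p - int q \<in> smooth_ints 5}"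
proof
  define X where "X = {(p::nat, q::nat). prime p \<and> prime q \<and> int p - int q \<in> smooth_ints 5}"
  assume "finite {(p::nat, q::nat). prime p \<and> prime q \<and> int p - int q \<in> smooth_ints 5}"
  then have "finite (fst ` X)" by (simp add: X_def)
  then obtain N0 where bound: "\<forall>p\<in>fst ` X. p < N0" unfolding finite_nat_set_iff_bounded by blast
  obtain n h h' where n: "n \<ge> N0" and h: "h \<in> sextuple" "h' \<in> sextuple" "h \<noteq> h'" "prime (n + h)" "prime (n + h')"
    using two_primes_in_sextuple[OF assms] by blast
  have "(n + h, n + h') \<in> X" using sextuple_diff_smooth[OF h(1-3)] h(4,5) by (simp add: X_def)
  then have "n + h \<in> fst ` X" by (metis fst_conv imageI)
  then show False using bound n by fastforce
qed

end
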